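(* Let $n$, $N$, $m$, $p$ be positive integers, let $A_1,\dots,A_N\in\mathbb{R}^{n\times n}$, and let $r$ be a continuous-time (time-homogeneous) Markov process taking values in $\{1,\dots,N\}$ with infinitesimal generator $Q\in\mathbb{R}^{N\times N}$. Let $\Sigma$ be the Markov jump linear system $dx/dt=A_{r(t)}x(t)$, $x(0)=x_0$. Let $W_1,\dots,W_N\in\mathbb{R}^{m\times m}$, and assume that the deterministic switched linear system $\Sigma_{d,W}:\ dy/dt=W_{\sigma(t)}y(t)$, $y(0)=y_0$, is stable. If the matrix $$\hat{\mathcal T}=Q^\top\otimes I_{(mn)_p}+\operatorname{diag}\big((W_1\oplus A_1)_{[p]},\dots,(W_N\oplus A_N)_{[p]}\big)$$ is not Hurwitz stable, then $\Sigma$ is not exponentially $p$th mean stable.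
   Context: $\|\cdot\|$ is the Euclidean norm of vectors. $I_k$ is the $k\times k$ identity matrix, $\otimes$ is the Kronecker product, and $\operatorname{diag}(M_1,\dots,M_N)$ is the block-diagonal matrix with diagonal blocks $M_1,\dots,M_N$. For square matrices $A$ (of order $n$) and $B$ (of order $m$), the Kronecker sum is $A\oplus B=A\otimes I_m+I_n\otimes B$; thus $W_i\oplus A_i=W_i\otimes I_n+I_m\otimes A_i$. A real square matrix is Hurwitz stable if all its eigenvalues have negative real part. For positive integers $k,p$ put $k_p=\binom{k+p-1}{p}$. For $x\in\mathbb{R}^k$, $x^{[p]}\in\mathbb{R}^{k_p}$ is the vector whose entries are all the monomials of degree $p$ in $x_1,\dots,x_k$, in lexicographic order, with positive coefficients chosen so that $\|x^{[p]}\|=\|x\|^p$ (i.e. the coefficient of $x_1^{\alpha_1}\cdots x_k^{\alpha_k}$ is $\sqrt{p!/(\alpha_1!\cdots\alpha_k!)}$). For $A\in\mathbb{R}^{k\times k}$, $A_{[p]}$ is the unique $k_p\times k_p$ matrix such that whenever an $\mathbb{R}^k$-valued function $x$ satisfies $dx/dt=Ax$, the function $x^{[p]}$ satisfies $dx^{[p]}/dt=A_{[p]}x^{[p]}$. The Markov jump linear system $\Sigma$ is exponentially $p$th mean stable if there exist constants $C,\beta>0$ such that $\mathbb{E}[\|x(t)\|^p]\le Ce^{-\beta t}\|x_0\|^p$ for all $x_0\in\mathbb{R}^n$, all initial modes $r(0)\in\{1,\dots,N\}$ and all $t\ge 0$. The deterministic switched linear system $dy/dt=W_{\sigma(t)}y(t)$,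 $y(0)=y_0$, is stable if there exists $C>0$ such that $\|y(t)\|\le C\|y_0\|$ for all $y_0\in\mathbb{R}^m$, all $t\ge0$ and all piecewise constant switching signals $\sigma:[0,\infty)\to\{1,\dots,N\}$. *)

theory Defs
  imports
    "HOL-Probability.Probability"
    "HOL-Library.List_Lexorder"
    "Jordan_Normal_Form.Char_Poly"
begin

unbundle no vec_syntax

definition eucl_norm :: "real vec \<Rightarrow> real" where
  "eucl_norm v = sqrt (\<Sum>j<dim_vec v. (v $ j)\<^sup>2)"

definition kron :: "'a::semiring_1 mat \<Rightarrow> 'a mat \<Rightarrow> 'a mat" where
  "kron A B = mat (dim_row A * dim_row B) (dim_col A * dim_col B)
     (\<lambda>(i, j). A $$ (i div dim_row B, j div dim_col B) * B $$ (i mod dim_row B, j mod dim_col B))"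

definition kron_sum :: "'a::semiring_1 mat \<Rightarrow> 'a mat \<Rightarrow> 'a mat" where
  "kron_sum A B = kron A (1\<^sub>m (dim_row B)) + kron (1\<^sub>m (dim_row A)) B"

definition hurwitz_stable :: "real mat \<Rightarrow> bool" where
  "hurwitz_stable A \<longleftrightarrow> (\<forall>z. eigenvalue (map_mat complex_of_real A) z \<longrightarrow> Re z < 0)"

text \<open>Vectors of type \<open>real vec\<close> carry no topology, so derivatives are taken entrywise.\<close>

definition has_vec_deriv :: "(real \<Rightarrow> real vec) \<Rightarrow> real vec \<Rightarrow> real \<Rightarrow> bool" where
  "has_vec_deriv x v t \<longleftrightarrow>
     (\<forall>j<dim_vec v. ((\<lambda>s. x s $ j) has_real_derivative v $ j) (at t))"

definition num_monomials :: "nat \<Rightarrow> nat \<Rightarrow> nat" where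
  "num_monomials k p = (k + p - 1) choose p"

text \<open>
  A monomial of degree \<open>p\<close> in \<open>k\<close> variables is represented by its list of exponents.  The list is
  reversed because in the lexicographic order of monomials the power \<open>x\<^sub>1^p\<close> comes first, although
  its exponent list \<open>[p, 0, \<dots>, 0]\<close> is the largest one.
\<close>

definition monomials :: "nat \<Rightarrow> nat \<Rightarrow> nat list list" where
  "monomials k p = rev (sorted_list_of_set {\<alpha>. length \<alpha> = k \<and> sum_list \<alpha> = p})"

definition vec_power :: "nat \<Rightarrow> real vec \<Rightarrow> real vec" where
  "vec_power p x = vec (num_monomials (dim_vec x) p)
     (\<lambda>j. let \<alpha> = monomials (dim_vec x) p ! j in
        sqrt (fact p / (\<Prod>l<dim_vec x. fact (\<alpha> ! l))) * (\<Prod>l<dim_vec x. (x $ l) ^ (\<alpha> ! l)))"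

definition mat_power_lift :: "nat \<Rightarrow> real mat \<Rightarrow> real mat" where
  "mat_power_lift p A = (THE B. B \<in> carrier_mat (num_monomials (dim_row A) p) (num_monomials (dim_row A) p) \<and>
     (\<forall>x. (\<forall>t. x t \<in> carrier_vec (dim_row A) \<and> has_vec_deriv x (A *\<^sub>v x t) t) \<longrightarrow>
        (\<forall>t. has_vec_deriv (\<lambda>s. vec_power p (x s)) (B *\<^sub>v vec_power p (x t)) t)))"

definition switching_times :: "(real \<Rightarrow> nat) \<Rightarrow> real set" where
  "switching_times \<sigma> = {t. 0 < t \<and> \<not> (\<forall>\<^sub>F s in nhds t. \<sigma> s = \<sigma> t)}"

definition piecewise_constant :: "(real \<Rightarrow> nat) \<Rightarrow> bool" where
  "piecewise_constant \<sigma> \<longleftrightarrow> (\<forall>T. finite (switching_times \<sigma> \<inter> {..T}))"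

text \<open>
  Solutions on \<open>[0, \<infinity>)\<close> of \<open>dx/dt = A\<^bsub>\<sigma>(t)\<^esub> x(t)\<close>, \<open>x(0) = x\<^sub>0\<close>, in the usual sense for switched
  systems: continuous, and satisfying the equation at every time that is not a switching time.
\<close>

definition switched_solution ::
    "(nat \<Rightarrow> real mat) \<Rightarrow> (real \<Rightarrow> nat) \<Rightarrow> real vec \<Rightarrow> (real \<Rightarrow> real vec) \<Rightarrow> bool" where
  "switched_solution A \<sigma> x0 x \<longleftrightarrow>
     x 0 = x0 \<and>
     (\<forall>t\<ge>0. x t \<in> carrier_vec (dim_vec x0)) \<and>
     (\<forall>j<dim_vec x0. continuous_on {0..} (\<lambda>t. x t $ j)) \<and>
     (\<forall>t>0. t \<notin> switching_times \<sigma> \<longrightarrow> has_vec_deriv x (A (\<sigma> t) *\<^sub>v x t) t)"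

text \<open>The modes \<open>1, \<dots>, N\<close> are numbered from 0, so that they index rows and columns of matrices.\<close>

definition switched_stable :: "nat \<Rightarrow> nat \<Rightarrow> (nat \<Rightarrow> real mat) \<Rightarrow> bool" where
  "switched_stable m N W \<longleftrightarrow>
     (\<exists>C>0. \<forall>y0 \<in> carrier_vec m. \<forall>\<sigma> y.
        (\<forall>t\<ge>0. \<sigma> t < N) \<longrightarrow> piecewise_constant \<sigma> \<longrightarrow> switched_solution W \<sigma> y0 y \<longrightarrow>
        (\<forall>t\<ge>0. eucl_norm (y t) \<le> C * eucl_norm y0))"

text \<open>
  A time-homogeneous Markov process on \<open>{..<N}\<close> is given as usual by a family of laws \<open>M i\<close>, one for
  each initial mode \<open>i\<close>.  The transition probability from \<open>i\<close> to \<open>j\<close> in time \<open>h\<close> is the probability of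
  \<open>r h = j\<close> under \<open>M i\<close>, and the generator is its right derivative at \<open>h = 0\<close>.
  Almost all paths are required to be piecewise constant, so that \<open>dx/dt = A\<^bsub>r(t)\<^esub> x\<close> makes sense
  pathwise; the values taken at the jump times are left free.
\<close>

definition markov_process ::
    "(nat \<Rightarrow> 'a measure) \<Rightarrow> (real \<Rightarrow> 'a \<Rightarrow> nat) \<Rightarrow> nat \<Rightarrow> real mat \<Rightarrow> bool" where
  "markov_process M r N Q \<longleftrightarrow>
     (\<forall>i<N. prob_space (M i)) \<and>
     (\<forall>i<N. \<forall>t\<ge>0. r t \<in> measurable (M i) (count_space {..<N})) \<and>
     (\<forall>i<N. AE \<omega> in M i. r 0 \<omega> = i) \<and>
     (\<forall>i<N. AE \<omega> in M i. piecewise_constant (\<lambda>t. r t \<omega>)) \<and>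
     (\<forall>i<N. \<forall>k. \<forall>\<tau> :: nat \<Rightarrow> real. \<forall>s :: nat \<Rightarrow> nat.
        0 \<le> \<tau> 0 \<longrightarrow> (\<forall>l\<le>k. \<tau> l < \<tau> (Suc l)) \<longrightarrow> (\<forall>l\<le>Suc k. s l < N) \<longrightarrow>
        \<P>(\<omega> in M i. \<forall>l\<le>k. r (\<tau> l) \<omega> = s l) > 0 \<longrightarrow>
        \<P>(\<omega> in M i. r (\<tau> (Suc k)) \<omega> = s (Suc k) \<bar> \<forall>l\<le>k. r (\<tau> l) \<omega> = s l) =
        \<P>(\<omega> in M (s k). r (\<tau> (Suc k) - \<tau> k) \<omega> = s (Suc k))) \<and>
     Q \<in> carrier_mat N N \<and>
     (\<forall>i<N. \<forall>j<N.
        ((\<lambda>h. (\<P>(\<omega> in M i. r h \<omega> = j) - (if i = j then 1 else 0)) / h) \<longlongrightarrow> Q $$ (i, j)) (at_right 0))"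

text \<open>
  The expectation of the nonnegative variable \<open>\<parallel>x(t)\<parallel>^p\<close> is a \<open>nn_integral\<close>, which unlike the Bochner
  integral does not default to 0 when the variable is not integrable.
\<close>

definition exp_mean_stable ::
    "nat \<Rightarrow> nat \<Rightarrow> nat \<Rightarrow> (nat \<Rightarrow> real mat) \<Rightarrow> (nat \<Rightarrow> 'a measure) \<Rightarrow> (real \<Rightarrow> 'a \<Rightarrow> nat) \<Rightarrow> bool" where
  "exp_mean_stable p n N A M r \<longleftrightarrow>
     (\<exists>C>0. \<exists>\<beta>>0. \<forall>x0 \<in> carrier_vec n. \<forall>i<N. \<forall>x.
        (AE \<omega> in M i. switched_solution A (\<lambda>t. r t \<omega>) x0 (\<lambda>t. x t \<omega>)) \<longrightarrow>
        (\<forall>t\<ge>0. (\<integral>\<^sup>+ \<omega>. ennreal (eucl_norm (x t \<omega>) ^ p) \<partial>M i)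
                  \<le> ennreal (C * exp (- \<beta> * t) * eucl_norm x0 ^ p)))"

end

theory Submission
  imports Defs
begin

text \<open>
  Write \<open>G\<^sub>i = W\<^sub>i \<oplus> A\<^sub>i\<close>.  If \<open>x\<close> and \<open>y\<close> follow \<open>A\<close> and \<open>W\<close> along the same path of the
  Markov process \<open>r\<close>, then \<open>y \<otimes> x\<close> follows \<open>G\<close>, and as \<open>W\<close> is stable along every path,
  \<open>\<parallel>y \<otimes> x\<parallel>\<close> is at most a constant times \<open>\<parallel>x\<parallel>\<close>.  Every vector of \<open>\<real>^(mn)\<close> is a sum of \<open>m\<close> products
  \<open>e\<^sub>k \<otimes> x\<^sub>k\<close>, so exponential \<open>p\<close>th mean stability of \<open>A\<close> passes to the system \<open>z' = G\<^bsub>r(t)\<^esub> z\<close>: from every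
  initial value, \<open>E \<parallel>z(t)\<parallel>^p \<rightarrow> 0\<close>.  Sums are essential here, because the powers \<open>(y \<otimes> x)^[p]\<close> of pure
  tensors do not in general span the same space as all \<open>p\<close>th powers \<open>z^[p]\<close>.

  Suppose that the matrix of the theorem has an eigenvalue \<open>\<mu>\<close> with \<open>Re \<mu> \<ge> 0\<close>, and let \<open>v\<close> be a left
  eigenvector, with blocks \<open>v\<^sub>i\<close>.  The homogeneous polynomials \<open>f\<^sub>i(z) = v\<^sub>i \<bullet> z^[p]\<close> then satisfy
  \<open>\<Sum>\<^sub>j Q\<^sub>i\<^sub>j f\<^sub>j(z) + D f\<^sub>i(z) (G\<^sub>i z) = \<mu> f\<^sub>i(z)\<close>, i.e. \<open>f\<close> is an eigenfunction of the generator of the Markov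
  process \<open>(r, z)\<close>.  Hence \<open>E f\<^bsub>r(t)\<^esub>(z(t))\<close> equals \<open>e^(\<mu> t) f\<^sub>i(z\<^sub>0)\<close> for the initial mode \<open>i\<close>, which
  has modulus at least \<open>\<bar>f\<^sub>i(z\<^sub>0)\<bar>\<close>; but it is bounded by a constant times \<open>E \<parallel>z(t)\<parallel>^p\<close>, which tends to 0.
  So all \<open>f\<^sub>i\<close> vanish identically, and since distinct monomials are linearly independent, \<open>v = 0\<close>.

  The lower bound on \<open>E f\<^bsub>r(t)\<^esub>(z(t))\<close> is obtained by discretisation, which uses the Markov property
  only along finite time grids.  With \<open>h = t/K\<close>, the Euler scheme
  \<open>z\<^bsub>l+1\<^esub> = (I + h G\<^bsub>r(lh)\<^esub>) z\<^sub>l\<close> depends on finitely many values of \<open>r\<close>, so its moments are finite sums.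
  One step multiplies \<open>E f\<close> by \<open>1 + \<mu> h\<close> up to an error \<open>o(h)\<close> (\<open>generator_step\<close>), and
  \<open>\<bar>1 + \<mu> h\<bar> \<ge> 1\<close>, so that after \<open>K\<close> steps the modulus has dropped by at most \<open>t o(1)\<close>
  (\<open>discrete_moment_lower_bound\<close>).  On each piecewise constant path the scheme converges to the
  trajectory as \<open>K \<rightarrow> \<infinity>\<close> (\<open>euler_converges\<close>), and dominated convergence gives the bound for the
  trajectory itself (\<open>moment_lower_bound\<close>).

  The definition of \<open>A\<^bsub>[p]\<^esub>\<close> by a unique description has to be justified: existence holds because the
  derivative of a homogeneous polynomial along a linear vector field is homogeneous of the same degree,
  uniqueness because every vector is the initial value of a solution and monomials are independent
  (\<open>mat_power_lift_derivation\<close>).  Finally, trajectories for given paths exist by gluing solutions with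
  constant coefficients at the switching times (\<open>traj_glued\<close>); they are measurable as limits of Euler
  schemes (\<open>traj_measurable\<close>).
\<close>

text \<open>
  In the analysis, vectors of \<open>\<real>^d\<close> are functions on \<open>nat\<close> of which only the values below \<open>d\<close> matter;
  so \<open>d\<close> can be a product of two dimensions, and entries have the topology of \<open>\<real>\<close>.
\<close>

definition mulv :: "nat \<Rightarrow> (nat \<Rightarrow> nat \<Rightarrow> real) \<Rightarrow> (nat \<Rightarrow> real) \<Rightarrow> nat \<Rightarrow> real" where
  "mulv d G z j = (\<Sum>l<d. G j l * z l)"

lemma mulv_cong: "(\<And>l. l < d \<Longrightarrow> z l = z' l) \<Longrightarrow> mulv d G z j = mulv d G z' j"
  by (simp add: mulv_def)

section \<open>Linear systems with constant coefficients\<close>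

text \<open>
  The matrix exponential \<open>e^(t G) x\<^sub>0\<close>, entrywise as a power series; \<open>flow_coeff\<close> is \<open>G^k x\<^sub>0\<close>.
\<close>

primrec flow_coeff :: "nat \<Rightarrow> (nat \<Rightarrow> nat \<Rightarrow> real) \<Rightarrow> (nat \<Rightarrow> real) \<Rightarrow> nat \<Rightarrow> nat \<Rightarrow> real" where
  "flow_coeff d G x0 0 = x0"
| "flow_coeff d G x0 (Suc k) = mulv d G (flow_coeff d G x0 k)"

definition flow :: "nat \<Rightarrow> (nat \<Rightarrow> nat \<Rightarrow> real) \<Rightarrow> (nat \<Rightarrow> real) \<Rightarrow> real \<Rightarrow> nat \<Rightarrow> real" where
  "flow d G x0 t j = (\<Sum>k. flow_coeff d G x0 k j / fact k * t ^ k)"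

lemma flow_zero [simp]: "flow d G x0 0 = x0"
  unfolding flow_def by (rule ext, subst powser_zero) simp

lemma flow_coeff_bound:
  obtains B M where "B \<ge> 0" "M \<ge> 0" "\<And>k j. j < d \<Longrightarrow> \<bar>flow_coeff d G x0 k j\<bar> \<le> M * B ^ k"
proof -
  define B where "B = (\<Sum>j<d. \<Sum>l<d. \<bar>G j l\<bar>)"
  define M where "M = (\<Sum>l<d. \<bar>x0 l\<bar>)"
  have B0: "B \<ge> 0" and M0: "M \<ge> 0" by (auto simp: B_def M_def intro!: sum_nonneg)
  have "\<bar>flow_coeff d G x0 k j\<bar> \<le> M * B ^ k" if "j < d" for k j
    using that
  proof (induction k arbitrary: j)
    case 0
    then show ?case by (auto simp: M_def intro: member_le_sum[where f = "\<lambda>l. \<bar>x0 l\<bar>"])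
  next
    case (Suc k)
    have "\<bar>flow_coeff d G x0 (Suc k) j\<bar> \<le> (\<Sum>l<d. \<bar>G j l * flow_coeff d G x0 k l\<bar>)"
      unfolding flow_coeff.simps mulv_def by (rule sum_abs)
    also have "\<dots> \<le> (\<Sum>l<d. \<bar>G j l\<bar> * (M * B ^ k))"
      by (intro sum_mono) (auto simp: abs_mult intro!: mult_left_mono Suc.IH)
    also have "\<dots> = (\<Sum>l<d. \<bar>G j l\<bar>) * (M * B ^ k)"
      by (simp add: sum_distrib_right)
    also have "\<dots> \<le> B * (M * B ^ k)"
    proof (rule mult_right_mono)
      show "(\<Sum>l<d. \<bar>G j l\<bar>) \<le> B" unfolding B_def
        using Suc.prems by (intro member_le_sum[where f = "\<lambda>j. \<Sum>l<d. \<bar>G j l\<bar>"]) (auto intro: sum_nonneg)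
    qed (use B0 M0 in auto)
    finally show ?case by (simp add: mult_ac)
  qed
  with B0 M0 show ?thesis using that by blast
qed

lemma flow_summable:
  assumes "j < d"
  shows "summable (\<lambda>k. flow_coeff d G x0 k j / fact k * (t::real) ^ k)"
proof -
  obtain B M where B: "B \<ge> 0" "M \<ge> 0" "\<And>k j. j < d \<Longrightarrow> \<bar>flow_coeff d G x0 k j\<bar> \<le> M * B ^ k"
    using flow_coeff_bound[of d G x0] by blast
  have "summable (\<lambda>k. M * ((B * \<bar>t\<bar>) ^ k / fact k))"
    by (intro summable_mult) (use summable_exp[of "B * \<bar>t\<bar>"] in \<open>simp add: divide_inverse mult_ac\<close>)
  then show ?thesis
  proof (rule summable_comparison_test')
    fix k
    show "norm (flow_coeff d G x0 k j / fact k * t ^ k) \<le> M * ((B * \<bar>t\<bar>) ^ k / fact k)"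
      using mult_right_mono[OF B(3)[OF assms, of k], of "\<bar>t\<bar> ^ k / fact k"]
      by (simp add: abs_mult power_abs power_mult_distrib)
  qed
qed

lemma flow_deriv:
  assumes "j < d"
  shows "((\<lambda>t. flow d G x0 t j) has_real_derivative mulv d G (flow d G x0 t) j) (at t)"
proof -
  let ?c = "\<lambda>j k. flow_coeff d G x0 k j / fact k"
  have 1: "((\<lambda>t. flow d G x0 t j) has_real_derivative (\<Sum>k. diffs (?c j) k * t ^ k)) (at t)"
    unfolding flow_def
    by (rule termdiffs_strong_converges_everywhere) (rule flow_summable[OF assms])
  have 2: "diffs (?c j) k * t ^ k = (\<Sum>l<d. G j l * (?c l k * t ^ k))" for k
  proof -
    have "diffs (?c j) k = flow_coeff d G x0 (Suc k) j / fact k"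
      by (simp add: diffs_def fact_Suc del: flow_coeff.simps of_nat_Suc)
    also have "\<dots> = (\<Sum>l<d. G j l * ?c l k)"
      by (simp add: mulv_def sum_divide_distrib)
    finally show ?thesis by (simp add: sum_distrib_left sum_distrib_right field_simps)
  qed
  have "(\<Sum>k. diffs (?c j) k * t ^ k) = (\<Sum>l<d. \<Sum>k. G j l * (?c l k * t ^ k))"
    unfolding 2 by (rule suminf_sum) (intro summable_mult flow_summable, simp)
  also have "\<dots> = mulv d G (flow d G x0 t) j"
    unfolding mulv_def flow_def by (intro sum.cong refl suminf_mult flow_summable) simp
  finally show ?thesis using 1 by simp
qed

section \<open>Trajectories of switched linear systems\<close>

text \<open>
  The analogue of \<open>switched_solution\<close> for vectors represented as functions; it fixes no initial value.
\<close>

definition traj :: "nat \<Rightarrow> (nat \<Rightarrow> nat \<Rightarrow> nat \<Rightarrow> real) \<Rightarrow> (real \<Rightarrow> nat) \<Rightarrow> (real \<Rightarrow> nat \<Rightarrow> real) \<Rightarrow> bool" where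
  "traj d G \<sigma> z \<longleftrightarrow>
     (\<forall>j<d. continuous_on {0..} (\<lambda>t. z t j)) \<and>
     (\<forall>t>0. t \<notin> switching_times \<sigma> \<longrightarrow>
        (\<forall>j<d. ((\<lambda>s. z s j) has_real_derivative mulv d (G (\<sigma> t)) (z t) j) (at t)))"

lemma signal_const_between_switches:
  assumes "{a<..<b} \<inter> switching_times \<sigma> = {}" "0 \<le> a" "s \<in> {a<..<b}" "t \<in> {a<..<b}"
  shows "\<sigma> s = \<sigma> t"
proof (rule connected_local_const[of "{a<..<b}" s t \<sigma>])
  show "\<forall>x\<in>{a<..<b}. \<forall>\<^sub>F y in at x within {a<..<b}. \<sigma> x = \<sigma> y"
  proof
    fix x assume x: "x \<in> {a<..<b}"
    with assms have "x > 0" "x \<notin> switching_times \<sigma>" by auto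
    then have "\<forall>\<^sub>F y in nhds x. \<sigma> y = \<sigma> x" by (auto simp: switching_times_def)
    then show "\<forall>\<^sub>F y in at x within {a<..<b}. \<sigma> x = \<sigma> y"
      by (auto simp: eventually_at_filter elim: eventually_mono)
  qed
qed (use assms in auto)

text \<open>
  Time 0 stands in for the last switch when there has been none, since gluing starts there.
\<close>

definition last_switch :: "(real \<Rightarrow> nat) \<Rightarrow> real \<Rightarrow> real" where
  "last_switch \<sigma> t = Max (insert 0 (switching_times \<sigma> \<inter> {0<..<t}))"

lemma finite_switches: "piecewise_constant \<sigma> \<Longrightarrow> finite (switching_times \<sigma> \<inter> {a<..<b})"
  unfolding piecewise_constant_def by (rule finite_subset[of _ "switching_times \<sigma> \<inter> {..b}"]) auto

lemma last_switch_bounds: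
  assumes "piecewise_constant \<sigma>" "0 < t"
  shows "0 \<le> last_switch \<sigma> t" "last_switch \<sigma> t < t"
    "{last_switch \<sigma> t<..<t} \<inter> switching_times \<sigma> = {}"
proof -
  let ?S = "insert 0 (switching_times \<sigma> \<inter> {0<..<t})"
  have fin: "finite ?S" using finite_switches[OF assms(1)] by simp
  show 0: "0 \<le> last_switch \<sigma> t" unfolding last_switch_def using fin by simp
  show "last_switch \<sigma> t < t" unfolding last_switch_def using fin assms(2) by auto
  show "{last_switch \<sigma> t<..<t} \<inter> switching_times \<sigma> = {}"
  proof (rule ccontr)
    assume "\<not> ?thesis"
    then obtain s where s: "last_switch \<sigma> t < s" "s < t" "s \<in> switching_times \<sigma>" by auto
    with 0 have "s \<in> ?S" by auto
    then have "s \<le> last_switch \<sigma> t" unfolding last_switch_def using fin by (intro Max_ge) auto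
    with s show False by simp
  qed
qed

lemma last_switch_eqI:
  assumes "a = 0 \<or> a \<in> switching_times \<sigma>" "0 \<le> a" "a < t" "{a<..<t} \<inter> switching_times \<sigma> = {}"
    "piecewise_constant \<sigma>"
  shows "last_switch \<sigma> t = a"
  unfolding last_switch_def
proof (rule Max_eqI)
  show "finite (insert 0 (switching_times \<sigma> \<inter> {0<..<t}))" using finite_switches[OF assms(5)] by simp
  show "a \<in> insert 0 (switching_times \<sigma> \<inter> {0<..<t})"
    using assms by (auto simp: switching_times_def)
  show "y \<le> a" if "y \<in> insert 0 (switching_times \<sigma> \<inter> {0<..<t})" for y
    using that assms(2,4) by (cases "y \<le> a") (auto simp: disjoint_iff)
qed

lemma last_switch_cases: "piecewise_constant \<sigma> \<Longrightarrow> last_switch \<sigma> t = 0 \<or> last_switch \<sigma> t \<in> switching_times \<sigma>"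
  unfolding last_switch_def
  using Max_in[of "insert 0 (switching_times \<sigma> \<inter> {0<..<t})"] finite_switches[of \<sigma> 0 t] by auto

context
  fixes d :: nat and G :: "nat \<Rightarrow> nat \<Rightarrow> nat \<Rightarrow> real" and \<sigma> :: "real \<Rightarrow> nat" and x0 :: "nat \<Rightarrow> real"
begin

text \<open>
  On an interval between two switches, the glued trajectory restarts the flow from its own value at the
  left end.  The mode is read off at the midpoint, because the value of \<open>\<sigma>\<close> at a switching time need
  not agree with its value on either side.  The recursion ends as each step removes a switching time; for
  signals with infinitely many switches before \<open>t\<close> the value is arbitrary.
\<close>

function glued :: "real \<Rightarrow> nat \<Rightarrow> real" where
  "glued t = (let a = last_switch \<sigma> t in
     flow d (G (\<sigma> ((a + t) / 2)))
       (if finite (switching_times \<sigma> \<inter> {0<..<t}) \<and> a > 0 then glued a else x0) (t - a))"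
  by auto
termination
proof (relation "Wellfounded.measure (\<lambda>t. card (switching_times \<sigma> \<inter> {0<..<t}))", simp)
  fix t a assume a: "a = last_switch \<sigma> t" and *: "finite (switching_times \<sigma> \<inter> {0<..<t}) \<and> 0 < a"
  have "last_switch \<sigma> t \<in> insert 0 (switching_times \<sigma> \<inter> {0<..<t})"
    unfolding last_switch_def by (rule Max_in) (use * in auto)
  with a * have "a \<in> switching_times \<sigma> \<inter> {0<..<t}" by auto
  then show "(a, t) \<in> Wellfounded.measure (\<lambda>t. card (switching_times \<sigma> \<inter> {0<..<t}))"
    using * by (auto intro!: psubset_card_mono)
qed

declare glued.simps [simp del]

lemma glued_zero: "glued 0 = x0"
  by (subst glued.simps) (simp add: last_switch_def)

text \<open>
  The right end \<open>t\<close> may itself be a switching time: this gives continuity from the left there, and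
  continuity from the right comes from the piece that starts at \<open>t\<close>.
\<close>

lemma glued_piece:
  assumes "piecewise_constant \<sigma>" "a = 0 \<or> a \<in> switching_times \<sigma>" "0 \<le> a" "a < t" "{a<..<t} \<inter> switching_times \<sigma> = {}"
    "u \<in> {a<..<t}"
  shows "glued t = flow d (G (\<sigma> u)) (glued a) (t - a)"
proof -
  have l: "last_switch \<sigma> t = a" using last_switch_eqI[OF assms(2-5,1)] .
  have s: "\<sigma> ((a + t) / 2) = \<sigma> u"
    using assms(3-6) by (intro signal_const_between_switches[of a t]) auto
  have "(if finite (switching_times \<sigma> \<inter> {0<..<t}) \<and> a > 0 then glued a else x0) = glued a"
    using finite_switches[OF assms(1)] assms(3) glued_zero by auto
  then show ?thesis by (subst glued.simps) (simp add: l s Let_def)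
qed

lemma switch_gap:
  assumes "piecewise_constant \<sigma>"
  obtains b where "b > t" "{t<..<b} \<inter> switching_times \<sigma> = {}"
proof -
  have "finite (switching_times \<sigma> \<inter> {t<..<t + 1})" by (rule finite_switches[OF assms])
  define S where "S = insert (t + 1) (switching_times \<sigma> \<inter> {t<..<t + 1})"
  have S: "finite S" "S \<noteq> {}" unfolding S_def using finite_switches[OF assms] by auto
  have 1: "Min S > t" using S by (auto simp: S_def)
  have 2: "{t<..<Min S} \<inter> switching_times \<sigma> = {}"
  proof (rule ccontr)
    assume "\<not> ?thesis"
    then obtain s where s: "t < s" "s < Min S" "s \<in> switching_times \<sigma>" by auto
    have "Min S \<le> t + 1" using S by (auto simp: S_def)
    with s have "s \<in> S" by (auto simp: S_def)
    then have "Min S \<le> s" using S by simp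
    with s show False by simp
  qed
  show ?thesis using that[OF 1 2] .
qed

lemma traj_glued:
  assumes pc: "piecewise_constant \<sigma>"
  shows "traj d G \<sigma> glued"
proof -
  have fl_isCont: "isCont (\<lambda>s. flow d A y (s - a) j) s" if "j < d" for A y a j s
  proof -
    have "isCont (\<lambda>s. flow d A y s j) (s - a)" by (rule DERIV_isCont[OF flow_deriv[OF that]])
    then show ?thesis by (rule isCont_o2[rotated]) auto
  qed
  have deriv: "((\<lambda>s. glued s j) has_real_derivative mulv d (G (\<sigma> t)) (glued t) j) (at t)"
    if t: "t > 0" "t \<notin> switching_times \<sigma>" and j: "j < d" for t j
  proof -
    define a where "a = last_switch \<sigma> t"
    note a = last_switch_bounds[OF pc t(1), folded a_def]
    obtain b where b: "b > t" "{t<..<b} \<inter> switching_times \<sigma> = {}" using switch_gap[OF pc, of t] by blast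
    have ab: "{a<..<b} \<inter> switching_times \<sigma> = {}"
    proof (rule ccontr)
      assume "\<not> ?thesis"
      then obtain s where s: "a < s" "s < b" "s \<in> switching_times \<sigma>" by auto
      consider "s < t" | "s = t" | "t < s" by linarith
      then show False using s a(3) b(2) t(2) by cases auto
    qed
    have eq: "glued s = flow d (G (\<sigma> t)) (glued a) (s - a)" if "s \<in> {a<..<b}" for s
    proof -
      have "{a<..<s} \<inter> switching_times \<sigma> = {}" using ab that by fastforce
      then have "glued s = flow d (G (\<sigma> ((a + s) / 2))) (glued a) (s - a)"
        using that a last_switch_cases[OF pc, of t, folded a_def]
        by (intro glued_piece[OF pc]) auto
      moreover have "\<sigma> ((a + s) / 2) = \<sigma> t"
        using signal_const_between_switches[OF ab a(1), of "(a + s) / 2" t] that a b by auto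
      ultimately show ?thesis by simp
    qed
    have "((\<lambda>s. flow d (G (\<sigma> t)) (glued a) (s - a) j) has_real_derivative
           mulv d (G (\<sigma> t)) (flow d (G (\<sigma> t)) (glued a) (t - a)) j * 1) (at t)"
      by (rule DERIV_chain2[OF flow_deriv[OF j]]) (auto intro!: derivative_eq_intros)
    then have "((\<lambda>s. flow d (G (\<sigma> t)) (glued a) (s - a) j) has_real_derivative
           mulv d (G (\<sigma> t)) (glued t) j) (at t)"
      using eq[of t] a b by simp
    then show ?thesis
      by (rule DERIV_cong_ev[THEN iffD1, rotated 3])
        (use eq a b in \<open>auto intro!: eventually_nhds_in_open[THEN eventually_mono, of "{a<..<b}"]\<close>)
  qed
  have cont: "continuous (at t within {0..}) (\<lambda>t. glued t j)" if t: "t \<ge> 0" and j: "j < d" for t j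
  proof (cases "t > 0 \<and> t \<notin> switching_times \<sigma>")
    case True
    then show ?thesis using DERIV_isCont[OF deriv[of t j]] j continuous_at_imp_continuous_within by blast
  next
    case False
    then have ts: "t = 0 \<or> t \<in> switching_times \<sigma>" using t by auto
    obtain b where b: "b > t" "{t<..<b} \<inter> switching_times \<sigma> = {}" using switch_gap[OF pc, of t] by blast
    let ?F = "\<lambda>s. flow d (G (\<sigma> ((t + b) / 2))) (glued t) (s - t) j"
    have eq: "glued s j = ?F s" if "s \<in> {t<..<b}" for s
    proof -
      have "{t<..<s} \<inter> switching_times \<sigma> = {}" using b that by fastforce
      then have "glued s = flow d (G (\<sigma> ((t + s) / 2))) (glued t) (s - t)"
        using that t ts by (intro glued_piece[OF pc]) auto
      moreover have "\<sigma> ((t + s) / 2) = \<sigma> ((t + b) / 2)"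
        using signal_const_between_switches[OF b(2) t, of "(t + s) / 2" "(t + b) / 2"] that b by auto
      ultimately show ?thesis by simp
    qed
    have "(?F \<longlongrightarrow> ?F t) (at_right t)"
      using fl_isCont[OF j] unfolding isCont_def filterlim_at_split by blast
    then have "(?F \<longlongrightarrow> glued t j) (at_right t)" by simp
    then have right: "((\<lambda>s. glued s j) \<longlongrightarrow> glued t j) (at_right t)"
    proof (rule Lim_transform_eventually)
      show "\<forall>\<^sub>F s in at_right t. ?F s = glued s j"
        using b eq by (auto simp: eventually_at_right[OF b(1)] intro!: exI[of _ b])
    qed
    show ?thesis
    proof (cases "t = 0")
      case True
      then show ?thesis using right by (simp add: continuous_within at_within_Ici_at_right)
    next
      case False
      with t have t0: "t > 0" by simp
      define a where "a = last_switch \<sigma> t"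
      note a = last_switch_bounds[OF pc t0, folded a_def]
      let ?F = "\<lambda>s. flow d (G (\<sigma> ((a + t) / 2))) (glued a) (s - a) j"
      have eq: "glued s j = ?F s" if "s \<in> {a<..t}" for s
      proof -
        have "{a<..<s} \<inter> switching_times \<sigma> = {}" using a that by fastforce
        then have "glued s = flow d (G (\<sigma> ((a + s) / 2))) (glued a) (s - a)"
          using that a last_switch_cases[OF pc, of t, folded a_def] by (intro glued_piece[OF pc]) auto
        moreover have "\<sigma> ((a + s) / 2) = \<sigma> ((a + t) / 2)"
          using signal_const_between_switches[OF a(3) a(1), of "(a + s) / 2" "(a + t) / 2"] that a by auto
        ultimately show ?thesis by simp
      qed
      have "(?F \<longlongrightarrow> ?F t) (at_left t)"
        using fl_isCont[OF j] unfolding isCont_def filterlim_at_split by blast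
      then have "(?F \<longlongrightarrow> glued t j) (at_left t)" using eq[of t] a by simp
      then have left: "((\<lambda>s. glued s j) \<longlongrightarrow> glued t j) (at_left t)"
      proof (rule Lim_transform_eventually)
        show "\<forall>\<^sub>F s in at_left t. ?F s = glued s j"
          using a eq by (auto simp: eventually_at_left[OF a(2)] intro!: exI[of _ a])
      qed
      have "isCont (\<lambda>s. glued s j) t" using left right unfolding isCont_def filterlim_at_split by blast
      then show ?thesis by (rule continuous_at_imp_continuous_within)
    qed
  qed
  show ?thesis unfolding traj_def
    using deriv cont by (auto simp: continuous_on_eq_continuous_within)
qed

end

section \<open>The Euler scheme\<close>

primrec euler :: "nat \<Rightarrow> (nat \<Rightarrow> nat \<Rightarrow> nat \<Rightarrow> real) \<Rightarrow> real \<Rightarrow> (nat \<Rightarrow> nat) \<Rightarrow> (nat \<Rightarrow> real) \<Rightarrow> nat \<Rightarrow> nat \<Rightarrow> real" where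
  "euler d G h s z0 0 = z0"
| "euler d G h s z0 (Suc l) = (\<lambda>j. euler d G h s z0 l j + h * mulv d (G (s l)) (euler d G h s z0 l) j)"

definition l1norm :: "nat \<Rightarrow> (nat \<Rightarrow> real) \<Rightarrow> real" where
  "l1norm d z = (\<Sum>j<d. \<bar>z j\<bar>)"

lemma l1norm_nonneg [simp]: "0 \<le> l1norm d z"
  by (simp add: l1norm_def sum_nonneg)

lemma abs_le_l1norm: "j < d \<Longrightarrow> \<bar>z j\<bar> \<le> l1norm d z"
  unfolding l1norm_def by (rule member_le_sum) auto

lemma l1norm_add: "l1norm d (\<lambda>j. x j + y j) \<le> l1norm d x + l1norm d y"
  unfolding l1norm_def sum.distrib[symmetric] by (intro sum_mono abs_triangle_ineq)

lemma l1norm_mulv: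
  assumes "\<forall>a<d. \<forall>b<d. \<bar>G a b\<bar> \<le> c"
  shows "l1norm d (mulv d G z) \<le> (real d * c) * l1norm d z"
proof -
  have "\<bar>mulv d G z j\<bar> \<le> c * l1norm d z" if "j < d" for j
  proof -
    have "\<bar>mulv d G z j\<bar> \<le> (\<Sum>l<d. \<bar>G j l * z l\<bar>)" unfolding mulv_def by (rule sum_abs)
    also have "\<dots> \<le> (\<Sum>l<d. c * \<bar>z l\<bar>)"
      using assms that by (intro sum_mono) (auto simp: abs_mult intro!: mult_right_mono)
    finally show ?thesis by (simp add: l1norm_def sum_distrib_left)
  qed
  then have "l1norm d (mulv d G z) \<le> (\<Sum>j<d. c * l1norm d z)"
    unfolding l1norm_def[of d "mulv d G z"] by (intro sum_mono) auto
  then show ?thesis by (simp add: mult_ac)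
qed

lemma mulv_diff: "mulv d G (\<lambda>j. x j - y j) j = mulv d G x j - mulv d G y j"
  by (simp add: mulv_def algebra_simps sum_subtractf)

lemma l1norm_euler_step:
  assumes "\<forall>a<d. \<forall>b<d. \<bar>G a b\<bar> \<le> c" "h \<ge> 0"
  shows "l1norm d (\<lambda>j. z j + h * mulv d G z j) \<le> (1 + h * (real d * c)) * l1norm d z"
proof -
  have "l1norm d (\<lambda>j. z j + h * mulv d G z j) \<le> l1norm d z + l1norm d (\<lambda>j. h * mulv d G z j)"
    by (rule l1norm_add)
  also have "l1norm d (\<lambda>j. h * mulv d G z j) = h * l1norm d (mulv d G z)"
    using assms(2) by (simp add: l1norm_def abs_mult sum_distrib_left)
  also have "\<dots> \<le> h * ((real d * c) * l1norm d z)"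
    by (intro mult_left_mono l1norm_mulv assms)
  finally show ?thesis by (simp add: algebra_simps)
qed

lemma power_one_plus_le_exp: "0 \<le> (x::real) \<Longrightarrow> (1 + x) ^ k \<le> exp (real k * x)"
  by (simp add: exp_of_nat_mult power_mono)

lemma l1norm_euler:
  assumes "\<And>l. l < k \<Longrightarrow> \<forall>a<d. \<forall>b<d. \<bar>G (s l) a b\<bar> \<le> c" "h \<ge> 0" "c \<ge> 0"
  shows "l1norm d (euler d G h s z0 k) \<le> exp (real k * h * (real d * c)) * l1norm d z0"
proof -
  have "l1norm d (euler d G h s z0 k) \<le> (1 + h * (real d * c)) ^ k * l1norm d z0"
    using assms(1)
  proof (induction k)
    case (Suc k)
    have "l1norm d (euler d G h s z0 (Suc k)) \<le> (1 + h * (real d * c)) * l1norm d (euler d G h s z0 k)"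
      unfolding euler.simps by (rule l1norm_euler_step) (use Suc.prems assms(2) in auto)
    also have "\<dots> \<le> (1 + h * (real d * c)) * ((1 + h * (real d * c)) ^ k * l1norm d z0)"
      using assms by (intro mult_left_mono Suc.IH Suc.prems) auto
    finally show ?case by (simp add: mult_ac)
  qed simp
  also have "\<dots> \<le> exp (real k * (h * (real d * c))) * l1norm d z0"
    by (intro mult_right_mono power_one_plus_le_exp) (use assms in auto)
  finally show ?thesis by (simp add: mult_ac)
qed

lemma discrete_gronwall:
  fixes e \<Delta> :: "nat \<Rightarrow> real"
  assumes "e 0 = 0" "\<And>l. l < k \<Longrightarrow> e (Suc l) \<le> (1 + x) * e l + \<Delta> l" "\<And>l. 0 \<le> \<Delta> l" "x \<ge> 0"
  shows "e k \<le> exp (real k * x) * (\<Sum>l<k. \<Delta> l)"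
proof -
  have "e k \<le> (1 + x) ^ k * (\<Sum>l<k. \<Delta> l)"
    using assms(2)
  proof (induction k)
    case (Suc k)
    have "e (Suc k) \<le> (1 + x) * e k + \<Delta> k" using Suc.prems by auto
    also have "\<dots> \<le> (1 + x) * ((1 + x) ^ k * (\<Sum>l<k. \<Delta> l)) + (1 + x) ^ Suc k * \<Delta> k"
    proof (rule add_mono)
      show "(1 + x) * e k \<le> (1 + x) * ((1 + x) ^ k * (\<Sum>l<k. \<Delta> l))"
        using Suc assms(4) by (intro mult_left_mono) auto
      show "\<Delta> k \<le> (1 + x) ^ Suc k * \<Delta> k"
        using mult_right_mono[OF one_le_power[of "1 + x" "Suc k"] assms(3)[of k]] assms(4) by simp
    qed
    finally show ?case by (simp add: algebra_simps)
  qed (use assms(1) in simp)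
  also have "\<dots> \<le> exp (real k * x) * (\<Sum>l<k. \<Delta> l)"
    by (intro mult_right_mono power_one_plus_le_exp sum_nonneg assms)
  finally show ?thesis .
qed

lemma traj_bounded:
  assumes "traj d G \<sigma> z"
  obtains Z where "Z \<ge> 0" "\<And>s. s \<in> {0..t} \<Longrightarrow> l1norm d (z s) \<le> Z"
proof -
  have "continuous_on {0..t} (\<lambda>s. l1norm d (z s))"
    unfolding l1norm_def using assms
    by (intro continuous_intros) (auto simp: traj_def intro: continuous_on_subset)
  then have "compact ((\<lambda>s. l1norm d (z s)) ` {0..t})" by (intro compact_continuous_image) auto
  then have "bounded ((\<lambda>s. l1norm d (z s)) ` {0..t})" by (rule compact_imp_bounded)
  then obtain B where "\<forall>s\<in>{0..t}. l1norm d (z s) \<le> B" by (auto simp: bounded_iff)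
  then have "l1norm d (z s) \<le> max B 0" if "s \<in> {0..t}" for s using that by fastforce
  then show ?thesis using that[of "max B 0"] by simp
qed

lemma traj_uniformly_continuous:
  assumes "traj d G \<sigma> z" "\<epsilon> > 0"
  obtains \<delta> where "\<delta> > 0" "\<And>s s' j. s \<in> {0..t} \<Longrightarrow> s' \<in> {0..t} \<Longrightarrow> \<bar>s - s'\<bar> < \<delta> \<Longrightarrow> j < d \<Longrightarrow> \<bar>z s j - z s' j\<bar> < \<epsilon>"
proof -
  have "\<exists>\<delta>>0. \<forall>s\<in>{0..t}. \<forall>s'\<in>{0..t}. \<bar>s - s'\<bar> < \<delta> \<longrightarrow> \<bar>z s j - z s' j\<bar> < \<epsilon>" if "j < d" for j
  proof -
    have "continuous_on {0..t} (\<lambda>s. z s j)"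
      using assms(1) that by (auto simp: traj_def intro: continuous_on_subset)
    then have "uniformly_continuous_on {0..t} (\<lambda>s. z s j)"
      by (intro compact_uniformly_continuous) auto
    then show ?thesis using assms(2) unfolding uniformly_continuous_on_def dist_real_def
      by (metis abs_minus_commute)
  qed
  then obtain D where D: "\<And>j. j < d \<Longrightarrow> D j > 0"
    "\<And>j s s'. j < d \<Longrightarrow> s \<in> {0..t} \<Longrightarrow> s' \<in> {0..t} \<Longrightarrow> \<bar>s - s'\<bar> < D j \<Longrightarrow> \<bar>z s j - z s' j\<bar> < \<epsilon>"
    by metis
  show ?thesis
  proof (rule that)
    show "Min (insert 1 (D ` {..<d})) > 0" using D(1) by auto
  qed (use D(2) in auto)
qed

text \<open>
  The local errors are summed by the discrete Gronwall inequality.  On a grid interval without a switch,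
  the mean value theorem and the uniform continuity of \<open>z\<close> bound the local error by \<open>O(h \<epsilon>)\<close>.  On the
  other intervals it is only \<open>O(\<epsilon> + h)\<close>, but their number is at most that of the switching times in
  \<open>[0, t]\<close>, with 0 counted, whatever the step.  The total is \<open>O(\<epsilon>) + O(1/K)\<close>.
\<close>

lemma euler_converges:
  assumes tr: "traj d G \<sigma> z" and pc: "piecewise_constant \<sigma>" and \<sigma>N: "\<And>s. s \<ge> 0 \<Longrightarrow> \<sigma> s < N"
    and G: "\<forall>i<N. \<forall>a<d. \<forall>b<d. \<bar>G i a b\<bar> \<le> c" and c: "c \<ge> 0" and t: "t > 0" and j: "j < d"
  shows "(\<lambda>K. euler d G (t / real K) (\<lambda>l. \<sigma> (real l * (t / real K))) (z 0) K j) \<longlonglongrightarrow> z t j"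
proof -
  define L where "L = real d * c"
  have L: "L \<ge> 0" using c by (simp add: L_def)
  \<comment> \<open>Time 0 counts as a switch: the mode at time 0 may differ from the modes just after it.\<close>
  define S where "S = insert 0 (switching_times \<sigma> \<inter> {..t})"
  have fS: "finite S" using pc by (simp add: S_def piecewise_constant_def)
  obtain Z where Z: "Z \<ge> 0" "\<And>s. s \<in> {0..t} \<Longrightarrow> l1norm d (z s) \<le> Z" using traj_bounded[OF tr] by blast
  define E where "E K k = euler d G (t / real K) (\<lambda>l. \<sigma> (real l * (t / real K))) (z 0) k" for K k
  define C1 where "C1 = exp (t * L) * (t * L * d + card S * d)"
  define C2 where "C2 = exp (t * L) * (card S * (t * L * Z))"
  have main: "\<forall>\<^sub>F K in sequentially. l1norm d (\<lambda>j. z t j - E K K j) \<le> C1 * \<epsilon> + C2 / real K"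
    if \<epsilon>: "\<epsilon> > 0" for \<epsilon>
  proof -
    obtain \<delta> where \<delta>: "\<delta> > 0" "\<And>s s' j. s \<in> {0..t} \<Longrightarrow> s' \<in> {0..t} \<Longrightarrow> \<bar>s - s'\<bar> < \<delta> \<Longrightarrow> j < d \<Longrightarrow> \<bar>z s j - z s' j\<bar> < \<epsilon>"
      using traj_uniformly_continuous[OF tr \<epsilon>] by blast
    have lim: "(\<lambda>K. t / real K) \<longlonglongrightarrow> 0" by (rule lim_const_over_n)
    have ev: "\<forall>\<^sub>F K in sequentially. K > 0 \<and> t / real K < \<delta>"
      using order_tendstoD(2)[OF lim \<delta>(1)] eventually_gt_at_top[of 0] by eventually_elim auto
    show ?thesis using ev
    proof eventually_elim
      case (elim K)
      define h where "h = t / real K"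
      have h: "h > 0" "h < \<delta>" "real K * h = t" using elim t by (auto simp: h_def)
      define e where "e k = l1norm d (\<lambda>j. z (real k * h) j - E K k j)" for k
      define \<Delta> where "\<Delta> k = l1norm d (\<lambda>j. z (real (Suc k) * h) j - z (real k * h) j
          - h * mulv d (G (\<sigma> (real k * h))) (z (real k * h)) j)" for k
      have Gk: "\<forall>a<d. \<forall>b<d. \<bar>G (\<sigma> (real k * h)) a b\<bar> \<le> c" for k
        using G \<sigma>N[of "real k * h"] h by auto
      have in01: "real k * h \<in> {0..t}" if "k \<le> K" for k
        using that h by (auto simp flip: h(3))
      have step: "e (Suc k) \<le> (1 + h * L) * e k + \<Delta> k" for k
      proof -
        let ?w = "\<lambda>j. z (real k * h) j - E K k j"
        have "e (Suc k) = l1norm d (\<lambda>j. (?w j + h * mulv d (G (\<sigma> (real k * h))) ?w j)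
           + (z (real (Suc k) * h) j - z (real k * h) j - h * mulv d (G (\<sigma> (real k * h))) (z (real k * h)) j))"
          unfolding e_def mulv_diff by (simp add: E_def h_def algebra_simps)
        also have "\<dots> \<le> l1norm d (\<lambda>j. ?w j + h * mulv d (G (\<sigma> (real k * h))) ?w j) + \<Delta> k"
          unfolding \<Delta>_def by (rule l1norm_add)
        also have "\<dots> \<le> (1 + h * L) * e k + \<Delta> k"
          unfolding L_def e_def using l1norm_euler_step[OF Gk, of h] h by simp
        finally show ?thesis .
      qed
      have "e K \<le> exp (real K * (h * L)) * (\<Sum>k<K. \<Delta> k)"
        by (rule discrete_gronwall) (use step h L in \<open>auto simp: e_def E_def \<Delta>_def l1norm_def\<close>)
      then have eK: "e K \<le> exp (t * L) * (\<Sum>k<K. \<Delta> k)" using h(3) by (simp add: mult.assoc[symmetric])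
      define bad where "bad = {k. k < K \<and> (\<exists>s\<in>S. real k * h \<le> s \<and> s < real (Suc k) * h)}"
      have close: "\<bar>z s j - z (real k * h) j\<bar> < \<epsilon>" if "k < K" "s \<in> {real k * h..real (Suc k) * h}" "j < d" for k s j
      proof (rule \<delta>(2))
        have "0 \<le> real k * h" using h by simp
        then show "s \<in> {0..t}" using that in01[of "Suc k"] by auto
        show "real k * h \<in> {0..t}" using that in01[of k] by simp
        show "\<bar>s - real k * h\<bar> < \<delta>" using that h by (auto simp: algebra_simps)
      qed (rule that)
      have \<Delta>bad: "\<Delta> k \<le> real d * \<epsilon> + h * (L * Z)" if "k < K" for k
      proof -
        have "\<Delta> k \<le> l1norm d (\<lambda>j. z (real (Suc k) * h) j - z (real k * h) j)
            + l1norm d (\<lambda>j. - (h * mulv d (G (\<sigma> (real k * h))) (z (real k * h)) j))"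
          unfolding \<Delta>_def using l1norm_add[of d "\<lambda>j. z (real (Suc k) * h) j - z (real k * h) j"
           "\<lambda>j. - (h * mulv d (G (\<sigma> (real k * h))) (z (real k * h)) j)"] by simp
        moreover have "l1norm d (\<lambda>j. z (real (Suc k) * h) j - z (real k * h) j) \<le> (\<Sum>j<d. \<epsilon>)"
          unfolding l1norm_def using close[OF that, of "real (Suc k) * h"] h
          by (intro sum_mono less_imp_le) (auto simp: algebra_simps)
        moreover have "l1norm d (\<lambda>j. - (h * mulv d (G (\<sigma> (real k * h))) (z (real k * h)) j))
            = h * l1norm d (mulv d (G (\<sigma> (real k * h))) (z (real k * h)))"
          using h by (simp add: l1norm_def abs_mult sum_distrib_left)
        moreover have "l1norm d (mulv d (G (\<sigma> (real k * h))) (z (real k * h))) \<le> L * Z"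
          by (rule order_trans[OF l1norm_mulv[OF Gk] mult_left_mono[OF Z(2)[OF in01[of k]] L, unfolded L_def],
                folded L_def]) (use that in simp)
        then have "h * l1norm d (mulv d (G (\<sigma> (real k * h))) (z (real k * h))) \<le> h * (L * Z)"
          using h(1) by (intro mult_left_mono) auto
        ultimately show ?thesis by simp
      qed
      have \<Delta>good: "\<Delta> k \<le> h * (L * (real d * \<epsilon>))" if k: "k < K" "k \<notin> bad" for k
      proof -
        let ?a = "real k * h" and ?b = "real (Suc k) * h"
        have ab: "?a < ?b" "?b \<le> t" using h in01[of "Suc k"] k by (auto simp: algebra_simps)
        have noS: "s \<notin> S" if "?a \<le> s" "s < ?b" for s using k that by (auto simp: bad_def)
        have a0: "?a > 0" using noS[of ?a] ab(1) h by (cases "k = 0") (auto simp: S_def)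
        \<comment> \<open>As \<open>?a\<close> is not a switching time, the mode is constant on an open interval that contains it.\<close>
        define a' where "a' = last_switch \<sigma> ?a"
        note a' = last_switch_bounds[OF pc a0, folded a'_def]
        have noswitch: "{a'<..<?b} \<inter> switching_times \<sigma> = {}"
        proof (rule ccontr)
          assume "\<not> ?thesis"
          then obtain s where s: "a' < s" "s < ?b" "s \<in> switching_times \<sigma>" by auto
          then show False using noS[of s] a'(3) ab(2) by (cases "s < ?a") (auto simp: S_def)
        qed
        have const: "\<sigma> s = \<sigma> ?a" if "s \<in> {?a<..<?b}" for s
          using signal_const_between_switches[OF noswitch a'(1), of s ?a] that a' ab by auto
        have "\<bar>z ?b j - z ?a j - h * mulv d (G (\<sigma> ?a)) (z ?a) j\<bar> \<le> h * (c * (real d * \<epsilon>))" if j: "j < d" for j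
        proof -
          have cont: "continuous_on {?a..?b} (\<lambda>s. z s j)"
            using tr j a0 by (auto simp: traj_def intro: continuous_on_subset)
          have der: "((\<lambda>s. z s j) has_real_derivative mulv d (G (\<sigma> s)) (z s) j) (at s)" if "?a < s" "s < ?b" for s
            using tr j a0 that noswitch a' unfolding traj_def by (force simp: disjoint_iff)
          obtain \<xi> where \<xi>: "?a < \<xi>" "\<xi> < ?b" "z ?b j - z ?a j = (?b - ?a) * mulv d (G (\<sigma> \<xi>)) (z \<xi>) j"
            using mvt[OF ab(1) cont der[unfolded has_field_derivative_def]] by (metis mult.commute)
          have "z ?b j - z ?a j - h * mulv d (G (\<sigma> ?a)) (z ?a) j = h * mulv d (G (\<sigma> ?a)) (\<lambda>j. z \<xi> j - z ?a j) j"
            using \<xi> const[of \<xi>] by (simp add: mulv_diff algebra_simps)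
          also have "\<bar>\<dots>\<bar> = h * \<bar>mulv d (G (\<sigma> ?a)) (\<lambda>j. z \<xi> j - z ?a j) j\<bar>" using h by (simp add: abs_mult)
          also have "\<bar>mulv d (G (\<sigma> ?a)) (\<lambda>j. z \<xi> j - z ?a j) j\<bar> \<le> (\<Sum>l<d. \<bar>G (\<sigma> ?a) j l * (z \<xi> l - z ?a l)\<bar>)"
            unfolding mulv_def by (rule sum_abs)
          also have "\<dots> \<le> (\<Sum>l<d. c * \<epsilon>)"
            unfolding abs_mult using Gk[of k] j c close[OF k(1), of \<xi>] \<xi>
            by (intro sum_mono mult_mono) (auto intro: less_imp_le)
          finally show ?thesis using h by (simp add: mult_ac)
        qed
        then have "\<Delta> k \<le> (\<Sum>j<d. h * (c * (real d * \<epsilon>)))" unfolding \<Delta>_def l1norm_def by (intro sum_mono) auto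
        then show ?thesis by (simp add: L_def mult_ac)
      qed
      have cbad: "card bad \<le> card S"
      proof -
        \<comment> \<open>A switching time lies in exactly one half-open grid interval.\<close>
        have "bad \<subseteq> (\<lambda>s. nat \<lfloor>s / h\<rfloor>) ` S"
        proof
          fix k assume "k \<in> bad"
          then obtain s where s: "s \<in> S" "real k * h \<le> s" "s < real (Suc k) * h" by (auto simp: bad_def)
          have "\<lfloor>s / h\<rfloor> = int k"
            using s h by (intro floor_unique) (auto simp: field_simps)
          then have "k = nat \<lfloor>s / h\<rfloor>" by simp
          with s show "k \<in> (\<lambda>s. nat \<lfloor>s / h\<rfloor>) ` S" by blast
        qed
        then show ?thesis using fS surj_card_le by blast
      qed
      have "(\<Sum>k<K. \<Delta> k) \<le> (\<Sum>k<K. h * (L * (real d * \<epsilon>)) + (if k \<in> bad then real d * \<epsilon> + h * (L * Z) else 0))"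
      proof (rule sum_mono)
        fix k assume k: "k \<in> {..<K}"
        have "0 \<le> h * (L * (real d * \<epsilon>))" using h L \<epsilon> by simp
        then show "\<Delta> k \<le> h * (L * (real d * \<epsilon>)) + (if k \<in> bad then real d * \<epsilon> + h * (L * Z) else 0)"
          using \<Delta>bad[of k] \<Delta>good[of k] k by auto
      qed
      also have "\<dots> = real K * (h * (L * (real d * \<epsilon>))) + real (card bad) * (real d * \<epsilon> + h * (L * Z))"
      proof -
        have "{..<K} \<inter> {k. k \<in> bad} = bad" by (auto simp: bad_def)
        then show ?thesis by (simp add: sum.distrib sum.If_cases)
      qed
      also have "\<dots> \<le> t * (L * (real d * \<epsilon>)) + real (card S) * (real d * \<epsilon> + h * (L * Z))"
        using cbad h L Z \<epsilon> by (intro add_mono mult_right_mono) (auto simp flip: h(3))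
      finally have "e K \<le> exp (t * L) * (t * (L * (real d * \<epsilon>)) + real (card S) * (real d * \<epsilon> + h * (L * Z)))"
        using eK by (meson exp_ge_zero mult_left_mono order_trans)
      then show ?case using h(3) by (simp add: e_def C1_def C2_def h_def algebra_simps)
    qed
  qed
  have "(\<lambda>K. l1norm d (\<lambda>j. z t j - E K K j)) \<longlonglongrightarrow> 0"
  proof (rule order_tendstoI)
    fix a :: real assume "a < 0"
    then show "\<forall>\<^sub>F K in sequentially. a < l1norm d (\<lambda>j. z t j - E K K j)"
      by (intro always_eventually allI less_le_trans[OF _ l1norm_nonneg])
  next
    fix a :: real assume a: "0 < a"
    have C1: "C1 \<ge> 0" unfolding C1_def using t L by simp
    define \<epsilon> where "\<epsilon> = a / (2 * (C1 + 1))"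
    have \<epsilon>: "\<epsilon> > 0" "C1 * \<epsilon> < a / 2" using a C1 by (auto simp: \<epsilon>_def field_simps)
    have "\<forall>\<^sub>F K in sequentially. C2 / real K < a / 2"
      using a by (intro order_tendstoD(2)[OF lim_const_over_n]) auto
    with main[OF \<epsilon>(1)] show "\<forall>\<^sub>F K in sequentially. l1norm d (\<lambda>j. z t j - E K K j) < a"
      by eventually_elim (use \<epsilon> in linarith)
  qed
  then have "(\<lambda>K. \<bar>z t j - E K K j\<bar>) \<longlonglongrightarrow> 0"
    by (rule tendsto_sandwich[OF _ _ tendsto_const, rotated 2]) (auto intro!: always_eventually abs_le_l1norm[OF j])
  then have "(\<lambda>K. z t j - (z t j - E K K j)) \<longlonglongrightarrow> z t j - 0"
    by (intro tendsto_intros) (simp add: tendsto_rabs_zero_iff)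
  then show ?thesis by (simp add: E_def)
qed

section \<open>Homogeneous polynomials and the matrices acting on them\<close>

text \<open>
  Homogeneous polynomials of degree \<open>p\<close> in \<open>z 0, \<dots>, z (d - 1)\<close>, generated from constants and coordinates, so
  that properties stable under sums and products follow by induction.
\<close>

inductive homog :: "nat \<Rightarrow> nat \<Rightarrow> ((nat \<Rightarrow> real) \<Rightarrow> real) \<Rightarrow> bool" for d where
  const: "homog d 0 (\<lambda>z. c)"
| zero: "homog d p (\<lambda>z. 0)"
| coord: "l < d \<Longrightarrow> homog d 1 (\<lambda>z. z l)"
| add: "homog d p f \<Longrightarrow> homog d p g \<Longrightarrow> homog d p (\<lambda>z. f z + g z)"
| mult: "homog d p f \<Longrightarrow> homog d q g \<Longrightarrow> homog d (p + q) (\<lambda>z. f z * g z)"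

lemma homog_scale: "homog d p f \<Longrightarrow> homog d p (\<lambda>z. c * f z)"
  using homog.mult[OF homog.const[of d c], of p f] by simp

lemma homog_sum: "finite I \<Longrightarrow> (\<And>i. i \<in> I \<Longrightarrow> homog d p (f i)) \<Longrightarrow> homog d p (\<lambda>z. \<Sum>i\<in>I. f i z)"
  by (induction I rule: finite_induct) (simp_all add: homog.add homog.zero)

lemma homog_power: "l < d \<Longrightarrow> homog d a (\<lambda>z. z l ^ a)"
proof (induction a)
  case 0
  show ?case using homog.const[of d 1] by simp
next
  case (Suc a)
  then show ?case using homog.mult[OF homog.coord[of l d], of a "\<lambda>z. z l ^ a"] by simp
qed

lemma homog_bounded:
  assumes "homog d p f"
  shows "\<exists>B\<ge>0. \<forall>z. (\<forall>j<d. \<bar>z j\<bar> \<le> R) \<longrightarrow> \<bar>f z\<bar> \<le> B"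
  using assms
proof (induction rule: homog.induct)
  case (const c)
  show ?case by (rule exI[of _ "\<bar>c\<bar>"]) auto
next
  case (coord l)
  then show ?case by (intro exI[of _ "max R 0"]) fastforce
next
  case (add p f g)
  then obtain B C where "B \<ge> 0" "C \<ge> 0" "\<forall>z. (\<forall>j<d. \<bar>z j\<bar> \<le> R) \<longrightarrow> \<bar>f z\<bar> \<le> B" "\<forall>z. (\<forall>j<d. \<bar>z j\<bar> \<le> R) \<longrightarrow> \<bar>g z\<bar> \<le> C"
    by blast
  then show ?case by (intro exI[of _ "B + C"]) (auto intro!: order_trans[OF abs_triangle_ineq] add_mono)
next
  case (mult p f q g)
  then obtain B C where "B \<ge> 0" "C \<ge> 0" "\<forall>z. (\<forall>j<d. \<bar>z j\<bar> \<le> R) \<longrightarrow> \<bar>f z\<bar> \<le> B" "\<forall>z. (\<forall>j<d. \<bar>z j\<bar> \<le> R) \<longrightarrow> \<bar>g z\<bar> \<le> C"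
    by blast
  then show ?case by (intro exI[of _ "B * C"]) (auto simp: abs_mult intro!: mult_mono)
qed auto

text \<open>
  \<open>g\<close> is the derivative of \<open>f\<close> along the linear vector field \<open>G\<close>, in the two forms needed: along the
  solutions of \<open>x' = G x\<close>, which defines \<open>A\<^bsub>[p]\<^esub>\<close>, and along Euler steps, with an error that is quadratic
  uniformly on bounded sets.
\<close>

definition derivation :: "nat \<Rightarrow> (nat \<Rightarrow> nat \<Rightarrow> real) \<Rightarrow> ((nat \<Rightarrow> real) \<Rightarrow> real) \<Rightarrow> ((nat \<Rightarrow> real) \<Rightarrow> real) \<Rightarrow> bool" where
  "derivation d G f g \<longleftrightarrow>
     (\<forall>x t. (\<forall>j<d. ((\<lambda>s. x s j) has_real_derivative mulv d G (x t) j) (at t)) \<longrightarrow>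
        ((\<lambda>s. f (x s)) has_real_derivative g (x t)) (at t)) \<and>
     (\<forall>R. \<exists>K\<ge>0. \<forall>z h. (\<forall>j<d. \<bar>z j\<bar> \<le> R) \<longrightarrow> 0 \<le> h \<longrightarrow> h \<le> 1 \<longrightarrow>
        \<bar>f (\<lambda>j. z j + h * mulv d G z j) - f z - h * g z\<bar> \<le> K * h\<^sup>2)"

lemma derivation_mult:
  assumes f1: "derivation d G f1 g1" and f2: "derivation d G f2 g2"
    and h: "homog d p f1" "homog d q f2" "homog d p g1" "homog d q g2"
  shows "derivation d G (\<lambda>z. f1 z * f2 z) (\<lambda>z. f1 z * g2 z + g1 z * f2 z)"
  unfolding derivation_def
proof (intro conjI allI impI)
  fix x t assume "\<forall>j<d. ((\<lambda>s. x s j) has_real_derivative mulv d G (x t) j) (at t)"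
  then have "((\<lambda>s. f1 (x s)) has_real_derivative g1 (x t)) (at t)" "((\<lambda>s. f2 (x s)) has_real_derivative g2 (x t)) (at t)"
    using f1 f2 by (auto simp: derivation_def)
  then show "((\<lambda>s. f1 (x s) * f2 (x s)) has_real_derivative f1 (x t) * g2 (x t) + g1 (x t) * f2 (x t)) (at t)"
    by (auto intro!: derivative_eq_intros)
next
  fix R :: real
  define box where "box = {z::nat \<Rightarrow> real. \<forall>j<d. \<bar>z j\<bar> \<le> R}"
  obtain K1 where K1: "K1 \<ge> 0" "\<And>z h. z \<in> box \<Longrightarrow> 0 \<le> h \<Longrightarrow> h \<le> 1 \<Longrightarrow> \<bar>f1 (\<lambda>j. z j + h * mulv d G z j) - f1 z - h * g1 z\<bar> \<le> K1 * h\<^sup>2"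
    using f1 unfolding derivation_def box_def by blast
  obtain K2 where K2: "K2 \<ge> 0" "\<And>z h. z \<in> box \<Longrightarrow> 0 \<le> h \<Longrightarrow> h \<le> 1 \<Longrightarrow> \<bar>f2 (\<lambda>j. z j + h * mulv d G z j) - f2 z - h * g2 z\<bar> \<le> K2 * h\<^sup>2"
    using f2 unfolding derivation_def box_def by blast
  have bd: "\<exists>B\<ge>0. \<forall>z\<in>box. \<bar>f z\<bar> \<le> B" if "homog d r f" for f r
    using homog_bounded[OF that, of R] by (auto simp: box_def)
  obtain A1 A2 B1 B2 where A: "A1 \<ge> 0" "A2 \<ge> 0" "B1 \<ge> 0" "B2 \<ge> 0"
    "\<And>z. z \<in> box \<Longrightarrow> \<bar>f1 z\<bar> \<le> A1" "\<And>z. z \<in> box \<Longrightarrow> \<bar>f2 z\<bar> \<le> A2" "\<And>z. z \<in> box \<Longrightarrow> \<bar>g1 z\<bar> \<le> B1" "\<And>z. z \<in> box \<Longrightarrow> \<bar>g2 z\<bar> \<le> B2"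
    using h[THEN bd] by metis
  define K where "K = A1 * K2 + K1 * A2 + B1 * B2 + B1 * K2 + K1 * B2 + K1 * K2"
  have "\<bar>f1 (\<lambda>j. z j + h * mulv d G z j) * f2 (\<lambda>j. z j + h * mulv d G z j) - f1 z * f2 z - h * (f1 z * g2 z + g1 z * f2 z)\<bar> \<le> K * h\<^sup>2"
    if z: "z \<in> box" and h: "0 \<le> h" "h \<le> 1" for z h
  proof -
    define r1 where "r1 = f1 (\<lambda>j. z j + h * mulv d G z j) - f1 z - h * g1 z"
    define r2 where "r2 = f2 (\<lambda>j. z j + h * mulv d G z j) - f2 z - h * g2 z"
    have r: "\<bar>r1\<bar> \<le> K1 * h\<^sup>2" "\<bar>r2\<bar> \<le> K2 * h\<^sup>2" using K1(2) K2(2) z h by (auto simp: r1_def r2_def)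
    have h2: "h\<^sup>2 * h \<le> h\<^sup>2" "h\<^sup>2 * h\<^sup>2 \<le> h\<^sup>2" using h by (auto intro!: mult_left_le power_le_one simp del: power_mult_numeral power_add_numeral power_add_numeral2 mult_2)
    have eq: "f1 (\<lambda>j. z j + h * mulv d G z j) * f2 (\<lambda>j. z j + h * mulv d G z j) - f1 z * f2 z - h * (f1 z * g2 z + g1 z * f2 z)
       = f1 z * r2 + r1 * f2 z + (g1 z * g2 z) * h\<^sup>2 + (g1 z * r2) * h + (r1 * g2 z) * h + r1 * r2"
      by (simp add: r1_def r2_def algebra_simps power2_eq_square)
    have t1: "\<bar>f1 z * r2\<bar> \<le> A1 * (K2 * h\<^sup>2)" unfolding abs_mult using A z r K2 by (intro mult_mono) auto
    have t2: "\<bar>r1 * f2 z\<bar> \<le> (K1 * h\<^sup>2) * A2" unfolding abs_mult using A z r K1 by (intro mult_mono) auto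
    have t3: "\<bar>(g1 z * g2 z) * h\<^sup>2\<bar> \<le> (B1 * B2) * h\<^sup>2" unfolding abs_mult using A z by (intro mult_mono) auto
    have "\<bar>(g1 z * r2) * h\<bar> \<le> (B1 * (K2 * h\<^sup>2)) * h" unfolding abs_mult using A z r K2 h by (intro mult_mono) auto
    also have "\<dots> = (B1 * K2) * (h\<^sup>2 * h)" by simp
    also have "\<dots> \<le> (B1 * K2) * h\<^sup>2" using A K2 h2 by (intro mult_left_mono) auto
    finally have t4: "\<bar>(g1 z * r2) * h\<bar> \<le> (B1 * K2) * h\<^sup>2" .
    have "\<bar>(r1 * g2 z) * h\<bar> \<le> ((K1 * h\<^sup>2) * B2) * h" unfolding abs_mult using A z r K1 h by (intro mult_mono) auto
    also have "\<dots> = (K1 * B2) * (h\<^sup>2 * h)" by simp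
    also have "\<dots> \<le> (K1 * B2) * h\<^sup>2" using A K1 h2 by (intro mult_left_mono) auto
    finally have t5: "\<bar>(r1 * g2 z) * h\<bar> \<le> (K1 * B2) * h\<^sup>2" .
    have "\<bar>r1 * r2\<bar> \<le> (K1 * h\<^sup>2) * (K2 * h\<^sup>2)" unfolding abs_mult using r K1 by (intro mult_mono) auto
    also have "\<dots> = (K1 * K2) * (h\<^sup>2 * h\<^sup>2)" by simp
    also have "\<dots> \<le> (K1 * K2) * h\<^sup>2" using K1 K2 h2 by (intro mult_left_mono) auto
    finally have t6: "\<bar>r1 * r2\<bar> \<le> (K1 * K2) * h\<^sup>2" .
    have "\<bar>f1 z * r2 + r1 * f2 z + (g1 z * g2 z) * h\<^sup>2 + (g1 z * r2) * h + (r1 * g2 z) * h + r1 * r2\<bar>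
      \<le> A1 * (K2 * h\<^sup>2) + (K1 * h\<^sup>2) * A2 + (B1 * B2) * h\<^sup>2 + (B1 * K2) * h\<^sup>2 + (K1 * B2) * h\<^sup>2 + (K1 * K2) * h\<^sup>2"
      by (intro order_trans[OF abs_triangle_ineq] add_mono t1 t2 t3 t4 t5 t6)
    also have "\<dots> = K * h\<^sup>2" by (simp add: K_def algebra_simps)
    finally show ?thesis by (simp only: eq)
  qed
  moreover have "K \<ge> 0" using A K1 K2 by (simp add: K_def)
  ultimately show "\<exists>K\<ge>0. \<forall>z h. (\<forall>j<d. \<bar>z j\<bar> \<le> R) \<longrightarrow> 0 \<le> h \<longrightarrow> h \<le> 1 \<longrightarrow>
     \<bar>f1 (\<lambda>j. z j + h * mulv d G z j) * f2 (\<lambda>j. z j + h * mulv d G z j) - f1 z * f2 z - h * (f1 z * g2 z + g1 z * f2 z)\<bar> \<le> K * h\<^sup>2"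
    by (auto simp: box_def)
qed

lemma derivation_add:
  assumes f1: "derivation d G f1 g1" and f2: "derivation d G f2 g2"
  shows "derivation d G (\<lambda>z. f1 z + f2 z) (\<lambda>z. g1 z + g2 z)"
  unfolding derivation_def
proof (intro conjI allI impI)
  fix x t assume "\<forall>j<d. ((\<lambda>s. x s j) has_real_derivative mulv d G (x t) j) (at t)"
  then show "((\<lambda>s. f1 (x s) + f2 (x s)) has_real_derivative g1 (x t) + g2 (x t)) (at t)"
    using f1 f2 by (auto simp: derivation_def intro: DERIV_add)
next
  fix R :: real
  obtain K1 where K1: "K1 \<ge> 0" "\<And>z h. (\<forall>j<d. \<bar>z j\<bar> \<le> R) \<Longrightarrow> 0 \<le> h \<Longrightarrow> h \<le> 1 \<Longrightarrow> \<bar>f1 (\<lambda>j. z j + h * mulv d G z j) - f1 z - h * g1 z\<bar> \<le> K1 * h\<^sup>2"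
    using f1 unfolding derivation_def by blast
  obtain K2 where K2: "K2 \<ge> 0" "\<And>z h. (\<forall>j<d. \<bar>z j\<bar> \<le> R) \<Longrightarrow> 0 \<le> h \<Longrightarrow> h \<le> 1 \<Longrightarrow> \<bar>f2 (\<lambda>j. z j + h * mulv d G z j) - f2 z - h * g2 z\<bar> \<le> K2 * h\<^sup>2"
    using f2 unfolding derivation_def by blast
  show "\<exists>K\<ge>0. \<forall>z h. (\<forall>j<d. \<bar>z j\<bar> \<le> R) \<longrightarrow> 0 \<le> h \<longrightarrow> h \<le> 1 \<longrightarrow>
     \<bar>f1 (\<lambda>j. z j + h * mulv d G z j) + f2 (\<lambda>j. z j + h * mulv d G z j) - (f1 z + f2 z) - h * (g1 z + g2 z)\<bar> \<le> K * h\<^sup>2"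
  proof (intro exI[of _ "K1 + K2"] conjI allI impI)
    fix z and h :: real assume *: "\<forall>j<d. \<bar>z j\<bar> \<le> R" "0 \<le> h" "h \<le> 1"
    show "\<bar>f1 (\<lambda>j. z j + h * mulv d G z j) + f2 (\<lambda>j. z j + h * mulv d G z j) - (f1 z + f2 z) - h * (g1 z + g2 z)\<bar> \<le> (K1 + K2) * h\<^sup>2"
      using K1(2)[OF *] K2(2)[OF *] unfolding distrib_left distrib_right by linarith
  qed (use K1 K2 in simp)
qed

lemma homog_derivation:
  assumes "homog d p f"
  shows "\<exists>g. homog d p g \<and> derivation d G f g"
  using assms
proof (induction rule: homog.induct)
  case (const c)
  show ?case by (rule exI[of _ "\<lambda>_. 0"]) (auto simp: derivation_def homog.zero)
next
  case (zero p)
  show ?case by (rule exI[of _ "\<lambda>_. 0"]) (auto simp: derivation_def homog.zero)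
next
  case (coord l)
  have "homog d 1 (\<lambda>z. mulv d G z l)" unfolding mulv_def
    by (intro homog_sum homog_scale homog.coord) auto
  moreover have "derivation d G (\<lambda>z. z l) (\<lambda>z. mulv d G z l)"
    using coord by (auto simp: derivation_def)
  ultimately show ?case by blast
next
  case (add p f g)
  then show ?case using derivation_add homog.add by blast
next
  case (mult p f q g)
  then obtain f' g' where *: "homog d p f'" "derivation d G f f'" "homog d q g'" "derivation d G g g'" by blast
  have "homog d (p + q) (\<lambda>z. f z * g' z + f' z * g z)"
    using * mult.hyps by (intro homog.add homog.mult)
  with derivation_mult[OF *(2,4) mult.hyps *(1,3)] show ?case by blast
qed

definition exponents :: "nat \<Rightarrow> nat \<Rightarrow> nat list set" where
  "exponents k p = {\<alpha>. length \<alpha> = k \<and> sum_list \<alpha> = p}"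

definition monomial :: "nat \<Rightarrow> nat list \<Rightarrow> (nat \<Rightarrow> real) \<Rightarrow> real" where
  "monomial k \<alpha> z = (\<Prod>l<k. z l ^ (\<alpha> ! l))"

lemma nat_elem_le_sum_list: "x \<in> set (\<alpha>::nat list) \<Longrightarrow> x \<le> sum_list \<alpha>"
  by (rule member_le_sum_list) auto

lemma finite_exponents: "finite (exponents k p)"
proof (rule finite_subset)
  show "exponents k p \<subseteq> {\<alpha>. set \<alpha> \<subseteq> {..p} \<and> length \<alpha> = k}"
    by (auto simp: exponents_def dest: nat_elem_le_sum_list)
qed (rule finite_lists_length_eq, simp)

lemma monomials_enum:
  "set (monomials k p) = exponents k p" "distinct (monomials k p)" "length (monomials k p) = num_monomials k p"
proof -
  show s: "set (monomials k p) = exponents k p" and d: "distinct (monomials k p)"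
    using finite_exponents[of k p] by (auto simp: monomials_def exponents_def)
  have "length (monomials k p) = card (exponents k p)" using s d distinct_card by metis
  then show "length (monomials k p) = num_monomials k p"
    by (simp add: exponents_def card_length_sum_list num_monomials_def add.commute)
qed

lemma sum_exponents: "(\<Sum>\<alpha>\<in>exponents k p. F \<alpha>) = (\<Sum>j<num_monomials k p. F (monomials k p ! j))"
  using sum.reindex_bij_betw[OF bij_betw_nth[OF monomials_enum(2) refl monomials_enum(1)[symmetric]], of F k p]
  by (simp add: monomials_enum(3))

lemma monomials_nth: "j < num_monomials k p \<Longrightarrow> monomials k p ! j \<in> exponents k p"
  using monomials_enum nth_mem by metis

text \<open>
  Homogeneous polynomials are combinations of monomials; for a product, the pairs of exponents are grouped
  by their sum.
\<close>

lemma homog_expand: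
  assumes "homog d p f"
  shows "\<exists>c. \<forall>z. f z = (\<Sum>\<alpha>\<in>exponents d p. c \<alpha> * monomial d \<alpha> z)"
  using assms
proof (induction rule: homog.induct)
  case (const c)
  have "exponents d 0 = {replicate d 0}"
    by (auto simp: exponents_def sum_list_eq_0_iff intro: replicate_eqI)
  then show ?case by (intro exI[of _ "\<lambda>_. c"]) (simp add: monomial_def)
next
  case (zero p)
  show ?case by (intro exI[of _ "\<lambda>_. 0"]) simp
next
  case (coord l)
  let ?e = "(replicate d 0)[l := 1 :: nat]"
  have e: "?e \<in> exponents d 1" using coord by (auto simp: exponents_def sum_list_update)
  have m: "monomial d ?e z = z l" for z
  proof -
    have "monomial d ?e z = (\<Prod>i<d. if i = l then z l else 1)" unfolding monomial_def
      by (intro prod.cong) (auto simp: nth_list_update)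
    then show ?thesis using coord by simp
  qed
  have "(\<Sum>\<alpha>\<in>exponents d 1. (if \<alpha> = ?e then 1 else 0) * monomial d \<alpha> z) = z l" for z
    using finite_exponents[of d 1] e m[of z] by (simp add: if_distrib[of "\<lambda>x. x * _"] cong: if_cong)
  then show ?case by (intro exI[of _ "\<lambda>\<alpha>. if \<alpha> = ?e then 1 else 0"]) simp
next
  case (add p f g)
  then obtain a b where "\<forall>z. f z = (\<Sum>\<alpha>\<in>exponents d p. a \<alpha> * monomial d \<alpha> z)"
    "\<forall>z. g z = (\<Sum>\<alpha>\<in>exponents d p. b \<alpha> * monomial d \<alpha> z)" by blast
  then show ?case by (intro exI[of _ "\<lambda>\<alpha>. a \<alpha> + b \<alpha>"]) (simp add: sum.distrib distrib_right)
next
  case (mult p f q g)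
  then obtain a b where ab: "\<forall>z. f z = (\<Sum>\<alpha>\<in>exponents d p. a \<alpha> * monomial d \<alpha> z)"
    "\<forall>z. g z = (\<Sum>\<alpha>\<in>exponents d q. b \<alpha> * monomial d \<alpha> z)" by blast
  let ?P = "exponents d p \<times> exponents d q"
  let ?s = "\<lambda>(\<alpha>, \<beta>). map2 (+) \<alpha> \<beta>"
  have fP: "finite ?P" using finite_exponents by simp
  have sum_map2: "sum_list (map2 (+) \<alpha> \<beta>) = sum_list \<alpha> + sum_list \<beta>" if "length \<alpha> = length \<beta>" for \<alpha> \<beta> :: "nat list"
    using that by (induction \<alpha> \<beta> rule: list_induct2) auto
  have s: "?s ` ?P \<subseteq> exponents d (p + q)"
    by (auto simp: exponents_def sum_map2)
  have m: "monomial d \<alpha> z * monomial d \<beta> z = monomial d (?s (\<alpha>, \<beta>)) z" if "(\<alpha>, \<beta>) \<in> ?P" for \<alpha> \<beta> z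
    using that unfolding monomial_def prod.distrib[symmetric]
    by (intro prod.cong) (auto simp: exponents_def power_add)
  let ?c = "\<lambda>\<gamma>. \<Sum>x\<in>{x \<in> ?P. ?s x = \<gamma>}. a (fst x) * b (snd x)"
  have "f z * g z = (\<Sum>\<gamma>\<in>exponents d (p + q). ?c \<gamma> * monomial d \<gamma> z)" for z
  proof -
    have "f z * g z = (\<Sum>x\<in>?P. a (fst x) * b (snd x) * monomial d (?s x) z)"
      unfolding ab(1)[rule_format] ab(2)[rule_format] sum_product sum.cartesian_product
    proof (rule sum.cong[OF refl], clarify)
      fix \<alpha> \<beta> assume "\<alpha> \<in> exponents d p" "\<beta> \<in> exponents d q"
      then show "a \<alpha> * monomial d \<alpha> z * (b \<beta> * monomial d \<beta> z)
          = a (fst (\<alpha>, \<beta>)) * b (snd (\<alpha>, \<beta>)) * monomial d (map2 (+) \<alpha> \<beta>) z"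
        using m[of \<alpha> \<beta> z] by (simp add: mult.assoc mult.left_commute flip: m)
    qed
    also have "\<dots> = (\<Sum>\<gamma>\<in>exponents d (p + q). \<Sum>x\<in>{x \<in> ?P. ?s x = \<gamma>}. a (fst x) * b (snd x) * monomial d (?s x) z)"
      by (rule sum.group[symmetric, OF fP finite_exponents s])
    also have "\<dots> = (\<Sum>\<gamma>\<in>exponents d (p + q). ?c \<gamma> * monomial d \<gamma> z)"
      by (intro sum.cong refl) (simp add: sum_distrib_right)
    finally show ?thesis .
  qed
  then show ?case by (intro exI[of _ ?c] allI)
qed

lemma sum_nth_exponent: "\<alpha> \<in> exponents k p \<Longrightarrow> (\<Sum>l<k. \<alpha> ! l) = p"
  by (auto simp: exponents_def sum_list_sum_nth atLeast0LessThan)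

lemma homog_monomial:
  assumes "\<alpha> \<in> exponents k p"
  shows "homog k p (monomial k \<alpha>)"
proof -
  have "homog k (\<Sum>l<n. \<alpha> ! l) (\<lambda>z. \<Prod>l<n. z l ^ (\<alpha> ! l))" if "n \<le> k" for n
    using that
  proof (induction n)
    case 0
    show ?case using homog.const[of k 1] by simp
  next
    case (Suc n)
    then show ?case using homog.mult[OF Suc.IH homog_power[of n k "\<alpha> ! n"]] by simp
  qed
  from this[of k] show ?thesis using sum_nth_exponent[OF assms] by (simp add: monomial_def[abs_def])
qed

text \<open>
  Kronecker's substitution \<open>z\<^sub>l = x^((p + 1)^l)\<close> turns distinct monomials of degree \<open>p\<close> into distinct powers of
  \<open>x\<close>: exponents are at most \<open>p\<close>, so they are the digits of the resulting power in base \<open>p + 1\<close>.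
\<close>

lemma kronecker_exponent_inj:
  fixes \<alpha> \<beta> :: "nat list"
  assumes "length \<alpha> = k" "length \<beta> = k" "\<forall>a\<in>set \<alpha>. a \<le> p" "\<forall>b\<in>set \<beta>. b \<le> p"
    "(\<Sum>l<k. (p + 1) ^ l * \<alpha> ! l) = (\<Sum>l<k. (p + 1) ^ l * \<beta> ! l)"
  shows "\<alpha> = \<beta>"
  using assms
proof (induction k arbitrary: \<alpha> \<beta>)
  case (Suc k)
  obtain a \<alpha>' b \<beta>' where c: "\<alpha> = a # \<alpha>'" "\<beta> = b # \<beta>'"
    using Suc.prems(1,2) by (metis length_Suc_conv)
  have e: "(\<Sum>l<Suc k. (p + 1) ^ l * (a # \<alpha>) ! l) = a + (p + 1) * (\<Sum>l<k. (p + 1) ^ l * \<alpha> ! l)" for a and \<alpha> :: "nat list"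
    unfolding sum.lessThan_Suc_shift sum_distrib_left
    by (simp only: nth_Cons_0 nth_Cons_Suc power_Suc power_0 mult_1 mult.assoc)
  have eq: "a + (p + 1) * (\<Sum>l<k. (p + 1) ^ l * \<alpha>' ! l) = b + (p + 1) * (\<Sum>l<k. (p + 1) ^ l * \<beta>' ! l)"
    using Suc.prems(5) unfolding c e .
  have "a < p + 1" "b < p + 1" using Suc.prems c by auto
  then have "a = b" using eq by (metis mod_less mod_mult_self2)
  moreover have "\<alpha>' = \<beta>'"
  proof (rule Suc.IH)
    show "(\<Sum>l<k. (p + 1) ^ l * \<alpha>' ! l) = (\<Sum>l<k. (p + 1) ^ l * \<beta>' ! l)"
      using eq unfolding \<open>a = b\<close> add_left_cancel by (simp only: mult_cancel1) simp
  qed (use Suc.prems c in auto)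
  ultimately show ?case using c by simp
qed simp

lemma monomials_lin_indep:
  fixes u :: "nat list \<Rightarrow> real"
  assumes "\<And>z. (\<Sum>\<alpha>\<in>exponents k p. u \<alpha> * monomial k \<alpha> z) = 0" "\<alpha> \<in> exponents k p"
  shows "u \<alpha> = 0"
proof -
  define e where "e \<alpha> = (\<Sum>l<k. (p + 1) ^ l * \<alpha> ! l)" for \<alpha> :: "nat list"
  have inj: "inj_on e (exponents k p)"
  proof (rule inj_onI)
    fix \<alpha> \<beta> assume "\<alpha> \<in> exponents k p" "\<beta> \<in> exponents k p" "e \<alpha> = e \<beta>"
    then show "\<alpha> = \<beta>" using nat_elem_le_sum_list unfolding e_def exponents_def
      by (intro kronecker_exponent_inj[of \<alpha> k \<beta> p]) fastforce+
  qed
  have m: "monomial k \<alpha> (\<lambda>l. x ^ ((p + 1) ^ l)) = x ^ e \<alpha>" for \<alpha> x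
    by (simp add: monomial_def e_def power_sum power_mult)
  define P where "P = (\<Sum>\<alpha>\<in>exponents k p. Polynomial.monom (u \<alpha>) (e \<alpha>))"
  have "poly P x = 0" for x
    using assms(1)[of "\<lambda>l. x ^ ((p + 1) ^ l)"] unfolding m by (simp add: P_def poly_sum poly_monom)
  then have "P = 0" using poly_all_0_iff_0 by blast
  then have "0 = Polynomial.coeff P (e \<alpha>)" by simp
  also have "\<dots> = (\<Sum>\<beta>\<in>exponents k p. if \<beta> = \<alpha> then u \<beta> else 0)"
    unfolding P_def coeff_sum using inj_onD[OF inj] assms(2)
    by (intro sum.cong) auto
  also have "\<dots> = u \<alpha>" using assms(2) finite_exponents by simp
  finally show ?thesis by simp
qed

text \<open>
  \<open>vec_power\<close> in the representation of vectors as functions.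
\<close>

definition vpow :: "nat \<Rightarrow> nat \<Rightarrow> (nat \<Rightarrow> real) \<Rightarrow> nat \<Rightarrow> real" where
  "vpow k p z j = (let \<alpha> = monomials k p ! j in
     sqrt (fact p / (\<Prod>l<k. fact (\<alpha> ! l))) * monomial k \<alpha> z)"

lemma vec_power_nth:
  "dim_vec x = k \<Longrightarrow> j < num_monomials k p \<Longrightarrow> vec_power p x $ j = vpow k p (\<lambda>l. x $ l) j"
  by (simp add: vec_power_def vpow_def monomial_def Let_def)

lemma homog_vpow: "j < num_monomials k p \<Longrightarrow> homog k p (\<lambda>z. vpow k p z j)"
  using homog_scale[OF homog_monomial[OF monomials_nth]] by (simp add: vpow_def Let_def)

lemma vpow_span:
  assumes "homog k p f"
  obtains c where "\<And>z. f z = (\<Sum>j<num_monomials k p. c j * vpow k p z j)"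
proof -
  obtain c where c: "\<And>z. f z = (\<Sum>\<alpha>\<in>exponents k p. c \<alpha> * monomial k \<alpha> z)"
    using homog_expand[OF assms] by blast
  have "f z = (\<Sum>j<num_monomials k p. (let \<alpha> = monomials k p ! j in
     c \<alpha> / sqrt (fact p / (\<Prod>l<k. fact (\<alpha> ! l)))) * vpow k p z j)" for z
    unfolding c sum_exponents by (intro sum.cong) (simp_all add: Let_def vpow_def)
  then show ?thesis by (rule that)
qed

lemma vpow_lin_indep:
  assumes "\<And>z. (\<Sum>j<num_monomials k p. u j * vpow k p z j) = 0" "j < num_monomials k p"
  shows "u j = 0"
proof -
  let ?i = "\<lambda>\<alpha>. THE j. j < num_monomials k p \<and> monomials k p ! j = \<alpha>"
  have i: "?i (monomials k p ! j) = j" if "j < num_monomials k p" for j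
    using that monomials_enum(2,3)[of k p] by (intro the_equality) (auto simp: nth_eq_iff_index_eq)
  let ?c = "\<lambda>\<alpha>. sqrt (fact p / (\<Prod>l<k. fact (\<alpha> ! l)))"
  have "(\<Sum>\<alpha>\<in>exponents k p. (u (?i \<alpha>) * ?c \<alpha>) * monomial k \<alpha> z) = 0" for z
  proof -
    have "(\<Sum>\<alpha>\<in>exponents k p. (u (?i \<alpha>) * ?c \<alpha>) * monomial k \<alpha> z) = (\<Sum>j<num_monomials k p. u j * vpow k p z j)"
      unfolding sum_exponents by (intro sum.cong) (simp_all add: i vpow_def Let_def)
    then show ?thesis using assms(1) by simp
  qed
  from monomials_lin_indep[OF this monomials_nth[OF assms(2)]] show ?thesis using i[OF assms(2)] by simp
qed

lemma vpow_bound: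
  obtains c where "c \<ge> 0" "\<And>z j. j < num_monomials k p \<Longrightarrow> \<bar>vpow k p z j\<bar> \<le> c * l1norm k z ^ p"
proof -
  define c where "c = (\<Sum>\<alpha>\<in>exponents k p. \<bar>sqrt (fact p / (\<Prod>l<k. fact (\<alpha> ! l)))\<bar>)"
  have "\<bar>vpow k p z j\<bar> \<le> c * l1norm k z ^ p" if "j < num_monomials k p" for z j
  proof -
    define \<alpha> where "\<alpha> = monomials k p ! j"
    have \<alpha>: "\<alpha> \<in> exponents k p" using monomials_nth[OF that] by (simp add: \<alpha>_def)
    have "\<bar>monomial k \<alpha> z\<bar> = (\<Prod>l<k. \<bar>z l\<bar> ^ (\<alpha> ! l))" by (simp add: monomial_def abs_prod power_abs)
    also have "\<dots> \<le> (\<Prod>l<k. l1norm k z ^ (\<alpha> ! l))"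
      by (intro prod_mono conjI power_mono abs_le_l1norm) auto
    also have "\<dots> = l1norm k z ^ p" using sum_nth_exponent[OF \<alpha>] by (simp flip: power_sum)
    finally have 1: "\<bar>monomial k \<alpha> z\<bar> \<le> l1norm k z ^ p" .
    have 2: "\<bar>sqrt (fact p / (\<Prod>l<k. fact (\<alpha> ! l)))\<bar> \<le> c"
      unfolding c_def by (rule member_le_sum[OF \<alpha>]) (use finite_exponents in auto)
    have "\<bar>vpow k p z j\<bar> = \<bar>sqrt (fact p / (\<Prod>l<k. fact (\<alpha> ! l)))\<bar> * \<bar>monomial k \<alpha> z\<bar>"
      by (simp only: vpow_def Let_def \<alpha>_def abs_mult)
    also have "\<dots> \<le> c * l1norm k z ^ p"
      using 1 2 by (intro mult_mono) (auto simp: c_def intro: sum_nonneg)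
    finally show ?thesis .
  qed
  then show ?thesis using that[of c] by (auto simp: c_def intro: sum_nonneg)
qed

text \<open>
  The unique description in \<open>mat_power_lift\<close> denotes the matrix of the derivation along \<open>A\<close> in the basis of
  normalised monomials.  Such a matrix exists because derivation preserves homogeneity.  It is
  unique because two candidates agree on \<open>z^[p]\<close> for every \<open>z\<close>, by comparing derivatives at time 0 of the powers of the flow
  from \<open>z\<close>.
\<close>

lemma mat_power_lift_derivation:
  fixes p :: nat
  assumes A: "A \<in> carrier_mat k k"
  defines "D \<equiv> num_monomials k p"
  shows "mat_power_lift p A \<in> carrier_mat D D"
    and "\<And>j. j < D \<Longrightarrow> derivation k (\<lambda>a b. A $$ (a, b)) (\<lambda>z. vpow k p z j)
            (\<lambda>z. \<Sum>i<D. mat_power_lift p A $$ (j, i) * vpow k p z i)"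
proof -
  let ?G = "\<lambda>a b. A $$ (a, b)"
  have "\<exists>b. derivation k ?G (\<lambda>z. vpow k p z j) (\<lambda>z. \<Sum>i<D. b i * vpow k p z i)" if jD: "j < D" for j
  proof -
    obtain g where g: "homog k p g" "derivation k ?G (\<lambda>z. vpow k p z j) g"
      using homog_derivation[OF homog_vpow[OF jD[unfolded D_def]], of ?G] by blast
    obtain b where b: "\<And>z. g z = (\<Sum>i<D. b i * vpow k p z i)" using vpow_span[OF g(1), folded D_def] by blast
    have "g = (\<lambda>z. \<Sum>i<D. b i * vpow k p z i)" by (rule ext) (rule b)
    with g show ?thesis by blast
  qed
  then obtain b where b: "\<And>j. j < D \<Longrightarrow> derivation k ?G (\<lambda>z. vpow k p z j) (\<lambda>z. \<Sum>i<D. b j i * vpow k p z i)"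
    by metis
  define B where "B = mat D D (\<lambda>(j, i). b j i)"
  have B: "B \<in> carrier_mat D D" by (simp add: B_def)
  have bB: "(\<Sum>i<D. b j i * vpow k p z i) = (\<Sum>i<D. B $$ (j, i) * vpow k p z i)" if "j < D" for j z
    using that by (simp add: B_def)
  have mulv: "(A *\<^sub>v x) $ j = mulv k ?G (\<lambda>l. x $ l) j" if "j < k" "x \<in> carrier_vec k" for x j
    using that A by (simp add: mulv_def scalar_prod_def atLeast0LessThan)
  have lift: "(C *\<^sub>v vec_power p x) $ j = (\<Sum>i<D. C $$ (j, i) * vpow k p (\<lambda>l. x $ l) i)"
    if "j < D" "x \<in> carrier_vec k" "C \<in> carrier_mat D D" for C x j
  proof -
    have "dim_vec (vec_power p x) = D" using that by (simp add: vec_power_def D_def)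
    then show ?thesis using that
      by (simp add: scalar_prod_def atLeast0LessThan vec_power_nth[of x k] D_def)
  qed
  define P where "P C \<longleftrightarrow> (\<forall>x. (\<forall>t. x t \<in> carrier_vec k \<and> has_vec_deriv x (A *\<^sub>v x t) t) \<longrightarrow>
        (\<forall>t. has_vec_deriv (\<lambda>s. vec_power p (x s)) (C *\<^sub>v vec_power p (x t)) t))" for C
  have vp: "(\<lambda>s. vec_power p (x s) $ j) = (\<lambda>s. vpow k p (\<lambda>l. x s $ l) j)"
    if "\<forall>t. x t \<in> carrier_vec k" "j < D" for x :: "real \<Rightarrow> real vec" and j
    using that by (intro ext vec_power_nth) (auto simp: D_def)
  have PB: "P B" unfolding P_def
  proof (intro allI impI)
    fix x t assume x: "\<forall>t. x t \<in> carrier_vec k \<and> has_vec_deriv x (A *\<^sub>v x t) t"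
    then have xc: "\<forall>t. x t \<in> carrier_vec k" by blast
    show "has_vec_deriv (\<lambda>s. vec_power p (x s)) (B *\<^sub>v vec_power p (x t)) t"
      unfolding has_vec_deriv_def
    proof (intro allI impI)
      fix j assume "j < dim_vec (B *\<^sub>v vec_power p (x t))"
      then have j: "j < D" using B by simp
      have "\<forall>l<k. ((\<lambda>s. x s $ l) has_real_derivative mulv k ?G (\<lambda>l. x t $ l) l) (at t)"
        using x A mulv[OF _ xc[rule_format]] by (auto simp: has_vec_deriv_def)
      then have "((\<lambda>s. vpow k p (\<lambda>l. x s $ l) j) has_real_derivative (\<Sum>i<D. b j i * vpow k p (\<lambda>l. x t $ l) i)) (at t)"
        using b[OF j] unfolding derivation_def by (elim conjE allE[of _ "\<lambda>s l. x s $ l"] allE[of _ t]) auto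
      then show "((\<lambda>s. vec_power p (x s) $ j) has_real_derivative (B *\<^sub>v vec_power p (x t)) $ j) (at t)"
        using lift[OF j _ B] xc bB[OF j] by (simp add: vp[OF xc j])
    qed
  qed
  have uniq: "C = B" if C: "C \<in> carrier_mat D D" "P C" for C
  proof (rule eq_matI)
    fix j i assume "j < dim_row B" "i < dim_col B"
    then have ji: "j < D" "i < D" using B by auto
    have "(\<Sum>i<D. (C $$ (j, i) - B $$ (j, i)) * vpow k p z i) = 0" for z
    proof -
      define x where "x t = vec k (flow k ?G z t)" for t
      have xc: "\<forall>t. x t \<in> carrier_vec k" by (simp add: x_def)
      have "has_vec_deriv x (A *\<^sub>v x t) t" for t
        unfolding has_vec_deriv_def
      proof (intro allI impI)
        fix j assume "j < dim_vec (A *\<^sub>v x t)"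
        then have j: "j < k" using A by simp
        have "mulv k ?G (\<lambda>l. x t $ l) j = mulv k ?G (flow k ?G z t) j" by (rule mulv_cong) (simp add: x_def)
        then show "((\<lambda>s. x s $ j) has_real_derivative (A *\<^sub>v x t) $ j) (at t)"
          using flow_deriv[OF j, of ?G z t] mulv[OF j xc[rule_format]] j by (simp add: x_def)
      qed
      then have "has_vec_deriv (\<lambda>s. vec_power p (x s)) (C *\<^sub>v vec_power p (x 0)) 0"
          "has_vec_deriv (\<lambda>s. vec_power p (x s)) (B *\<^sub>v vec_power p (x 0)) 0"
        using xc C(2) PB unfolding P_def by blast+
      then have "(C *\<^sub>v vec_power p (x 0)) $ j = (B *\<^sub>v vec_power p (x 0)) $ j"
        using ji B C(1) by (auto simp: has_vec_deriv_def intro: DERIV_unique)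
      moreover have "vpow k p (\<lambda>l. x 0 $ l) i = vpow k p z i" for i
        by (simp add: vpow_def monomial_def x_def)
      ultimately show ?thesis using lift[OF ji(1) xc[rule_format] C(1)] lift[OF ji(1) xc[rule_format] B]
        by (simp add: left_diff_distrib sum_subtractf)
    qed
    from vpow_lin_indep[OF this[unfolded D_def] ji(2)[unfolded D_def]] show "C $$ (j, i) = B $$ (j, i)" by simp
  qed (use B C(1) in auto)
  have "mat_power_lift p A = B"
    unfolding mat_power_lift_def carrier_matD(1)[OF A] D_def[symmetric] P_def[symmetric]
    using B PB uniq by (intro the_equality) blast+
  then show "mat_power_lift p A \<in> carrier_mat D D"
    and "\<And>j. j < D \<Longrightarrow> derivation k ?G (\<lambda>z. vpow k p z j) (\<lambda>z. \<Sum>i<D. mat_power_lift p A $$ (j, i) * vpow k p z i)"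
    using B b bB by auto
qed

section \<open>The Markov property along a time grid\<close>

lemma euler_cong: "(\<And>m. m < k \<Longrightarrow> s m = s' m) \<Longrightarrow> euler d G h s z0 k = euler d G h s' z0 k"
  by (induction k) auto

lemma integral_finite_range:
  fixes F :: "'b \<Rightarrow> 'c::{banach, second_countable_topology}"
  assumes "finite_measure M" "finite S" "\<And>\<omega>. \<omega> \<in> space M \<Longrightarrow> X \<omega> \<in> S"
    "\<And>s. s \<in> S \<Longrightarrow> {\<omega> \<in> space M. X \<omega> = s} \<in> sets M"
  shows "integrable M (\<lambda>\<omega>. F (X \<omega>))"
    and "(\<integral>\<omega>. F (X \<omega>) \<partial>M) = (\<Sum>s\<in>S. measure M {\<omega> \<in> space M. X \<omega> = s} *\<^sub>R F s)"
proof -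
  interpret finite_measure M by fact
  have eq: "F (X \<omega>) = (\<Sum>s\<in>S. indicator {\<omega> \<in> space M. X \<omega> = s} \<omega> *\<^sub>R F s)" if "\<omega> \<in> space M" for \<omega>
  proof -
    have "(\<Sum>s\<in>S. indicator {\<omega> \<in> space M. X \<omega> = s} \<omega> *\<^sub>R F s) = (\<Sum>s\<in>S. if X \<omega> = s then F s else 0)"
      using that by (intro sum.cong) (auto simp: indicator_def)
    then show ?thesis using assms(2,3) that by simp
  qed
  have i: "integrable M (\<lambda>\<omega>. indicator {\<omega> \<in> space M. X \<omega> = s} \<omega> *\<^sub>R F s)" if "s \<in> S" for s
    using assms(4)[OF that] by (intro integrable_scaleR_left integrable_real_indicator) (auto simp: less_top[symmetric])
  have "integrable M (\<lambda>\<omega>. \<Sum>s\<in>S. indicator {\<omega> \<in> space M. X \<omega> = s} \<omega> *\<^sub>R F s)"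
    by (intro Bochner_Integration.integrable_sum i)
  then show "integrable M (\<lambda>\<omega>. F (X \<omega>))"
    by (rule Bochner_Integration.integrable_cong[OF refl eq, THEN iffD2, rotated])
  have "(\<integral>\<omega>. F (X \<omega>) \<partial>M) = (\<integral>\<omega>. (\<Sum>s\<in>S. indicator {\<omega> \<in> space M. X \<omega> = s} \<omega> *\<^sub>R F s) \<partial>M)"
    by (rule Bochner_Integration.integral_cong[OF refl eq])
  also have "\<dots> = (\<Sum>s\<in>S. \<integral>\<omega>. indicator {\<omega> \<in> space M. X \<omega> = s} \<omega> *\<^sub>R F s \<partial>M)"
    by (rule Bochner_Integration.integral_sum) (rule i)
  also have "\<dots> = (\<Sum>s\<in>S. measure M {\<omega> \<in> space M. X \<omega> = s} *\<^sub>R F s)"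
  proof (rule sum.cong[OF refl])
    fix s assume "s \<in> S"
    from assms(4)[OF this]
    show "(\<integral>\<omega>. indicator {\<omega> \<in> space M. X \<omega> = s} \<omega> *\<^sub>R F s \<partial>M) = measure M {\<omega> \<in> space M. X \<omega> = s} *\<^sub>R F s"
      by (subst integral_scaleR_left) (auto simp: less_top[symmetric] intro!: integrable_real_indicator arg_cong[of _ _ "measure M"])
  qed
  finally show "(\<integral>\<omega>. F (X \<omega>) \<partial>M) = (\<Sum>s\<in>S. measure M {\<omega> \<in> space M. X \<omega> = s} *\<^sub>R F s)" .
qed

definition trans_prob :: "(nat \<Rightarrow> 'a measure) \<Rightarrow> (real \<Rightarrow> 'a \<Rightarrow> nat) \<Rightarrow> real \<Rightarrow> nat \<Rightarrow> nat \<Rightarrow> real" where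
  "trans_prob M r h i j = measure (M i) {\<omega> \<in> space (M i). r h \<omega> = j}"

text \<open>
  The restriction to \<open>{..k}\<close> makes histories range over a finite set, so that functions of the history
  have expectations that are finite sums.
\<close>

definition history :: "(real \<Rightarrow> 'a \<Rightarrow> nat) \<Rightarrow> real \<Rightarrow> nat \<Rightarrow> 'a \<Rightarrow> nat \<Rightarrow> nat" where
  "history r h k \<omega> = restrict (\<lambda>l. r (real l * h) \<omega>) {..k}"

context
  fixes M :: "nat \<Rightarrow> 'a measure" and r :: "real \<Rightarrow> 'a \<Rightarrow> nat" and N :: nat and Q :: "real mat" and i :: nat and h :: real
  assumes mp: "markov_process M r N Q" and iN: "i < N" and h: "h > 0"
begin

lemma mode_measurable: "t \<ge> 0 \<Longrightarrow> r t \<in> measurable (M i) (count_space {..<N})"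
  using mp iN by (auto simp: markov_process_def)

lemma prob_space_initial: "prob_space (M i)"
  using mp iN by (auto simp: markov_process_def)

lemma mode_less: "t \<ge> 0 \<Longrightarrow> \<omega> \<in> space (M i) \<Longrightarrow> r t \<omega> < N"
  using measurable_space[OF mode_measurable] by auto

lemma mode_event: "t \<ge> 0 \<Longrightarrow> {\<omega> \<in> space (M i). r t \<omega> = j} \<in> sets (M i)"
proof -
  assume t: "t \<ge> 0"
  have "{\<omega> \<in> space (M i). r t \<omega> = j} = r t -` ({j} \<inter> {..<N}) \<inter> space (M i)"
    using mode_less[OF t] by auto
  then show ?thesis using measurable_sets[OF mode_measurable[OF t], of "{j} \<inter> {..<N}"] by simp
qed

lemma history_event: "{\<omega> \<in> space (M i). \<forall>l\<le>k. r (real l * h) \<omega> = s l} \<in> sets (M i)"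
proof -
  have "{\<omega> \<in> space (M i). \<forall>l\<le>k. r (real l * h) \<omega> = s l}
      = (\<Inter>l\<in>{..k}. {\<omega> \<in> space (M i). r (real l * h) \<omega> = s l})" by auto
  also have "\<dots> \<in> sets (M i)" using h by (intro sets.finite_INT mode_event) auto
  finally show ?thesis .
qed

text \<open>
  For a history of probability 0, where the conditional probability says nothing, both sides vanish.
\<close>

lemma markov_grid:
  assumes "\<And>l. l \<le> k \<Longrightarrow> s l < N" "j < N"
  shows "measure (M i) {\<omega> \<in> space (M i). (\<forall>l\<le>k. r (real l * h) \<omega> = s l) \<and> r (real (Suc k) * h) \<omega> = j}
       = measure (M i) {\<omega> \<in> space (M i). \<forall>l\<le>k. r (real l * h) \<omega> = s l} * trans_prob M r h (s k) j"
proof (cases "measure (M i) {\<omega> \<in> space (M i). \<forall>l\<le>k. r (real l * h) \<omega> = s l} > 0")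
  case True
  interpret prob_space "M i" by (rule prob_space_initial)
  define s' where "s' = s(Suc k := j)"
  have s': "\<And>l. l \<le> Suc k \<Longrightarrow> s' l < N" "\<And>l. l \<le> k \<Longrightarrow> s' l = s l" "s' (Suc k) = j" "s' k = s k"
    using assms by (auto simp: s'_def le_Suc_eq)
  have E: "{\<omega> \<in> space (M i). \<forall>l\<le>k. r (real l * h) \<omega> = s' l} = {\<omega> \<in> space (M i). \<forall>l\<le>k. r (real l * h) \<omega> = s l}"
    using s'(2) by auto
  have "\<P>(\<omega> in M i. r (real (Suc k) * h) \<omega> = s' (Suc k) \<bar> \<forall>l\<le>k. r (real l * h) \<omega> = s' l)
      = \<P>(\<omega> in M (s' k). r (real (Suc k) * h - real k * h) \<omega> = s' (Suc k))"
  proof -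
    have markov: "\<P>(\<omega> in M i. r (\<tau> (Suc k)) \<omega> = s (Suc k) \<bar> \<forall>l\<le>k. r (\<tau> l) \<omega> = s l) =
        \<P>(\<omega> in M (s k). r (\<tau> (Suc k) - \<tau> k) \<omega> = s (Suc k))"
      if "0 \<le> \<tau> 0" "\<forall>l\<le>k. \<tau> l < \<tau> (Suc l)" "\<forall>l\<le>Suc k. s l < N"
        "\<P>(\<omega> in M i. \<forall>l\<le>k. r (\<tau> l) \<omega> = s l) > 0" for \<tau> s
      using mp iN that unfolding markov_process_def by blast
    show ?thesis
    proof (rule markov)
      show "\<P>(\<omega> in M i. \<forall>l\<le>k. r (real l * h) \<omega> = s' l) > 0" unfolding E by (rule True)
    qed (use h s'(1) in auto)
  qed
  moreover have eq_h: "real (Suc k) * h - real k * h = h" by (simp add: algebra_simps)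
  ultimately have "measure (M i) {\<omega> \<in> space (M i). r (real (Suc k) * h) \<omega> = j \<and> (\<forall>l\<le>k. r (real l * h) \<omega> = s' l)}
     / measure (M i) {\<omega> \<in> space (M i). \<forall>l\<le>k. r (real l * h) \<omega> = s' l} = trans_prob M r h (s k) j"
    unfolding cond_prob_def s'(3,4) trans_prob_def eq_h by -
  moreover have "{\<omega> \<in> space (M i). r (real (Suc k) * h) \<omega> = j \<and> (\<forall>l\<le>k. r (real l * h) \<omega> = s' l)}
     = {\<omega> \<in> space (M i). (\<forall>l\<le>k. r (real l * h) \<omega> = s l) \<and> r (real (Suc k) * h) \<omega> = j}"
    using s'(2) by auto
  ultimately show ?thesis using True unfolding E by (simp add: field_simps del: of_nat_Suc)
next
  case False
  interpret prob_space "M i" by (rule prob_space_initial)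
  have "measure (M i) {\<omega> \<in> space (M i). (\<forall>l\<le>k. r (real l * h) \<omega> = s l) \<and> r (real (Suc k) * h) \<omega> = j}
     \<le> measure (M i) {\<omega> \<in> space (M i). \<forall>l\<le>k. r (real l * h) \<omega> = s l}"
    by (intro finite_measure_mono history_event) auto
  moreover have "x = y * t" if "x \<le> y" "\<not> 0 < y" "0 \<le> x" for x y t :: real
  proof -
    have "x = 0" "y = 0" using that by linarith+
    then show ?thesis by simp
  qed
  ultimately show ?thesis using False measure_nonneg by blast
qed

lemma history_in: "\<omega> \<in> space (M i) \<Longrightarrow> history r h k \<omega> \<in> {..k} \<rightarrow>\<^sub>E {..<N}"
  using mode_less h by (auto simp: history_def)

lemma history_eq_iff: "s \<in> {..k} \<rightarrow>\<^sub>E {..<N} \<Longrightarrow> history r h k \<omega> = s \<longleftrightarrow> (\<forall>l\<le>k. r (real l * h) \<omega> = s l)"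
  by (auto simp: history_def fun_eq_iff restrict_def PiE_def extensional_def)

lemma integral_history:
  fixes F :: "(nat \<Rightarrow> nat) \<Rightarrow> 'c::{banach, second_countable_topology}"
  shows "integrable (M i) (\<lambda>\<omega>. F (history r h k \<omega>))"
    and "(\<integral>\<omega>. F (history r h k \<omega>) \<partial>M i) = (\<Sum>s\<in>{..k} \<rightarrow>\<^sub>E {..<N}.
       measure (M i) {\<omega> \<in> space (M i). \<forall>l\<le>k. r (real l * h) \<omega> = s l} *\<^sub>R F s)"
proof -
  interpret prob_space "M i" by (rule prob_space_initial)
  have ev: "{\<omega> \<in> space (M i). history r h k \<omega> = s} = {\<omega> \<in> space (M i). \<forall>l\<le>k. r (real l * h) \<omega> = s l}"
    if "s \<in> {..k} \<rightarrow>\<^sub>E {..<N}" for s using history_eq_iff[OF that] by auto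
  note * = integral_finite_range[where X = "history r h k" and S = "{..k} \<rightarrow>\<^sub>E {..<N}" and F = F, OF finite_measure_axioms]
  show "integrable (M i) (\<lambda>\<omega>. F (history r h k \<omega>))"
    by (rule *(1)) (auto simp: history_in ev history_event intro!: finite_PiE)
  have "(\<integral>\<omega>. F (history r h k \<omega>) \<partial>M i) = (\<Sum>s\<in>{..k} \<rightarrow>\<^sub>E {..<N}. measure (M i) {\<omega> \<in> space (M i). history r h k \<omega> = s} *\<^sub>R F s)"
    by (rule *(2)) (auto simp: history_in ev history_event intro!: finite_PiE)
  then show "(\<integral>\<omega>. F (history r h k \<omega>) \<partial>M i) = (\<Sum>s\<in>{..k} \<rightarrow>\<^sub>E {..<N}.
       measure (M i) {\<omega> \<in> space (M i). \<forall>l\<le>k. r (real l * h) \<omega> = s l} *\<^sub>R F s)"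
    using ev by simp
qed

text \<open>
  The Markov property in integrated form: given the history, the next mode is averaged with the
  transition probabilities from the present mode.
\<close>

lemma integral_history_step:
  fixes F :: "(nat \<Rightarrow> nat) \<Rightarrow> nat \<Rightarrow> complex"
  shows "(\<integral>\<omega>. F (history r h k \<omega>) (r (real (Suc k) * h) \<omega>) \<partial>M i)
       = (\<integral>\<omega>. (\<Sum>j<N. of_real (trans_prob M r h (r (real k * h) \<omega>) j) * F (history r h k \<omega>) j) \<partial>M i)"
proof -
  interpret prob_space "M i" by (rule prob_space_initial)
  let ?S = "{..k} \<rightarrow>\<^sub>E {..<N}"
  let ?A = "\<lambda>s. {\<omega> \<in> space (M i). \<forall>l\<le>k. r (real l * h) \<omega> = s l}"
  let ?X = "\<lambda>\<omega>. (history r h k \<omega>, r (real (Suc k) * h) \<omega>)"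
  have ev: "{\<omega> \<in> space (M i). ?X \<omega> = x}
     = {\<omega> \<in> space (M i). (\<forall>l\<le>k. r (real l * h) \<omega> = fst x l) \<and> r (real (Suc k) * h) \<omega> = snd x}"
    if "x \<in> ?S \<times> {..<N}" for x using that by (cases x) (auto simp: history_eq_iff)
  have "(\<integral>\<omega>. F (history r h k \<omega>) (r (real (Suc k) * h) \<omega>) \<partial>M i) = (\<integral>\<omega>. (\<lambda>x. F (fst x) (snd x)) (?X \<omega>) \<partial>M i)" by simp
  also have "\<dots> = (\<Sum>x\<in>?S \<times> {..<N}. measure (M i) {\<omega> \<in> space (M i). ?X \<omega> = x} *\<^sub>R F (fst x) (snd x))"
  proof (rule integral_finite_range(2)[OF finite_measure_axioms])
    show "finite (?S \<times> {..<N})" by (intro finite_cartesian_product finite_PiE) auto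
    show "?X \<omega> \<in> ?S \<times> {..<N}" if "\<omega> \<in> space (M i)" for \<omega>
      using history_in[OF that] mode_less[OF _ that, of "real (Suc k) * h"] h by simp
    show "{\<omega> \<in> space (M i). ?X \<omega> = x} \<in> sets (M i)" if "x \<in> ?S \<times> {..<N}" for x
    proof -
      have eq: "{\<omega> \<in> space (M i). ?X \<omega> = x} = ?A (fst x) \<inter> {\<omega> \<in> space (M i). r (real (Suc k) * h) \<omega> = snd x}"
        unfolding ev[OF that] by auto
      show ?thesis unfolding eq
        by (rule sets.Int[OF history_event mode_event]) (use h in simp)
    qed
  qed
  also have "\<dots> = (\<Sum>x\<in>?S \<times> {..<N}. (measure (M i) (?A (fst x)) * trans_prob M r h (fst x k) (snd x)) *\<^sub>R F (fst x) (snd x))"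
  proof (rule sum.cong[OF refl])
    fix x assume x: "x \<in> ?S \<times> {..<N}"
    then have "\<And>l. l \<le> k \<Longrightarrow> fst x l < N" "snd x < N" by (auto simp: PiE_def Pi_def)
    from markov_grid[OF this] show "measure (M i) {\<omega> \<in> space (M i). ?X \<omega> = x} *\<^sub>R F (fst x) (snd x)
        = (measure (M i) (?A (fst x)) * trans_prob M r h (fst x k) (snd x)) *\<^sub>R F (fst x) (snd x)"
      unfolding ev[OF x] by simp
  qed
  also have "\<dots> = (\<Sum>(s, j)\<in>?S \<times> {..<N}. (measure (M i) (?A s) * trans_prob M r h (s k) j) *\<^sub>R F s j)"
    by (simp only: case_prod_unfold)
  also have "\<dots> = (\<Sum>s\<in>?S. \<Sum>j<N. (measure (M i) (?A s) * trans_prob M r h (s k) j) *\<^sub>R F s j)"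
    by (rule sum.cartesian_product[symmetric])
  also have "\<dots> = (\<Sum>s\<in>?S. measure (M i) (?A s) *\<^sub>R (\<Sum>j<N. of_real (trans_prob M r h (s k) j) * F s j))"
    by (simp only: scaleR_conv_of_real of_real_mult mult.assoc sum_distrib_left)
  also have "\<dots> = (\<integral>\<omega>. (\<lambda>s. \<Sum>j<N. of_real (trans_prob M r h (s k) j) * F s j) (history r h k \<omega>) \<partial>M i)"
    by (rule integral_history(2)[symmetric])
  finally show ?thesis by (simp add: history_def)
qed

end

text \<open>
  The Euler scheme up to step \<open>l + 1\<close> is a function of the history up to \<open>l\<close>.  Averaging over the next mode
  turns \<open>E f\<close> at step \<open>l + 1\<close> into the expectation of the sum over \<open>j\<close> in \<open>step\<close>, which is \<open>(1 + \<mu> h) f\<close>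
  up to \<open>\<eta>\<close>.  As \<open>Re \<mu> \<ge> 0\<close>, the factor \<open>1 + \<mu> h\<close> does not decrease the modulus, so \<open>K\<close> steps
  lose at most \<open>K \<eta>\<close>.
\<close>

lemma discrete_moment_lower_bound:
  fixes f :: "nat \<Rightarrow> (nat \<Rightarrow> real) \<Rightarrow> complex"
  assumes mp: "markov_process M r N Q" and iN: "i < N" and h: "h > 0" and \<mu>: "Re \<mu> \<ge> 0"
    and step: "\<And>i z. i < N \<Longrightarrow> \<forall>j<d. \<bar>z j\<bar> \<le> R \<Longrightarrow>
       cmod ((\<Sum>j<N. of_real (trans_prob M r h i j) * f j (\<lambda>a. z a + h * mulv d (G i) z a)) - (1 + \<mu> * of_real h) * f i z) \<le> \<eta>"
    and box: "\<And>s l. (\<And>m. s m < N) \<Longrightarrow> l \<le> K \<Longrightarrow> \<forall>j<d. \<bar>euler d G h s z0 l j\<bar> \<le> R"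
  shows "cmod (\<integral>\<omega>. f (r (real K * h) \<omega>) (euler d G h (\<lambda>l. r (real l * h) \<omega>) z0 K) \<partial>M i) \<ge> cmod (f i z0) - real K * \<eta>"
proof -
  interpret prob_space "M i" by (rule prob_space_initial[OF mp iN h])
  define e where "e l \<omega> = euler d G h (\<lambda>l. r (real l * h) \<omega>) z0 l" for l \<omega>
  define D where "D l = (\<integral>\<omega>. f (r (real l * h) \<omega>) (e l \<omega>) \<partial>M i)" for l
  have hist: "history r h l \<omega> m = r (real m * h) \<omega>" if "m \<le> l" for m l \<omega>
    using that by (simp add: history_def)
  have e_hist: "e l \<omega> = euler d G h (history r h l \<omega>) z0 l" "e (Suc l) \<omega> = euler d G h (history r h l \<omega>) z0 (Suc l)" for l \<omega>
    unfolding e_def by (rule euler_cong, simp add: hist)+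
  have int: "integrable (M i) (\<lambda>\<omega>. f (r (real l * h) \<omega>) (e l \<omega>))" for l
    using integral_history(1)[OF mp iN h, of "\<lambda>s. f (s l) (euler d G h s z0 l)" l]
    by (simp add: hist e_hist)
  have "cmod (D l) \<ge> cmod (f i z0) - real l * \<eta>" if "l \<le> K" for l
    using that
  proof (induction l)
    case 0
    have "AE \<omega> in M i. r 0 \<omega> = i" using mp iN by (auto simp: markov_process_def)
    then have "AE \<omega> in M i. f (r (real 0 * h) \<omega>) (e 0 \<omega>) = f i z0" by eventually_elim (simp add: e_def)
    then have "D 0 = (\<integral>\<omega>. f i z0 \<partial>M i)" unfolding D_def
      by (intro integral_cong_AE borel_measurable_integrable int) auto
    then show ?case by (simp add: prob_space)
  next
    case (Suc l)
    let ?g = "\<lambda>\<omega>. \<Sum>j<N. of_real (trans_prob M r h (r (real l * h) \<omega>) j) * f j (e (Suc l) \<omega>)"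
    have D1: "D (Suc l) = (\<integral>\<omega>. ?g \<omega> \<partial>M i)"
      using integral_history_step[OF mp iN h, of "\<lambda>s j. f j (euler d G h s z0 (Suc l))" l]
      unfolding D_def e_hist(2) by (simp only:)
    have intg: "integrable (M i) ?g"
      using integral_history(1)[OF mp iN h, of "\<lambda>s. \<Sum>j<N. of_real (trans_prob M r h (s l) j) * f j (euler d G h s z0 (Suc l))" l]
      unfolding e_hist(2) hist[OF order_refl] .
    have "cmod (D (Suc l) - (1 + \<mu> * of_real h) * D l)
       = cmod (\<integral>\<omega>. ?g \<omega> - (1 + \<mu> * of_real h) * f (r (real l * h) \<omega>) (e l \<omega>) \<partial>M i)"
      unfolding D1 unfolding D_def using int intg by simp
    also have "\<dots> \<le> (\<integral>\<omega>. cmod (?g \<omega> - (1 + \<mu> * of_real h) * f (r (real l * h) \<omega>) (e l \<omega>)) \<partial>M i)"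
      by (rule integral_norm_bound)
    also have "\<dots> \<le> (\<integral>\<omega>. \<eta> \<partial>M i)"
    proof (rule integral_mono)
      fix \<omega> assume \<omega>: "\<omega> \<in> space (M i)"
      have m: "\<And>l. r (real l * h) \<omega> < N" using mode_less[OF mp iN h _ \<omega>] h by simp
      have "\<forall>j<d. \<bar>e l \<omega> j\<bar> \<le> R" unfolding e_def using m Suc.prems by (intro box) auto
      from step[OF m this] show "cmod (?g \<omega> - (1 + \<mu> * of_real h) * f (r (real l * h) \<omega>) (e l \<omega>)) \<le> \<eta>"
        by (simp add: e_def)
    qed (use int intg in \<open>auto intro!: integrable_norm\<close>)
    finally have err: "cmod (D (Suc l) - (1 + \<mu> * of_real h) * D l) \<le> \<eta>" by (simp add: prob_space)
    have "1 \<le> Re (1 + \<mu> * of_real h)" using \<mu> h by simp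
    also have "\<dots> \<le> cmod (1 + \<mu> * of_real h)" by (rule complex_Re_le_cmod)
    finally have "cmod (D l) \<le> cmod ((1 + \<mu> * of_real h) * D l)"
      unfolding norm_mult using mult_right_mono[of 1 _ "cmod (D l)"] by fastforce
    also have "\<dots> \<le> cmod (D (Suc l)) + \<eta>"
      using err norm_triangle_ineq2[of "(1 + \<mu> * of_real h) * D l" "D (Suc l)"] by (simp add: norm_minus_commute)
    finally show ?case using Suc by (simp add: algebra_simps)
  qed
  from this[of K] show ?thesis by (simp add: D_def e_def)
qed

section \<open>The infinitesimal generator\<close>

lemma uniform_constant:
  fixes P :: "nat \<Rightarrow> nat \<Rightarrow> real \<Rightarrow> bool"
  assumes "\<And>i b. i < N \<Longrightarrow> b < D \<Longrightarrow> \<exists>K\<ge>0. P i b K" "\<And>i b K K'. P i b K \<Longrightarrow> K \<le> K' \<Longrightarrow> P i b K'"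
  obtains K where "K \<ge> 0" "\<And>i b. i < N \<Longrightarrow> b < D \<Longrightarrow> P i b K"
proof -
  obtain k where k: "\<And>i b. i < N \<Longrightarrow> b < D \<Longrightarrow> k i b \<ge> 0 \<and> P i b (k i b)" using assms(1) by metis
  define K where "K = (\<Sum>i<N. \<Sum>b<D. k i b)"
  have "K \<ge> 0" unfolding K_def using k by (intro sum_nonneg) auto
  moreover have "k i b \<le> K" if "i < N" "b < D" for i b
  proof -
    have "k i b \<le> (\<Sum>b<D. k i b)" using that k by (intro member_le_sum) auto
    also have "\<dots> \<le> K" unfolding K_def using that k by (intro member_le_sum[where f = "\<lambda>i. \<Sum>b<D. k i b"] sum_nonneg) auto
    finally show ?thesis .
  qed
  ultimately show ?thesis using that assms(2) k by blast
qed

text \<open>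
  A function on modes and vectors that is an eigenfunction of the generator is multiplied by \<open>1 + \<mu> h\<close> in
  one step of the Euler scheme, up to \<open>o(h)\<close> uniformly on bounded sets.  With \<open>z' = z + h G\<^sub>i z\<close> and
  \<open>P\<^sub>i\<^sub>j(h) = \<delta>\<^sub>i\<^sub>j + h q\<^sub>i\<^sub>j + h e\<^sub>i\<^sub>j(h)\<close>, the difference splits into the Taylor error of \<open>f\<^sub>i\<close>, which is \<open>O(h\<^sup>2)\<close>, the
  terms \<open>h q\<^sub>i\<^sub>j (f\<^sub>j(z') - f\<^sub>j(z)) = O(h\<^sup>2)\<close>, and the terms \<open>h e\<^sub>i\<^sub>j(h) f\<^sub>j(z') = o(h)\<close>.
\<close>

lemma generator_step:
  fixes v :: "nat \<Rightarrow> nat \<Rightarrow> complex" and F :: "(nat \<Rightarrow> real) \<Rightarrow> nat \<Rightarrow> real" and LF :: "nat \<Rightarrow> (nat \<Rightarrow> real) \<Rightarrow> nat \<Rightarrow> real"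
    and P :: "real \<Rightarrow> nat \<Rightarrow> nat \<Rightarrow> real" and d D N :: nat
  defines "f \<equiv> \<lambda>i z. \<Sum>b<D. v i b * of_real (F z b)"
  assumes der: "\<And>i b. i < N \<Longrightarrow> b < D \<Longrightarrow> derivation d (G i) (\<lambda>z. F z b) (\<lambda>z. LF i z b)"
    and hF: "\<And>b. b < D \<Longrightarrow> homog d p (\<lambda>z. F z b)" and hLF: "\<And>i b. i < N \<Longrightarrow> b < D \<Longrightarrow> homog d p (\<lambda>z. LF i z b)"
    and eigen: "\<And>i z. i < N \<Longrightarrow> (\<Sum>j<N. of_real (q i j) * f j z) + (\<Sum>b<D. v i b * of_real (LF i z b)) = \<mu> * f i z"
    and gen: "\<And>i j. i < N \<Longrightarrow> j < N \<Longrightarrow> ((\<lambda>h. (P h i j - (if i = j then 1 else 0)) / h) \<longlongrightarrow> q i j) (at_right 0)"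
    and \<epsilon>: "\<epsilon> > 0"
  shows "\<forall>\<^sub>F h in at_right 0. \<forall>i<N. \<forall>z. (\<forall>j<d. \<bar>z j\<bar> \<le> R) \<longrightarrow>
     cmod ((\<Sum>j<N. of_real (P h i j) * f j (\<lambda>a. z a + h * mulv d (G i) z a)) - (1 + \<mu> * of_real h) * f i z) \<le> \<epsilon> * h"
proof -
  define box where "box = {z::nat \<Rightarrow> real. \<forall>j<d. \<bar>z j\<bar> \<le> R}"
  define zz where "zz i h z = (\<lambda>a. z a + h * mulv d (G i) z a)" for i h z
  obtain K where K: "K \<ge> 0" "\<And>i b. i < N \<Longrightarrow> b < D \<Longrightarrow> \<forall>z\<in>box. \<forall>h. 0 \<le> h \<longrightarrow> h \<le> 1 \<longrightarrow> \<bar>F (zz i h z) b - F z b - h * LF i z b\<bar> \<le> K * h\<^sup>2"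
  proof (rule uniform_constant[of N D "\<lambda>i b K. \<forall>z\<in>box. \<forall>h. 0 \<le> h \<longrightarrow> h \<le> 1 \<longrightarrow> \<bar>F (zz i h z) b - F z b - h * LF i z b\<bar> \<le> K * h\<^sup>2"])
    fix i b assume "i < N" "b < D"
    from der[OF this] show "\<exists>K\<ge>0. \<forall>z\<in>box. \<forall>h. 0 \<le> h \<longrightarrow> h \<le> 1 \<longrightarrow> \<bar>F (zz i h z) b - F z b - h * LF i z b\<bar> \<le> K * h\<^sup>2"
      unfolding derivation_def box_def zz_def by blast
  next
    fix i b K K' assume *: "\<forall>z\<in>box. \<forall>h. 0 \<le> h \<longrightarrow> h \<le> 1 \<longrightarrow> \<bar>F (zz i h z) b - F z b - h * LF i z b\<bar> \<le> K * h\<^sup>2" "K \<le> K'"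
    then show "\<forall>z\<in>box. \<forall>h. 0 \<le> h \<longrightarrow> h \<le> 1 \<longrightarrow> \<bar>F (zz i h z) b - F z b - h * LF i z b\<bar> \<le> K' * h\<^sup>2"
      by (meson mult_right_mono order_trans zero_le_power2)
  qed blast
  obtain B where B: "B \<ge> 0" "\<And>i b. i < N \<Longrightarrow> b < D \<Longrightarrow> \<forall>z\<in>box. \<bar>F z b\<bar> \<le> B"
    by (rule uniform_constant[of N D "\<lambda>i b K. \<forall>z\<in>box. \<bar>F z b\<bar> \<le> K"])
      (use homog_bounded[OF hF, of _ R] in \<open>auto simp: box_def intro: order_trans\<close>)
  obtain C where C: "C \<ge> 0" "\<And>i b. i < N \<Longrightarrow> b < D \<Longrightarrow> \<forall>z\<in>box. \<bar>LF i z b\<bar> \<le> C"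
    by (rule uniform_constant[of N D "\<lambda>i b K. \<forall>z\<in>box. \<bar>LF i z b\<bar> \<le> K"])
      (use homog_bounded[OF hLF, of _ _ R] in \<open>auto simp: box_def intro: order_trans\<close>)
  define V where "V = (\<Sum>i<N. \<Sum>b<D. cmod (v i b))"
  have V0: "V \<ge> 0" by (simp add: V_def sum_nonneg)
  have V: "(\<Sum>b<D. cmod (v i b)) \<le> V" if "i < N" for i
    unfolding V_def using that by (intro member_le_sum[where f = "\<lambda>i. \<Sum>b<D. cmod (v i b)"]) (auto intro: sum_nonneg)
  define S where "S = (\<Sum>i<N. \<Sum>j<N. \<bar>q i j\<bar>)"
  have S: "(\<Sum>j<N. \<bar>q i j\<bar>) \<le> S" if "i < N" for i
    unfolding S_def using that by (intro member_le_sum[where f = "\<lambda>i. \<Sum>j<N. \<bar>q i j\<bar>"]) (auto intro: sum_nonneg)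
  define e where "e h i j = (P h i j - (if i = j then 1 else 0)) / h - q i j" for h i j
  define T where "T h = (\<Sum>i<N. \<Sum>j<N. \<bar>e h i j\<bar>)" for h
  have T: "(\<Sum>j<N. \<bar>e h i j\<bar>) \<le> T h" if "i < N" for i h
    unfolding T_def using that by (intro member_le_sum[where f = "\<lambda>i. \<Sum>j<N. \<bar>e h i j\<bar>"]) (auto intro: sum_nonneg)
  have "(T \<longlongrightarrow> (\<Sum>i<N. \<Sum>j<N. \<bar>q i j - q i j\<bar>)) (at_right 0)"
    unfolding T_def[abs_def] e_def using gen by (intro tendsto_intros) auto
  then have T_lim: "(T \<longlongrightarrow> 0) (at_right 0)" by simp
  have fbound: "cmod (f i z) \<le> V * m" if "i < N" "\<And>b. b < D \<Longrightarrow> \<bar>F z b\<bar> \<le> m" "m \<ge> 0" for i z m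
  proof -
    have "cmod (f i z) \<le> (\<Sum>b<D. cmod (v i b) * m)" unfolding f_def
      using that by (intro order_trans[OF norm_sum] sum_mono) (auto simp: norm_mult intro!: mult_left_mono)
    also have "\<dots> \<le> V * m" unfolding sum_distrib_right[symmetric] using V[OF that(1)] that(3) by (rule mult_right_mono)
    finally show ?thesis .
  qed
  define E where "E h = V * K * h + S * (V * (C + K) * h) + T h * (V * (B + C + K))" for h
  have bound: "cmod ((\<Sum>j<N. of_real (P h i j) * f j (zz i h z)) - (1 + \<mu> * of_real h) * f i z) \<le> E h * h"
    if i: "i < N" and z: "z \<in> box" and h: "0 < h" "h \<le> 1" for i z h
  proof -
    let ?z = "zz i h z"
    have t: "\<bar>F ?z b - F z b - h * LF i z b\<bar> \<le> K * h\<^sup>2" if "b < D" for b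
      using K(2)[OF i that] z h by simp
    have hh: "h\<^sup>2 \<le> h" using h by (simp add: power2_eq_square mult_left_le)
    have t1: "\<bar>F ?z b - F z b\<bar> \<le> (C + K) * h" if "b < D" for b
    proof -
      have "\<bar>h * LF i z b\<bar> \<le> h * C" using C(2)[OF i that] z h by (simp add: abs_mult)
      moreover have "K * h\<^sup>2 \<le> K * h" using hh K by (intro mult_left_mono) auto
      ultimately show ?thesis using t[OF that] by (simp add: algebra_simps)
    qed
    have t2: "\<bar>F ?z b\<bar> \<le> B + C + K" if "b < D" for b
    proof -
      have "(C + K) * h \<le> C + K" using C K h by (simp add: mult_left_le)
      moreover have "\<bar>F z b\<bar> \<le> B" using B(2)[OF i that] z by simp
      ultimately show ?thesis using t1[OF that] by linarith
    qed
    have Ph: "P h i j = (if i = j then 1 else 0) + h * q i j + h * e h i j" for j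
      using h by (simp add: e_def field_simps)
    have "(\<Sum>j<N. of_real (P h i j) * f j ?z)
        = (\<Sum>j<N. (if i = j then f j ?z else 0)) + of_real h * (\<Sum>j<N. of_real (q i j) * f j ?z)
          + of_real h * (\<Sum>j<N. of_real (e h i j) * f j ?z)"
      unfolding sum_distrib_left sum.distrib[symmetric]
      by (intro sum.cong) (auto simp: Ph algebra_simps)
    also have "(\<Sum>j<N. (if i = j then f j ?z else 0)) = f i ?z" using i by simp
    finally have 1: "(\<Sum>j<N. of_real (P h i j) * f j ?z)
        = f i ?z + of_real h * (\<Sum>j<N. of_real (q i j) * f j ?z) + of_real h * (\<Sum>j<N. of_real (e h i j) * f j ?z)" .
    have fdiff: "f j ?z - f j z = (\<Sum>b<D. v j b * of_real (F ?z b - F z b))" for j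
      by (simp add: f_def algebra_simps sum_subtractf)
    let ?X1 = "f i ?z - f i z - of_real h * (\<Sum>b<D. v i b * of_real (LF i z b))"
    let ?X2 = "\<Sum>j<N. of_real (q i j) * (f j ?z - f j z)"
    let ?X3 = "\<Sum>j<N. of_real (e h i j) * f j ?z"
    have 2: "(1 + \<mu> * of_real h) * f i z = f i z + of_real h * ((\<Sum>j<N. of_real (q i j) * f j z) + (\<Sum>b<D. v i b * of_real (LF i z b)))"
      unfolding eigen[OF i] by (simp add: algebra_simps)
    have "(\<Sum>j<N. of_real (P h i j) * f j ?z) - (1 + \<mu> * of_real h) * f i z = ?X1 + of_real h * ?X2 + of_real h * ?X3"
      unfolding 1 2 by (simp add: algebra_simps sum_subtractf sum.distrib sum_distrib_left)
    then have "cmod ((\<Sum>j<N. of_real (P h i j) * f j ?z) - (1 + \<mu> * of_real h) * f i z)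
        = cmod (?X1 + of_real h * ?X2 + of_real h * ?X3)" by (rule arg_cong)
    also have "\<dots> \<le> cmod ?X1 + cmod (of_real h * ?X2) + cmod (of_real h * ?X3)"
      by (rule order_trans[OF norm_triangle_ineq add_right_mono[OF norm_triangle_ineq]])
    also have "\<dots> = cmod ?X1 + h * cmod ?X2 + h * cmod ?X3" using h by (simp add: norm_mult)
    also have "\<dots> \<le> V * (K * h\<^sup>2) + h * (S * (V * ((C + K) * h))) + h * (T h * (V * (B + C + K)))"
    proof (intro add_mono mult_left_mono)
      have "?X1 = (\<Sum>b<D. v i b * of_real (F ?z b - F z b - h * LF i z b))"
        unfolding fdiff by (simp add: algebra_simps sum_subtractf sum.distrib sum_distrib_left)
      also have "cmod \<dots> \<le> (\<Sum>b<D. cmod (v i b) * (K * h\<^sup>2))"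
        using t by (intro order_trans[OF norm_sum] sum_mono) (auto simp: norm_mult simp del: of_real_diff of_real_mult intro!: mult_left_mono)
      also have "\<dots> \<le> V * (K * h\<^sup>2)" unfolding sum_distrib_right[symmetric] using V[OF i] K by (intro mult_right_mono) auto
      finally show "cmod ?X1 \<le> V * (K * h\<^sup>2)" .
      have d: "cmod (f j ?z - f j z) \<le> V * ((C + K) * h)" if "j < N" for j
      proof -
        have "cmod (f j ?z - f j z) \<le> (\<Sum>b<D. cmod (v j b) * ((C + K) * h))" unfolding fdiff
          using t1 by (intro order_trans[OF norm_sum] sum_mono) (auto simp: norm_mult simp del: of_real_diff intro!: mult_left_mono)
        also have "\<dots> \<le> V * ((C + K) * h)" unfolding sum_distrib_right[symmetric] using V[OF that] K C h by (intro mult_right_mono) auto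
        finally show ?thesis .
      qed
      have "cmod ?X2 \<le> (\<Sum>j<N. \<bar>q i j\<bar> * (V * ((C + K) * h)))"
        using d by (intro order_trans[OF norm_sum] sum_mono) (auto simp: norm_mult intro!: mult_left_mono)
      also have "\<dots> \<le> S * (V * ((C + K) * h))" unfolding sum_distrib_right[symmetric]
        using S[OF i] V0 K C h by (intro mult_right_mono) auto
      finally show "cmod ?X2 \<le> S * (V * ((C + K) * h))" .
      have "cmod ?X3 \<le> (\<Sum>j<N. \<bar>e h i j\<bar> * (V * (B + C + K)))"
        using fbound t2 B C K by (intro order_trans[OF norm_sum] sum_mono) (auto simp: norm_mult intro!: mult_left_mono)
      also have "\<dots> \<le> T h * (V * (B + C + K))" unfolding sum_distrib_right[symmetric]
        using T[OF i] V0 K C B by (intro mult_right_mono) auto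
      finally show "cmod ?X3 \<le> T h * (V * (B + C + K))" .
    qed (use h in auto)
    also have "\<dots> = E h * h" by (simp add: E_def algebra_simps power2_eq_square)
    finally show ?thesis .
  qed
  have "(E \<longlongrightarrow> V * K * 0 + S * (V * (C + K) * 0) + 0 * (V * (B + C + K))) (at_right 0)"
    unfolding E_def[abs_def] by (intro tendsto_intros T_lim)
  then have "(E \<longlongrightarrow> 0) (at_right 0)" by simp
  then have "\<forall>\<^sub>F h in at_right 0. E h < \<epsilon>" using \<epsilon> by (rule order_tendstoD(2))
  moreover have "\<forall>\<^sub>F h::real in at_right 0. 0 < h \<and> h \<le> 1"
    by (auto simp: eventually_at_right[of 0 1] intro!: exI[of _ 1])
  ultimately show ?thesis
  proof eventually_elim
    case (elim h)
    show ?case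
    proof (intro allI impI)
      fix i z assume "i < N" "\<forall>j<d. \<bar>z j\<bar> \<le> R"
      with bound[of i z h] elim have "cmod ((\<Sum>j<N. of_real (P h i j) * f j (zz i h z)) - (1 + \<mu> * of_real h) * f i z) \<le> E h * h"
        by (simp add: box_def)
      also have "\<dots> \<le> \<epsilon> * h" using elim by (intro mult_right_mono) auto
      finally show "cmod ((\<Sum>j<N. of_real (P h i j) * f j (\<lambda>a. z a + h * mulv d (G i) z a)) - (1 + \<mu> * of_real h) * f i z) \<le> \<epsilon> * h"
        by (simp add: zz_def)
    qed
  qed
qed

section \<open>Kronecker products and block matrices\<close>

lemma sum_nat_pairs: "(\<Sum>x<N * D. F x) = (\<Sum>a<N. \<Sum>b<D. F (a * D + b :: nat))"
proof -
  have "(\<Sum>x<N * D. F x) = (\<Sum>a<N. sum F {a * D..<a * D + D})" by (rule sum.nat_group[symmetric])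
  moreover have "sum F {a * D..<a * D + D} = (\<Sum>b<D. F (a * D + b))" for a
    using sum.shift_bounds_nat_ivl[of F 0 "a * D" D] by (simp add: add.commute atLeast0LessThan)
  ultimately show ?thesis by simp
qed

lemma index_less_mult: "a < N \<Longrightarrow> b < D \<Longrightarrow> a * D + b < N * (D :: nat)"
proof -
  assume "a < N" "b < D"
  then have "a * D + b < Suc a * D" by simp
  also have "\<dots> \<le> N * D" using \<open>a < N\<close> by (intro mult_le_mono1) simp
  finally show ?thesis .
qed

lemma kron_index:
  assumes "a < dim_row A" "b < dim_row B" "c < dim_col A" "e < dim_col B"
  shows "kron A B $$ (a * dim_row B + b, c * dim_col B + e) = A $$ (a, c) * B $$ (b, e)"
  using assms index_less_mult[of a "dim_row A" b "dim_row B"] index_less_mult[of c "dim_col A" e "dim_col B"]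
  by (simp add: kron_def)

lemma kron_carrier: "A \<in> carrier_mat k l \<Longrightarrow> B \<in> carrier_mat k' l' \<Longrightarrow> kron A B \<in> carrier_mat (k * k') (l * l')"
  by (auto simp: kron_def)

lemma diag_block_mat_equal_size:
  assumes "\<forall>B\<in>set Bs. B \<in> carrier_mat D D"
  shows "diag_block_mat Bs \<in> carrier_mat (length Bs * D) (length Bs * D)"
    and "a < length Bs \<Longrightarrow> c < length Bs \<Longrightarrow> b < D \<Longrightarrow> e < D \<Longrightarrow>
      diag_block_mat Bs $$ (a * D + b, c * D + e) = (if a = c then (Bs ! a) $$ (b, e) else 0)"
  using assms
proof (induction Bs arbitrary: a c)
  case (Cons B Bs)
  case 1
  then show ?case using Cons.IH(1) by (auto simp: Let_def)
next
  case (Cons B Bs)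
  case 2
  have C: "diag_block_mat Bs \<in> carrier_mat (length Bs * D) (length Bs * D)" using Cons.IH(1) 2 by simp
  have B: "B \<in> carrier_mat D D" using 2 by simp
  have l: "a * D + b < D + length Bs * D" "c * D + e < D + length Bs * D"
    using 2 index_less_mult[of a "Suc (length Bs)" b D] index_less_mult[of c "Suc (length Bs)" e D] by auto
  note dims = carrier_matD[OF B] carrier_matD[OF C]
  show ?case
  proof (cases a)
    case a: 0
    show ?thesis
    proof (cases c)
      case 0
      then show ?thesis using a B C 2 l by (simp add: Let_def dims)
    next
      case (Suc c')
      then have "c' * D + e < length Bs * D" using l by simp
      then show ?thesis using a B C 2 l Suc by (simp add: Let_def dims)
    qed
  next
    case a: (Suc a')
    then have al: "a' * D + b < length Bs * D" using l by simp
    show ?thesis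
    proof (cases c)
      case 0
      then show ?thesis using a B C 2 l al by (simp add: Let_def dims)
    next
      case (Suc c')
      then have "c' * D + e < length Bs * D" using l by simp
      then show ?thesis using a B C 2 l Suc al Cons.IH(2)[of a' c'] by (simp add: Let_def dims add.commute add.left_commute)
    qed
  qed
qed auto

text \<open>
  Moments will be tested against polynomials, whose coefficients evolve by the transpose of the matrix for
  the moments; hence the eigenvector is taken on the left.
\<close>

lemma not_hurwitz_left_eigenvector:
  assumes T: "T \<in> carrier_mat n n" and "\<not> hurwitz_stable T"
  obtains \<mu> v where "Re \<mu> \<ge> 0" "v \<in> carrier_vec n" "v \<noteq> 0\<^sub>v n"
    "\<And>c. c < n \<Longrightarrow> (\<Sum>x<n. of_real (T $$ (x, c)) * v $ x) = \<mu> * v $ c"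
proof -
  let ?T = "map_mat complex_of_real T"
  obtain \<mu> where \<mu>: "eigenvalue ?T \<mu>" "Re \<mu> \<ge> 0" using assms(2) by (auto simp: hurwitz_stable_def not_less)
  have T1: "?T \<in> carrier_mat n n" "transpose_mat ?T \<in> carrier_mat n n" using T by auto
  have "eigenvalue (transpose_mat ?T) \<mu>"
    using \<mu>(1) eigenvalue_root_char_poly[OF T1(1)] eigenvalue_root_char_poly[OF T1(2)] char_poly_transpose_mat[OF T1(1)] by simp
  then obtain v where v: "v \<in> carrier_vec n" "v \<noteq> 0\<^sub>v n" "transpose_mat ?T *\<^sub>v v = \<mu> \<cdot>\<^sub>v v"
    using T1 by (auto simp: eigenvalue_def eigenvector_def)
  have "(\<Sum>x<n. of_real (T $$ (x, c)) * v $ x) = \<mu> * v $ c" if "c < n" for c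
  proof -
    have "(transpose_mat ?T *\<^sub>v v) $ c = (\<mu> \<cdot>\<^sub>v v) $ c" using v by simp
    then show ?thesis using that T v(1) by (simp add: scalar_prod_def atLeast0LessThan)
  qed
  then show ?thesis using that \<mu> v by blast
qed

lemma generator_left_eigenvector:
  assumes Q: "Q \<in> carrier_mat N N" and B: "\<And>i. i < N \<Longrightarrow> B i \<in> carrier_mat D D"
    and unstable: "\<not> hurwitz_stable (kron (transpose_mat Q) (1\<^sub>m D) + diag_block_mat (map B [0..<N]))"
  obtains \<mu> and v :: "nat \<Rightarrow> nat \<Rightarrow> complex" and i b where "Re \<mu> \<ge> 0" "i < N" "b < D" "v i b \<noteq> 0"
    "\<And>i b. i < N \<Longrightarrow> b < D \<Longrightarrow>
       (\<Sum>j<N. of_real (Q $$ (i, j)) * v j b) + (\<Sum>c<D. of_real (B i $$ (c, b)) * v i c) = \<mu> * v i b"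
proof -
  let ?K = "kron (transpose_mat Q) (1\<^sub>m D)" and ?B = "diag_block_mat (map B [0..<N])"
  have "\<forall>B\<in>set (map B [0..<N]). B \<in> carrier_mat D D" using B by auto
  note diag = diag_block_mat_equal_size[OF this]
  have K: "?K \<in> carrier_mat (N * D) (N * D)" using Q by (intro kron_carrier) auto
  have BC: "?B \<in> carrier_mat (N * D) (N * D)" using diag(1) by simp
  have T: "?K + ?B \<in> carrier_mat (N * D) (N * D)" using K BC by simp
  obtain \<mu> w where w: "Re \<mu> \<ge> 0" "w \<in> carrier_vec (N * D)" "w \<noteq> 0\<^sub>v (N * D)"
    "\<And>c. c < N * D \<Longrightarrow> (\<Sum>x<N * D. of_real ((?K + ?B) $$ (x, c)) * w $ x) = \<mu> * w $ c"
    using not_hurwitz_left_eigenvector[OF T unstable] by blast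
  define v where "v i b = w $ (i * D + b)" for i b
  obtain x where x: "x < N * D" "w $ x \<noteq> 0" using w(2,3) by (auto simp: vec_eq_iff)
  then have D: "D > 0" by (cases D) auto
  have "x div D < N" using x D by (simp add: div_less_iff_less_mult)
  moreover have "x mod D < D" "v (x div D) (x mod D) \<noteq> 0" using D x by (auto simp: v_def)
  moreover have "(\<Sum>j<N. of_real (Q $$ (i, j)) * v j b) + (\<Sum>c<D. of_real (B i $$ (c, b)) * v i c) = \<mu> * v i b"
    if i: "i < N" and b: "b < D" for i b
  proof -
    have ib: "i * D + b < N * D" using i b by (rule index_less_mult)
    have entry: "(?K + ?B) $$ (a * D + c, i * D + b) = (if c = b then Q $$ (i, a) else 0) + (if a = i then B i $$ (c, b) else 0)"
      if "a < N" "c < D" for a c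
    proof -
      have "?K $$ (a * D + c, i * D + b) = (if c = b then Q $$ (i, a) else 0)"
        using kron_index[of a "transpose_mat Q" c "1\<^sub>m D" i b] that i b Q by simp
      moreover have "?B $$ (a * D + c, i * D + b) = (if a = i then B i $$ (c, b) else 0)"
        using diag(2)[of a i c b] that i b by simp
      moreover have "(?K + ?B) $$ (a * D + c, i * D + b) = ?K $$ (a * D + c, i * D + b) + ?B $$ (a * D + c, i * D + b)"
        using index_less_mult[OF that] ib BC by simp
      ultimately show ?thesis by simp
    qed
    have "\<mu> * v i b = (\<Sum>a<N. \<Sum>c<D. of_real ((?K + ?B) $$ (a * D + c, i * D + b)) * v a c)"
      unfolding v_def w(4)[OF ib, symmetric] sum_nat_pairs ..
    also have "\<dots> = (\<Sum>a<N. \<Sum>c<D. (if c = b then of_real (Q $$ (i, a)) * v a c else 0)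
           + (if a = i then of_real (B i $$ (c, b)) * v i c else 0))"
      by (intro sum.cong refl) (simp add: entry distrib_right)
    also have "\<dots> = (\<Sum>a<N. of_real (Q $$ (i, a)) * v a b) + (\<Sum>a<N. \<Sum>c<D. if a = i then of_real (B i $$ (c, b)) * v i c else 0)"
      using b by (simp add: sum.distrib)
    also have "(\<Sum>a<N. \<Sum>c<D. if a = i then of_real (B i $$ (c, b)) * v i c else 0)
        = (\<Sum>a<N. if a = i then \<Sum>c<D. of_real (B i $$ (c, b)) * v i c else 0)"
      by (intro sum.cong) auto
    also have "\<dots> = (\<Sum>c<D. of_real (B i $$ (c, b)) * v i c)" using i by simp
    finally show ?thesis by simp
  qed
  ultimately show ?thesis using that[of \<mu> "x div D" "x mod D" v] w(1) by blast
qed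

section \<open>Products of trajectories\<close>

abbreviation entries :: "(nat \<Rightarrow> real mat) \<Rightarrow> nat \<Rightarrow> nat \<Rightarrow> nat \<Rightarrow> real" where
  "entries A \<equiv> \<lambda>i a b. A i $$ (a, b)"

lemma kron_sum_carrier: "W \<in> carrier_mat m m \<Longrightarrow> A \<in> carrier_mat n n \<Longrightarrow> kron_sum W A \<in> carrier_mat (m * n) (m * n)"
  unfolding kron_sum_def by (intro add_carrier_mat kron_carrier) auto

text \<open>
  The entry of \<open>y \<otimes> x\<close> at the pair \<open>(a, b)\<close> has index \<open>a n + b\<close>.
\<close>

lemma mulv_kron_sum:
  assumes W: "W \<in> carrier_mat m m" and A: "A \<in> carrier_mat n n" and a: "a < m" and b: "b < n"
  shows "mulv (m * n) (\<lambda>j l. kron_sum W A $$ (j, l)) z (a * n + b)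
     = mulv m (\<lambda>j l. W $$ (j, l)) (\<lambda>c. z (c * n + b)) a + mulv n (\<lambda>j l. A $$ (j, l)) (\<lambda>e. z (a * n + e)) b"
proof -
  have entry: "kron_sum W A $$ (a * n + b, c * n + e) = (if e = b then W $$ (a, c) else 0) + (if c = a then A $$ (b, e) else 0)"
    if "c < m" "e < n" for c e
  proof -
    have "kron W (1\<^sub>m n) $$ (a * n + b, c * n + e) = (if e = b then W $$ (a, c) else 0)"
      using kron_index[of a W b "1\<^sub>m n" c e] that a b W by simp
    moreover have "kron (1\<^sub>m m) A $$ (a * n + b, c * n + e) = (if c = a then A $$ (b, e) else 0)"
      using kron_index[of a "1\<^sub>m m" b A c e] that a b A by simp
    moreover have "kron (1\<^sub>m m) A \<in> carrier_mat (m * n) (m * n)" using A by (intro kron_carrier) auto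
    ultimately show ?thesis
      using index_less_mult[OF a b] index_less_mult[OF that] W A by (simp add: kron_sum_def)
  qed
  have "mulv (m * n) (\<lambda>j l. kron_sum W A $$ (j, l)) z (a * n + b)
    = (\<Sum>c<m. \<Sum>e<n. (if e = b then W $$ (a, c) * z (c * n + e) else 0) + (if c = a then A $$ (b, e) * z (a * n + e) else 0))"
    unfolding mulv_def sum_nat_pairs by (intro sum.cong refl) (simp add: entry distrib_right)
  also have "\<dots> = (\<Sum>c<m. W $$ (a, c) * z (c * n + b)) + (\<Sum>c<m. \<Sum>e<n. if c = a then A $$ (b, e) * z (a * n + e) else 0)"
    using b by (simp add: sum.distrib)
  also have "(\<Sum>c<m. \<Sum>e<n. if c = a then A $$ (b, e) * z (a * n + e) else 0)
      = (\<Sum>c<m. if c = a then \<Sum>e<n. A $$ (b, e) * z (a * n + e) else 0)"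
    by (intro sum.cong) auto
  also have "\<dots> = (\<Sum>e<n. A $$ (b, e) * z (a * n + e))" using a by simp
  finally show ?thesis by (simp add: mulv_def)
qed

text \<open>
  Sums of products, since pure tensors \<open>y \<otimes> x\<close> do not reach all initial values.
\<close>

lemma traj_tensor:
  assumes W: "\<And>i. i < N \<Longrightarrow> W i \<in> carrier_mat m m" and A: "\<And>i. i < N \<Longrightarrow> A i \<in> carrier_mat n n"
    and \<sigma>: "\<And>t. t \<ge> 0 \<Longrightarrow> \<sigma> t < N"
    and y: "\<And>k. k < K \<Longrightarrow> traj m (entries W) \<sigma> (y k)" and x: "\<And>k. k < K \<Longrightarrow> traj n (entries A) \<sigma> (x k)"
  shows "traj (m * n) (entries (\<lambda>i. kron_sum (W i) (A i))) \<sigma> (\<lambda>t j. \<Sum>k<K. y k t (j div n) * x k t (j mod n))"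
proof -
  have idx: "j div n < m" "j mod n < n" if "j < m * n" for j
  proof -
    have "n > 0" using that by (cases n) auto
    then show "j div n < m" "j mod n < n" using that by (auto simp: div_less_iff_less_mult)
  qed
  show ?thesis unfolding traj_def
  proof (intro conjI allI impI)
    fix j assume j: "j < m * n"
    show "continuous_on {0..} (\<lambda>t. \<Sum>k<K. y k t (j div n) * x k t (j mod n))"
      using x y idx[OF j] by (intro continuous_intros) (auto simp: traj_def)
  next
    fix t j assume t: "t > 0" "t \<notin> switching_times \<sigma>" and j: "j < m * n"
    let ?z = "\<lambda>t j. \<Sum>k<K. y k t (j div n) * x k t (j mod n)"
    let ?a = "j div n" and ?b = "j mod n"
    note ab = idx[OF j]
    have st: "\<sigma> t < N" using \<sigma> t by simp
    have "((\<lambda>s. ?z s j) has_real_derivative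
        (\<Sum>k<K. y k t ?a * mulv n (entries A (\<sigma> t)) (x k t) ?b + mulv m (entries W (\<sigma> t)) (y k t) ?a * x k t ?b)) (at t)"
      using x y ab t by (intro DERIV_sum DERIV_mult') (auto simp: traj_def)
    also have "(\<Sum>k<K. y k t ?a * mulv n (entries A (\<sigma> t)) (x k t) ?b + mulv m (entries W (\<sigma> t)) (y k t) ?a * x k t ?b)
        = mulv m (entries W (\<sigma> t)) (\<lambda>c. ?z t (c * n + ?b)) ?a + mulv n (entries A (\<sigma> t)) (\<lambda>e. ?z t (?a * n + e)) ?b"
    proof -
      have "mulv m (entries W (\<sigma> t)) (\<lambda>c. ?z t (c * n + ?b)) ?a = (\<Sum>k<K. mulv m (entries W (\<sigma> t)) (y k t) ?a * x k t ?b)"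
        using ab unfolding mulv_def sum_distrib_left sum_distrib_right by (subst sum.swap) (simp add: mult.assoc)
      moreover have "mulv n (entries A (\<sigma> t)) (\<lambda>e. ?z t (?a * n + e)) ?b = (\<Sum>k<K. y k t ?a * mulv n (entries A (\<sigma> t)) (x k t) ?b)"
        using ab unfolding mulv_def sum_distrib_left sum_distrib_right by (subst sum.swap) (simp add: mult.left_commute)
      ultimately show ?thesis by (simp add: sum.distrib)
    qed
    also have "\<dots> = mulv (m * n) (entries (\<lambda>i. kron_sum (W i) (A i)) (\<sigma> t)) (?z t) (?a * n + ?b)"
      by (rule mulv_kron_sum[OF W[OF st] A[OF st] ab, symmetric])
    also have "?a * n + ?b = j" by simp
    finally show "((\<lambda>s. ?z s j) has_real_derivative mulv (m * n) (entries (\<lambda>i. kron_sum (W i) (A i)) (\<sigma> t)) (?z t) j) (at t)" .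
  qed
qed

lemma traj_switched_solution:
  assumes A: "\<And>i. i < N \<Longrightarrow> A i \<in> carrier_mat n n" and \<sigma>: "\<And>t. t \<ge> 0 \<Longrightarrow> \<sigma> t < N"
    and z: "traj n (entries A) \<sigma> z" and x0: "x0 \<in> carrier_vec n" "vec n (z 0) = x0"
  shows "switched_solution A \<sigma> x0 (\<lambda>t. vec n (z t))"
  unfolding switched_solution_def
proof (intro conjI allI impI)
  fix t :: real assume t: "t > 0" "t \<notin> switching_times \<sigma>"
  have At: "A (\<sigma> t) \<in> carrier_mat n n" using A \<sigma> t by simp
  show "has_vec_deriv (\<lambda>t. vec n (z t)) (A (\<sigma> t) *\<^sub>v vec n (z t)) t"
    unfolding has_vec_deriv_def
  proof (intro allI impI)
    fix j assume "j < dim_vec (A (\<sigma> t) *\<^sub>v vec n (z t))"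
    then have j: "j < n" using At by simp
    have "(A (\<sigma> t) *\<^sub>v vec n (z t)) $ j = mulv n (entries A (\<sigma> t)) (z t) j"
      using At j by (simp add: mulv_def scalar_prod_def atLeast0LessThan)
    then show "((\<lambda>s. vec n (z s) $ j) has_real_derivative (A (\<sigma> t) *\<^sub>v vec n (z t)) $ j) (at t)"
      using z j t by (simp add: traj_def)
  qed
qed (use z x0 in \<open>auto simp: traj_def\<close>)

section \<open>Moments along trajectories\<close>

context
  fixes M :: "nat \<Rightarrow> 'a measure" and r :: "real \<Rightarrow> 'a \<Rightarrow> nat" and N :: nat and Q :: "real mat" and i :: nat and \<Omega> :: "'a set"
    and d :: nat and G :: "nat \<Rightarrow> nat \<Rightarrow> nat \<Rightarrow> real" and c :: real and z0 :: "nat \<Rightarrow> real" and z :: "'a \<Rightarrow> real \<Rightarrow> nat \<Rightarrow> real" and t :: real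
  assumes mp: "markov_process M r N Q" and iN: "i < N" and \<Omega>: "\<Omega> \<in> sets (M i)"
    and G: "\<forall>i<N. \<forall>a<d. \<forall>b<d. \<bar>G i a b\<bar> \<le> c" and c: "c \<ge> 0"
    and path: "\<And>\<omega>. \<omega> \<in> \<Omega> \<Longrightarrow> piecewise_constant (\<lambda>t. r t \<omega>) \<and> traj d G (\<lambda>t. r t \<omega>) (z \<omega>) \<and> z \<omega> 0 = z0"
    and t: "t > 0"
begin

lemma euler_along_path_converges:
  assumes "\<omega> \<in> \<Omega>" "j < d"
  shows "(\<lambda>K. euler d G (t / real K) (\<lambda>l. r (real l * (t / real K)) \<omega>) z0 K j) \<longlonglongrightarrow> z \<omega> t j"
proof -
  have \<omega>: "\<omega> \<in> space (M i)" using assms(1) \<Omega> sets.sets_into_space by blast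
  show ?thesis
    using euler_converges[of d G "\<lambda>t. r t \<omega>" "z \<omega>" N c t j] path[OF assms(1)] G c t assms(2)
      mode_less[OF mp iN t _ \<omega>] by simp
qed

lemma euler_measurable:
  assumes h: "h > 0"
  shows "(\<lambda>\<omega>. F (r (real K * h) \<omega>) (euler d G h (\<lambda>l. r (real l * h) \<omega>) z0 K) :: 'c::{banach, second_countable_topology}) \<in> borel_measurable (M i)"
proof -
  have "euler d G h (history r h K \<omega>) z0 K = euler d G h (\<lambda>l. r (real l * h) \<omega>) z0 K" for \<omega>
    by (rule euler_cong) (simp add: history_def)
  then show ?thesis
    using integral_history(1)[OF mp iN h, of "\<lambda>s. F (s K) (euler d G h s z0 K)" K, THEN borel_measurable_integrable]
    by (simp add: history_def)
qed

text \<open>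
  Trajectories are chosen path by path; they are measurable as pointwise limits of Euler schemes, which
  depend on finitely many values of the process.
\<close>

lemma traj_measurable:
  assumes j: "j < d"
  shows "(\<lambda>\<omega>. if \<omega> \<in> \<Omega> then z \<omega> t j else 0) \<in> borel_measurable (M i)"
proof (rule borel_measurable_LIMSEQ_real)
  fix K
  let ?h = "t / real (Suc K)"
  show "(\<lambda>\<omega>. indicator \<Omega> \<omega> * euler d G ?h (\<lambda>l. r (real l * ?h) \<omega>) z0 (Suc K) j) \<in> borel_measurable (M i)"
    using \<Omega> t by (intro borel_measurable_times borel_measurable_indicator euler_measurable[of _ "\<lambda>_ z. z j"]) auto
next
  fix \<omega>
  show "(\<lambda>K. indicator \<Omega> \<omega> * euler d G (t / real (Suc K)) (\<lambda>l. r (real l * (t / real (Suc K))) \<omega>) z0 (Suc K) j)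
     \<longlonglongrightarrow> (if \<omega> \<in> \<Omega> then z \<omega> t j else 0)"
  proof (cases "\<omega> \<in> \<Omega>")
    case True
    from LIMSEQ_Suc[OF euler_along_path_converges[OF True j]] True show ?thesis by simp
  qed simp
qed

text \<open>
  Passage to the limit in the discrete bound.  The loss after \<open>K\<close> steps of length \<open>t/K\<close> is at most \<open>t \<epsilon>\<close>, and
  the Euler schemes stay in a ball of radius \<open>R\<close> independent of \<open>K\<close>, which is the bounded set for
  the one-step estimate; \<open>R^p\<close> is the dominating constant.
\<close>

lemma moment_lower_bound:
  fixes f :: "nat \<Rightarrow> (nat \<Rightarrow> real) \<Rightarrow> complex"
  assumes full: "AE \<omega> in M i. \<omega> \<in> \<Omega>" and \<mu>: "Re \<mu> \<ge> 0"
    and step: "\<And>R \<epsilon>. \<epsilon> > 0 \<Longrightarrow> \<forall>\<^sub>F h in at_right 0. \<forall>i<N. \<forall>z. (\<forall>j<d. \<bar>z j\<bar> \<le> R) \<longrightarrow>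
     cmod ((\<Sum>j<N. of_real (trans_prob M r h i j) * f j (\<lambda>a. z a + h * mulv d (G i) z a)) - (1 + \<mu> * of_real h) * f i z) \<le> \<epsilon> * h"
    and f: "\<And>j z. j < N \<Longrightarrow> cmod (f j z) \<le> C * l1norm d z ^ p" and C: "C \<ge> 0"
  shows "ennreal (cmod (f i z0)) \<le> ennreal C * (\<integral>\<^sup>+ \<omega>. ennreal (l1norm d (\<lambda>j. if \<omega> \<in> \<Omega> then z \<omega> t j else 0) ^ p) \<partial>M i)"
proof -
  interpret prob_space "M i" using mp iN by (auto simp: markov_process_def)
  define E where "E K \<omega> = euler d G (t / real K) (\<lambda>l. r (real l * (t / real K)) \<omega>) z0 K" for K \<omega>
  define R where "R = exp (t * (real d * c)) * l1norm d z0"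
  have R0: "R \<ge> 0" by (simp add: R_def)
  define Z where "Z \<omega> = l1norm d (\<lambda>j. if \<omega> \<in> \<Omega> then z \<omega> t j else 0) ^ p" for \<omega>
  have Z: "Z \<in> borel_measurable (M i)" "\<And>\<omega>. Z \<omega> \<ge> 0"
    unfolding Z_def[abs_def] l1norm_def using traj_measurable by (auto intro!: borel_measurable_power borel_measurable_sum borel_measurable_abs sum_nonneg zero_le_power)
  have eb: "l1norm d (euler d G (t / real K) s z0 l) \<le> R" if "K > 0" "l \<le> K" "\<And>m. s m < N" for s K l
  proof -
    have "l1norm d (euler d G (t / real K) s z0 l) \<le> exp (real l * (t / real K) * (real d * c)) * l1norm d z0"
      using G that t c by (intro l1norm_euler) auto
    also have "\<dots> \<le> R"
    proof -
      have "real l * (t / real K) \<le> t" using that t by (simp add: field_simps)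
      then have "real l * (t / real K) * (real d * c) \<le> t * (real d * c)"
        by (rule mult_right_mono) (use c in simp)
      from iffD2[OF exp_le_cancel_iff this] show ?thesis
        unfolding R_def by (rule mult_right_mono) simp
    qed
    finally show ?thesis .
  qed
  have mN: "r s \<omega> < N" if "\<omega> \<in> space (M i)" "s \<ge> 0" for \<omega> s using mode_less[OF mp iN t that(2,1)] .
  have EZ: "(\<lambda>K. l1norm d (E (Suc K) \<omega>) ^ p) \<longlonglongrightarrow> Z \<omega>" if "\<omega> \<in> \<Omega>" for \<omega>
    unfolding Z_def l1norm_def E_def using that LIMSEQ_Suc[OF euler_along_path_converges[OF that]]
    by (auto intro!: tendsto_intros)
  have Em: "(\<lambda>\<omega>. l1norm d (E (Suc K) \<omega>) ^ p) \<in> borel_measurable (M i)" for K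
    unfolding E_def using t euler_measurable[of "t / real (Suc K)" "\<lambda>_ z. l1norm d z ^ p" "Suc K"] by simp
  have Eb: "l1norm d (E (Suc K) \<omega>) ^ p \<le> R ^ p" if "\<omega> \<in> space (M i)" for K \<omega>
    unfolding E_def using that t by (intro power_mono eb mN) auto
  have lim: "(\<lambda>K. \<integral>\<omega>. l1norm d (E (Suc K) \<omega>) ^ p \<partial>M i) \<longlonglongrightarrow> (\<integral>\<omega>. Z \<omega> \<partial>M i)"
  proof (rule integral_dominated_convergence[where w = "\<lambda>_. R ^ p"])
    show "AE \<omega> in M i. (\<lambda>K. l1norm d (E (Suc K) \<omega>) ^ p) \<longlonglongrightarrow> Z \<omega>"
      using full by eventually_elim (rule EZ)
    show "AE \<omega> in M i. norm (l1norm d (E (Suc K) \<omega>) ^ p) \<le> R ^ p" for K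
      using Eb by (intro AE_I2) simp
  qed (use Z Em in auto)
  have intZ: "integrable (M i) Z"
  proof (rule integrable_dominated_convergence[where w = "\<lambda>_. R ^ p"])
    show "AE \<omega> in M i. (\<lambda>K. l1norm d (E (Suc K) \<omega>) ^ p) \<longlonglongrightarrow> Z \<omega>"
      using full by eventually_elim (rule EZ)
    show "AE \<omega> in M i. norm (l1norm d (E (Suc K) \<omega>) ^ p) \<le> R ^ p" for K
      using Eb by (intro AE_I2) simp
  qed (use Z Em in auto)
  have main: "cmod (f i z0) - t * \<epsilon> \<le> C * (\<integral>\<omega>. Z \<omega> \<partial>M i)" if \<epsilon>: "\<epsilon> > 0" for \<epsilon>
  proof (rule LIMSEQ_le_const)
    show "(\<lambda>K. C * (\<integral>\<omega>. l1norm d (E (Suc K) \<omega>) ^ p \<partial>M i)) \<longlonglongrightarrow> C * (\<integral>\<omega>. Z \<omega> \<partial>M i)"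
      by (intro tendsto_intros lim)
    have "filterlim (\<lambda>K. t / real (Suc K)) (at_right 0) sequentially"
      unfolding filterlim_at using t LIMSEQ_Suc[OF lim_const_over_n[of t]] by auto
    from eventually_compose_filterlim[OF step[OF \<epsilon>, of R] this]
    obtain K0 where K0: "\<And>K i z. K \<ge> K0 \<Longrightarrow> i < N \<Longrightarrow> (\<forall>j<d. \<bar>z j\<bar> \<le> R) \<Longrightarrow>
     cmod ((\<Sum>j<N. of_real (trans_prob M r (t / real (Suc K)) i j) * f j (\<lambda>a. z a + t / real (Suc K) * mulv d (G i) z a)) - (1 + \<mu> * of_real (t / real (Suc K))) * f i z)
        \<le> \<epsilon> * (t / real (Suc K))"
      unfolding eventually_sequentially by blast
    show "\<exists>K0. \<forall>K\<ge>K0. cmod (f i z0) - t * \<epsilon> \<le> C * (\<integral>\<omega>. l1norm d (E (Suc K) \<omega>) ^ p \<partial>M i)"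
    proof (intro exI allI impI)
      fix K assume K: "K \<ge> K0"
      let ?h = "t / real (Suc K)"
      have h: "?h > 0" "real (Suc K) * ?h = t" using t by auto
      have box: "\<forall>j<d. \<bar>euler d G ?h s z0 l j\<bar> \<le> R" if "\<And>m. s m < N" "l \<le> Suc K" for s l
        using eb[of "Suc K" l s] that abs_le_l1norm order_trans by blast
      have "cmod (f i z0) - real (Suc K) * (\<epsilon> * ?h)
         \<le> cmod (\<integral>\<omega>. f (r (real (Suc K) * ?h) \<omega>) (E (Suc K) \<omega>) \<partial>M i)"
        unfolding E_def by (rule discrete_moment_lower_bound[OF mp iN h(1) \<mu> K0[OF K] box])
      also have "\<dots> \<le> (\<integral>\<omega>. cmod (f (r (real (Suc K) * ?h) \<omega>) (E (Suc K) \<omega>)) \<partial>M i)"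
        by (rule integral_norm_bound)
      also have "\<dots> \<le> (\<integral>\<omega>. C * l1norm d (E (Suc K) \<omega>) ^ p \<partial>M i)"
      proof (rule integral_mono')
        show "integrable (M i) (\<lambda>\<omega>. C * l1norm d (E (Suc K) \<omega>) ^ p)"
          using Em Eb C R0 by (intro integrable_mult_right integrable_const_bound[where B = "R ^ p"] AE_I2) auto
        fix \<omega> assume "\<omega> \<in> space (M i)"
        then show "cmod (f (r (real (Suc K) * ?h) \<omega>) (E (Suc K) \<omega>)) \<le> C * l1norm d (E (Suc K) \<omega>) ^ p"
          using t by (intro f mN) auto
      qed (use C in auto)
      finally show "cmod (f i z0) - t * \<epsilon> \<le> C * (\<integral>\<omega>. l1norm d (E (Suc K) \<omega>) ^ p \<partial>M i)"
        using h(2) by (simp add: mult.commute)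
    qed
  qed
  have "cmod (f i z0) \<le> C * (\<integral>\<omega>. Z \<omega> \<partial>M i)"
  proof (rule field_le_epsilon)
    fix e :: real assume "e > 0"
    then show "cmod (f i z0) \<le> C * (\<integral>\<omega>. Z \<omega> \<partial>M i) + e" using main[of "e / t"] t by simp
  qed
  then have "ennreal (cmod (f i z0)) \<le> ennreal (C * (\<integral>\<omega>. Z \<omega> \<partial>M i))" by (rule ennreal_leI)
  also have "\<dots> = ennreal C * ennreal (\<integral>\<omega>. Z \<omega> \<partial>M i)" using C Z by (intro ennreal_mult) auto
  also have "ennreal (\<integral>\<omega>. Z \<omega> \<partial>M i) = (\<integral>\<^sup>+ \<omega>. ennreal (Z \<omega>) \<partial>M i)"
    using intZ Z by (intro nn_integral_eq_integral[symmetric]) auto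
  finally show ?thesis by (simp only: Z_def)
qed

end

section \<open>Instability\<close>

lemma power_sum_le:
  fixes e :: "nat \<Rightarrow> real"
  assumes "m > 0" "\<And>k. k < m \<Longrightarrow> e k \<ge> 0"
  shows "(\<Sum>k<m. e k) ^ p \<le> real m ^ p * (\<Sum>k<m. e k ^ p)"
proof -
  define M where "M = Max (e ` {..<m})"
  have "M \<in> e ` {..<m}" unfolding M_def using assms(1) by (intro Max_in) auto
  then obtain k where k: "k < m" "M = e k" by auto
  have "(\<Sum>k<m. e k) \<le> (\<Sum>k<m. M)" by (intro sum_mono) (auto simp: M_def)
  then have "(\<Sum>k<m. e k) ^ p \<le> (real m * M) ^ p" using assms by (intro power_mono sum_nonneg) auto
  also have "\<dots> = real m ^ p * e k ^ p" by (simp add: power_mult_distrib k)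
  also have "\<dots> \<le> real m ^ p * (\<Sum>k<m. e k ^ p)"
    using k assms by (intro mult_left_mono member_le_sum) auto
  finally show ?thesis .
qed

lemma eucl_norm_nonneg [simp]: "0 \<le> eucl_norm v"
  by (simp add: eucl_norm_def sum_nonneg)

lemma l1norm_le_eucl_norm: "l1norm n x \<le> real n * eucl_norm (vec n x)"
proof -
  have "\<bar>x j\<bar> \<le> eucl_norm (vec n x)" if "j < n" for j
  proof -
    have "(x j)\<^sup>2 \<le> (\<Sum>j<n. (x j)\<^sup>2)" using that by (intro member_le_sum) auto
    then have "sqrt ((x j)\<^sup>2) \<le> sqrt (\<Sum>j<n. (x j)\<^sup>2)" by (rule real_sqrt_le_mono)
    then show ?thesis by (simp add: eucl_norm_def)
  qed
  then have "l1norm n x \<le> (\<Sum>j<n. eucl_norm (vec n x))" unfolding l1norm_def by (intro sum_mono) auto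
  then show ?thesis by simp
qed

lemma l1norm_tensor: "l1norm (m * n) (\<lambda>j. \<Sum>k<K. y k (j div n) * x k (j mod n)) \<le> (\<Sum>k<K. l1norm m (y k) * l1norm n (x k))"
proof -
  have "l1norm (m * n) (\<lambda>j. \<Sum>k<K. y k (j div n) * x k (j mod n)) = (\<Sum>a<m. \<Sum>b<n. \<bar>\<Sum>k<K. y k a * x k b\<bar>)"
    unfolding l1norm_def sum_nat_pairs by (intro sum.cong refl) simp
  also have "\<dots> \<le> (\<Sum>a<m. \<Sum>b<n. \<Sum>k<K. \<bar>y k a\<bar> * \<bar>x k b\<bar>)"
    by (intro sum_mono order_trans[OF sum_abs]) (simp add: abs_mult)
  also have "\<dots> = (\<Sum>a<m. \<Sum>k<K. \<Sum>b<n. \<bar>y k a\<bar> * \<bar>x k b\<bar>)"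
    by (intro sum.cong refl sum.swap)
  also have "\<dots> = (\<Sum>k<K. \<Sum>a<m. \<Sum>b<n. \<bar>y k a\<bar> * \<bar>x k b\<bar>)" by (rule sum.swap)
  also have "\<dots> = (\<Sum>k<K. l1norm m (y k) * l1norm n (x k))"
    unfolding l1norm_def sum_product ..
  finally show ?thesis .
qed

theorem theorem1:
  fixes n N m p :: nat
    and A W :: "nat \<Rightarrow> real mat"
    and Q :: "real mat"
    and M :: "nat \<Rightarrow> 'a measure"
    and r :: "real \<Rightarrow> 'a \<Rightarrow> nat"
  assumes "n > 0" and "N > 0" and "m > 0" and "p > 0"
    and "\<And>i. i < N \<Longrightarrow> A i \<in> carrier_mat n n"
    and "markov_process M r N Q"
    and "\<And>i. i < N \<Longrightarrow> W i \<in> carrier_mat m m"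
    and "switched_stable m N W"
    and "\<not> hurwitz_stable
           (kron (transpose_mat Q) (1\<^sub>m (num_monomials (m * n) p))
            + diag_block_mat (map (\<lambda>i. mat_power_lift p (kron_sum (W i) (A i))) [0..<N]))"
  shows "\<not> exp_mean_stable p n N A M r"
proof
  assume stable: "exp_mean_stable p n N A M r"
  note A = assms(5) and mp = assms(6) and W = assms(7)
  define d where "d = m * n"
  define D where "D = num_monomials d p"
  define G where "G = entries (\<lambda>i. kron_sum (W i) (A i))"
  define B where "B i = mat_power_lift p (kron_sum (W i) (A i))" for i
  have lift: "B i \<in> carrier_mat D D"
    "b < D \<Longrightarrow> derivation d (G i) (\<lambda>z. vpow d p z b) (\<lambda>z. \<Sum>c<D. B i $$ (b, c) * vpow d p z c)" if "i < N" for i b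
    using mat_power_lift_derivation[OF kron_sum_carrier[OF W[OF that] A[OF that]]]
    by (auto simp: B_def D_def d_def G_def)
  obtain \<mu> and v :: "nat \<Rightarrow> nat \<Rightarrow> complex" and i0 b0 where \<mu>: "Re \<mu> \<ge> 0" and v: "i0 < N" "b0 < D" "v i0 b0 \<noteq> 0"
    and eigen: "\<And>i b. i < N \<Longrightarrow> b < D \<Longrightarrow>
       (\<Sum>j<N. of_real (Q $$ (i, j)) * v j b) + (\<Sum>c<D. of_real (B i $$ (c, b)) * v i c) = \<mu> * v i b"
  proof (rule generator_left_eigenvector)
    show "Q \<in> carrier_mat N N" using mp by (simp add: markov_process_def)
    show "\<not> hurwitz_stable (kron (transpose_mat Q) (1\<^sub>m D) + diag_block_mat (map B [0..<N]))"
      using assms(9) unfolding B_def[abs_def] D_def d_def by -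
  qed (use lift in auto)
  \<comment> \<open>The eigenfunction of the generator; the equation \<open>eigen\<close> for the coefficients says that it is one.\<close>
  define f where "f i z = (\<Sum>b<D. v i b * of_real (vpow d p z b))" for i z
  have step: "\<forall>\<^sub>F h in at_right 0. \<forall>i<N. \<forall>z. (\<forall>j<d. \<bar>z j\<bar> \<le> R) \<longrightarrow>
     cmod ((\<Sum>j<N. of_real (trans_prob M r h i j) * f j (\<lambda>a. z a + h * mulv d (G i) z a)) - (1 + \<mu> * of_real h) * f i z) \<le> \<epsilon> * h"
    if "\<epsilon> > 0" for R \<epsilon>
    unfolding f_def
  proof (rule generator_step[OF lift(2) _ _ _ _ that])
    show "homog d p (\<lambda>z. vpow d p z b)" if "b < D" for b using homog_vpow that by (simp add: D_def)
    then show "homog d p (\<lambda>z. \<Sum>c<D. B i $$ (b, c) * vpow d p z c)" for i b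
      by (intro homog_sum homog_scale) auto
    show "((\<lambda>h. (trans_prob M r h i j - (if i = j then 1 else 0)) / h) \<longlongrightarrow> Q $$ (i, j)) (at_right 0)" if "i < N" "j < N" for i j
      using mp that by (simp add: markov_process_def trans_prob_def)
    fix i and z :: "nat \<Rightarrow> real" assume i: "i < N"
    have "(\<Sum>j<N. of_real (Q $$ (i, j)) * (\<Sum>b<D. v j b * of_real (vpow d p z b)))
        + (\<Sum>b<D. v i b * of_real (\<Sum>c<D. B i $$ (b, c) * vpow d p z c))
       = (\<Sum>b<D. \<Sum>j<N. of_real (Q $$ (i, j)) * v j b * of_real (vpow d p z b))
        + (\<Sum>c<D. \<Sum>b<D. of_real (B i $$ (b, c)) * v i b * of_real (vpow d p z c))"
      unfolding sum_distrib_left of_real_sum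
      by (subst sum.swap[of _ "{..<D}" "{..<N}"], subst (3) sum.swap) (simp add: mult_ac)
    also have "\<dots> = (\<Sum>b<D. ((\<Sum>j<N. of_real (Q $$ (i, j)) * v j b) + (\<Sum>c<D. of_real (B i $$ (c, b)) * v i c)) * of_real (vpow d p z b))"
      by (simp add: sum.distrib distrib_right sum_distrib_right)
    also have "\<dots> = \<mu> * (\<Sum>b<D. v i b * of_real (vpow d p z b))"
      using eigen[OF i] by (simp add: sum_distrib_left mult.assoc)
    finally show "(\<Sum>j<N. of_real (Q $$ (i, j)) * (\<Sum>b<D. v j b * of_real (vpow d p z b)))
        + (\<Sum>b<D. v i b * of_real (\<Sum>c<D. B i $$ (b, c) * vpow d p z c)) = \<mu> * (\<Sum>b<D. v i b * of_real (vpow d p z b))" .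
  qed
  obtain cv where cv: "cv \<ge> 0" "\<And>z b. b < D \<Longrightarrow> \<bar>vpow d p z b\<bar> \<le> cv * l1norm d z ^ p"
    using vpow_bound[of d p] unfolding D_def by blast
  define Cf where "Cf = (\<Sum>i<N. \<Sum>b<D. cmod (v i b) * cv)"
  have Cf0: "Cf \<ge> 0" unfolding Cf_def using cv by (intro sum_nonneg) auto
  have fb: "cmod (f j z) \<le> Cf * l1norm d z ^ p" if "j < N" for j z
  proof -
    have "cmod (f j z) \<le> (\<Sum>b<D. (cmod (v j b) * cv) * l1norm d z ^ p)" unfolding f_def
      using cv(2) by (intro order_trans[OF norm_sum] sum_mono) (auto simp: norm_mult mult.assoc intro!: mult_left_mono)
    also have "\<dots> = (\<Sum>b<D. cmod (v j b) * cv) * l1norm d z ^ p" by (rule sum_distrib_right[symmetric])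
    also have "\<dots> \<le> Cf * l1norm d z ^ p"
    proof (rule mult_right_mono)
      show "(\<Sum>b<D. cmod (v j b) * cv) \<le> Cf" unfolding Cf_def
        by (rule member_le_sum[where f = "\<lambda>i. \<Sum>b<D. cmod (v i b) * cv"]) (use that cv in \<open>auto intro!: sum_nonneg\<close>)
    qed simp
    finally show ?thesis .
  qed
  obtain Cs \<beta> where Cs: "Cs > 0" "\<beta> > 0"
    "\<And>x0 i x t. x0 \<in> carrier_vec n \<Longrightarrow> i < N \<Longrightarrow> (AE \<omega> in M i. switched_solution A (\<lambda>t. r t \<omega>) x0 (\<lambda>t. x t \<omega>)) \<Longrightarrow> t \<ge> 0 \<Longrightarrow>
       (\<integral>\<^sup>+ \<omega>. ennreal (eucl_norm (x t \<omega>) ^ p) \<partial>M i) \<le> ennreal (Cs * exp (- \<beta> * t) * eucl_norm x0 ^ p)"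
    using stable unfolding exp_mean_stable_def by blast
  obtain Cw where Cw: "Cw > 0" "\<And>y0 \<sigma> y t. y0 \<in> carrier_vec m \<Longrightarrow> (\<forall>t\<ge>0. \<sigma> t < N) \<Longrightarrow> piecewise_constant \<sigma> \<Longrightarrow>
      switched_solution W \<sigma> y0 y \<Longrightarrow> t \<ge> 0 \<Longrightarrow> eucl_norm (y t) \<le> Cw * eucl_norm y0"
    using assms(8) unfolding switched_stable_def by blast
  have Gbound: "\<exists>c\<ge>0. \<forall>i<N. \<forall>a<k. \<forall>b<k. \<bar>H i a b\<bar> \<le> c" for H :: "nat \<Rightarrow> nat \<Rightarrow> nat \<Rightarrow> real" and k
  proof -
    obtain K where "K \<ge> 0" "\<And>i a. i < N \<Longrightarrow> a < k \<Longrightarrow> \<forall>b<k. \<bar>H i a b\<bar> \<le> K"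
    proof (rule uniform_constant[of N k "\<lambda>i a K. \<forall>b<k. \<bar>H i a b\<bar> \<le> K"])
      fix i a
      show "\<exists>K\<ge>0. \<forall>b<k. \<bar>H i a b\<bar> \<le> K"
        by (intro exI[of _ "\<Sum>b<k. \<bar>H i a b\<bar>"] conjI sum_nonneg allI impI member_le_sum) auto
    qed (auto intro: order_trans)
    then show ?thesis by blast
  qed
  \<comment> \<open>The moments of \<open>f\<close> decay with those of \<open>\<parallel>z(t)\<parallel>^p\<close>, yet stay above \<open>\<bar>f i z0\<bar>\<close>.\<close>
  have f_zero: "f i z0 = 0" if i: "i < N" for i z0
  proof -
    interpret prob_space "M i" using mp i by (auto simp: markov_process_def)
    have "AE \<omega> in M i. piecewise_constant (\<lambda>t. r t \<omega>)" using mp i by (simp add: markov_process_def)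
    then obtain N0 where N0: "{\<omega> \<in> space (M i). \<not> piecewise_constant (\<lambda>t. r t \<omega>)} \<subseteq> N0" "N0 \<in> null_sets (M i)"
      by (auto elim!: AE_E simp: null_sets_def)
    define \<Omega> where "\<Omega> = space (M i) - N0"
    have \<Omega>: "\<Omega> \<in> sets (M i)" "\<Omega> \<subseteq> space (M i)" using N0(2) by (auto simp: \<Omega>_def)
    have full: "AE \<omega> in M i. \<omega> \<in> \<Omega>"
      using AE_not_in[OF N0(2)] by (rule AE_mp) (auto simp: \<Omega>_def)
    have pc: "piecewise_constant (\<lambda>t. r t \<omega>)" if "\<omega> \<in> \<Omega>" for \<omega> using that N0(1) by (auto simp: \<Omega>_def)
    have modes: "r t \<omega> < N" if "\<omega> \<in> \<Omega>" "t \<ge> 0" for t \<omega>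
      using mode_less[OF mp i _ that(2), of 1 \<omega>] that(1) \<Omega>(2) by auto
    \<comment> \<open>The decomposition \<open>z0 = \<Sum>\<^sub>k e\<^sub>k \<otimes> x0\<^sub>k\<close>.\<close>
    define x0 where "x0 k b = z0 (k * n + b)" for k b
    define y0 where "y0 k a = (if a = k then 1 else 0 :: real)" for k a :: nat
    define x where "x k \<omega> = glued n (entries A) (\<lambda>t. r t \<omega>) (x0 k)" for k \<omega>
    define y where "y k \<omega> = glued m (entries W) (\<lambda>t. r t \<omega>) (y0 k)" for k \<omega>
    have x: "traj n (entries A) (\<lambda>t. r t \<omega>) (x k \<omega>)" "x k \<omega> 0 = x0 k" if "\<omega> \<in> \<Omega>" for \<omega> k
      unfolding x_def using traj_glued[OF pc[OF that]] glued_zero by auto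
    have y: "traj m (entries W) (\<lambda>t. r t \<omega>) (y k \<omega>)" "y k \<omega> 0 = y0 k" if "\<omega> \<in> \<Omega>" for \<omega> k
      unfolding y_def using traj_glued[OF pc[OF that]] glued_zero by auto
    define z where "z \<omega> t j = (\<Sum>k<m. y k \<omega> t (j div n) * x k \<omega> t (j mod n))" for \<omega> t j
    \<comment> \<open>\<open>z1\<close> agrees with \<open>z0\<close> on the indices below \<open>d\<close>, the only ones that \<open>f\<close> depends on.\<close>
    define z1 where "z1 j = (\<Sum>k<m. y0 k (j div n) * x0 k (j mod n))" for j
    have z: "traj d G (\<lambda>t. r t \<omega>) (z \<omega>)" "z \<omega> 0 = z1" if "\<omega> \<in> \<Omega>" for \<omega>
    proof -
      show "traj d G (\<lambda>t. r t \<omega>) (z \<omega>)"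
        unfolding z_def d_def G_def using x(1)[OF that] y(1)[OF that] modes[OF that] A W
        by (intro traj_tensor[of N]) auto
      show "z \<omega> 0 = z1" using x(2)[OF that] y(2)[OF that] by (auto simp: z_def z1_def)
    qed
    have "f i z1 = f i z0"
    proof -
      have "z1 j = z0 j" if "j < d" for j
      proof -
        have "j div n < m" using that assms(1) by (simp add: d_def div_less_iff_less_mult)
        then show ?thesis by (simp add: z1_def y0_def x0_def if_distrib[of "\<lambda>u. u * _"] cong: if_cong)
      qed
      then show ?thesis by (simp add: f_def vpow_def monomial_def)
    qed
    \<comment> \<open>Set to 0 off \<open>\<Omega>\<close>, where paths may be wild, to keep the solution measurable.\<close>
    define X where "X k t \<omega> = vec n (if \<omega> \<in> \<Omega> then x k \<omega> t else (\<lambda>_. 0))" for k t \<omega>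
    define Y where "Y = (\<Sum>k<m. real m * (Cw * eucl_norm (vec m (y0 k))))"
    have Y0: "Y \<ge> 0" unfolding Y_def using Cw by (intro sum_nonneg) auto
    have yb: "l1norm m (y k \<omega> t) \<le> Y" if "\<omega> \<in> \<Omega>" "t \<ge> 0" "k < m" for k \<omega> t
    proof -
      have "switched_solution W (\<lambda>t. r t \<omega>) (vec m (y0 k)) (\<lambda>t. vec m (y k \<omega> t))"
        using y[OF that(1)] modes[OF that(1)] W by (intro traj_switched_solution[of N]) auto
      then have "eucl_norm (vec m (y k \<omega> t)) \<le> Cw * eucl_norm (vec m (y0 k))"
        using modes[OF that(1)] pc[OF that(1)] that(2) by (intro Cw(2)[of _ "\<lambda>t. r t \<omega>" "\<lambda>t. vec m (y k \<omega> t)"]) auto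
      then have "l1norm m (y k \<omega> t) \<le> real m * (Cw * eucl_norm (vec m (y0 k)))"
        using l1norm_le_eucl_norm[of m "y k \<omega> t"] mult_left_mono[of _ _ "real m"] by fastforce
      also have "\<dots> \<le> Y" unfolding Y_def using that(3) Cw by (intro member_le_sum) auto
      finally show ?thesis .
    qed
    have xs: "AE \<omega> in M i. switched_solution A (\<lambda>t. r t \<omega>) (vec n (x0 k)) (\<lambda>t. X k t \<omega>)" for k
      using full
    proof eventually_elim
      case (elim \<omega>)
      then show ?case unfolding X_def using x[OF elim] modes[OF elim] A
        by (simp, intro traj_switched_solution[of N]) auto
    qed
    define c0 where "c0 = (Y * real n) ^ p * real m ^ p"
    have c00: "c0 \<ge> 0" using Y0 by (simp add: c0_def)
    have zb: "l1norm d (\<lambda>j. if \<omega> \<in> \<Omega> then z \<omega> t j else 0) ^ p \<le> (\<Sum>k<m. c0 * eucl_norm (X k t \<omega>) ^ p)" if t: "t > 0" for \<omega> t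
    proof (cases "\<omega> \<in> \<Omega>")
      case True
      have "l1norm d (z \<omega> t) \<le> (\<Sum>k<m. l1norm m (y k \<omega> t) * l1norm n (x k \<omega> t))"
        unfolding z_def d_def by (rule l1norm_tensor)
      also have "\<dots> \<le> (\<Sum>k<m. Y * (real n * eucl_norm (X k t \<omega>)))"
        using True t yb Y0 l1norm_le_eucl_norm by (intro sum_mono mult_mono) (auto simp: X_def)
      also have "\<dots> = (Y * real n) * (\<Sum>k<m. eucl_norm (X k t \<omega>))" by (simp add: sum_distrib_left mult_ac)
      finally have "l1norm d (z \<omega> t) ^ p \<le> ((Y * real n) * (\<Sum>k<m. eucl_norm (X k t \<omega>))) ^ p"
        by (intro power_mono) auto
      also have "\<dots> \<le> (Y * real n) ^ p * (real m ^ p * (\<Sum>k<m. eucl_norm (X k t \<omega>) ^ p))"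
        unfolding power_mult_distrib[of "Y * real n"] using assms(3) Y0 by (intro mult_left_mono power_sum_le) auto
      finally show ?thesis using True by (simp add: c0_def sum_distrib_left mult_ac)
    next
      case False
      then show ?thesis using assms(4) c00 by (simp add: l1norm_def zero_power sum_nonneg)
    qed
    obtain c where c: "c \<ge> 0" "\<forall>i<N. \<forall>a<d. \<forall>b<d. \<bar>G i a b\<bar> \<le> c" using Gbound by blast
    obtain c' where c': "c' \<ge> 0" "\<forall>i<N. \<forall>a<n. \<forall>b<n. \<bar>entries A i a b\<bar> \<le> c'" using Gbound[of n "entries A"] by blast
    define K where "K = Cf * (\<Sum>k<m. c0 * (Cs * eucl_norm (vec n (x0 k)) ^ p))"
    have decay: "cmod (f i z0) \<le> K * exp (- \<beta> * t)" if t: "t > 0" for t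
    proof -
      have Xm: "(\<lambda>\<omega>. ennreal (eucl_norm (X k t \<omega>) ^ p)) \<in> borel_measurable (M i)" for k
      proof -
        have "(\<lambda>\<omega>. if \<omega> \<in> \<Omega> then x k \<omega> t j else 0) \<in> borel_measurable (M i)" if "j < n" for j
          by (rule traj_measurable[OF mp i \<Omega>(1) c'(2,1) _ t that, of "x k" "x0 k"]) (use pc x in auto)
        then have "(\<lambda>\<omega>. X k t \<omega> $ j) \<in> borel_measurable (M i)" if "j < n" for j
          using that by (simp add: X_def if_distrib[of "\<lambda>f. f j"])
        then show ?thesis unfolding eucl_norm_def by (simp add: X_def)
      qed
      have "ennreal (cmod (f i z1)) \<le> ennreal Cf * (\<integral>\<^sup>+ \<omega>. ennreal (l1norm d (\<lambda>j. if \<omega> \<in> \<Omega> then z \<omega> t j else 0) ^ p) \<partial>M i)"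
        by (rule moment_lower_bound[OF mp i \<Omega>(1) c(2,1) _ t full \<mu> step fb Cf0]) (use pc z in auto)
      also have "\<dots> \<le> ennreal Cf * (\<integral>\<^sup>+ \<omega>. (\<Sum>k<m. ennreal c0 * ennreal (eucl_norm (X k t \<omega>) ^ p)) \<partial>M i)"
        using zb[OF t] c00 by (intro mult_left_mono nn_integral_mono) (auto simp: ennreal_mult[symmetric] sum_nonneg intro!: ennreal_leI)
      also have "\<dots> = ennreal Cf * (\<Sum>k<m. ennreal c0 * (\<integral>\<^sup>+ \<omega>. ennreal (eucl_norm (X k t \<omega>) ^ p) \<partial>M i))"
        using Xm by (simp add: nn_integral_sum nn_integral_cmult)
      also have "\<dots> \<le> ennreal Cf * (\<Sum>k<m. ennreal c0 * ennreal (Cs * exp (- \<beta> * t) * eucl_norm (vec n (x0 k)) ^ p))"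
        using t by (intro mult_left_mono sum_mono Cs(3)[OF _ i xs]) auto
      also have "\<dots> = ennreal (Cf * (\<Sum>k<m. c0 * (Cs * exp (- \<beta> * t) * eucl_norm (vec n (x0 k)) ^ p)))"
        using c00 Cs(1) Cf0 by (simp add: ennreal_mult[symmetric] sum_nonneg)
      also have "Cf * (\<Sum>k<m. c0 * (Cs * exp (- \<beta> * t) * eucl_norm (vec n (x0 k)) ^ p)) = K * exp (- \<beta> * t)"
        by (simp add: K_def sum_distrib_left sum_distrib_right mult_ac)
      finally have "ennreal (cmod (f i z1)) \<le> ennreal (K * exp (- \<beta> * t))" .
      moreover have "0 \<le> K * exp (- \<beta> * t)"
        unfolding K_def using Cf0 c00 Cs(1) by (intro mult_nonneg_nonneg sum_nonneg) auto
      ultimately show ?thesis using \<open>f i z1 = f i z0\<close> by simp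
    qed
    have "((\<lambda>t. K * exp (- \<beta> * t)) \<longlongrightarrow> K * 0) at_top"
    proof (intro tendsto_intros filterlim_compose[OF exp_at_bot])
      show "filterlim (\<lambda>t. - \<beta> * t) at_bot at_top"
        using Cs(2) by (intro filterlim_tendsto_neg_mult_at_bot[OF tendsto_const _ filterlim_ident]) auto
    qed
    then have "cmod (f i z0) \<le> K * 0"
    proof (rule tendsto_lowerbound)
      show "\<forall>\<^sub>F t in at_top. cmod (f i z0) \<le> K * exp (- \<beta> * t)"
        using eventually_gt_at_top[of "0::real"] by eventually_elim (rule decay)
    qed simp
    then show ?thesis by simp
  qed
  have "Re (v i0 b0) = 0"
  proof (rule vpow_lin_indep[where k = d and p = p and u = "\<lambda>b. Re (v i0 b)"])
    show "(\<Sum>b<num_monomials d p. Re (v i0 b) * vpow d p z b) = 0" for z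
      using arg_cong[OF f_zero[OF v(1), of z], of Re] by (simp add: f_def D_def)
  qed (use v D_def in simp)
  moreover have "Im (v i0 b0) = 0"
  proof (rule vpow_lin_indep[where k = d and p = p and u = "\<lambda>b. Im (v i0 b)"])
    show "(\<Sum>b<num_monomials d p. Im (v i0 b) * vpow d p z b) = 0" for z
      using arg_cong[OF f_zero[OF v(1), of z], of Im] by (simp add: f_def D_def)
  qed (use v D_def in simp)
  ultimately show False using v(3) by (simp add: complex_eq_iff)
qed

end
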